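(* Let $\alpha\in(0,1]$. Every boundaryless compact two-dimensional smooth Riemannian manifold $M$ admits a finite set $\mathcal{G}=\{g_1,\dots,g_s\}$ of $C^{1+\alpha}$-diffeomorphisms of $M$ that generates an action group $\langle\mathcal{G}\rangle$ which is $C^{1+\alpha}$-robustly term ergodic with respect to the normalized volume measure $\mathrm{Vol}$ on $M$.
   Context: For a finite collection $\mathcal{G}=\{g_1,\dots,g_s\}$ of diffeomorphisms of $M$, write $\mathcal{G}^{-1}=\{g_1^{-1},\dots,g_s^{-1}\}$. The action semigroup generated by $\mathcal{G}$ is $$\langle\mathcal{G}\rangle^+=\{g_{i_n}\circ\cdots\circ g_{i_1} : n\ge 1,\ i_j\in\{1,\dots,s\}\}\cup\{\mathrm{id}\},$$ and the action group generated by $\mathcal{G}$ is $\langle\mathcal{G}\rangle=\langle\mathcal{G}\cup\mathcal{G}^{-1}\rangle^+$. A measure $\mu$ is quasi-invariant if $g_*\mu$ is absolutely continuous with respect to $\mu$ for every generator $g$. $\mathrm{Vol}$ denotes the normalized Riemannian volume (total mass $1$); it is quasi-invariant under $C^1$-diffeomorphisms. Term ergodicity: an action semigroup with a given finite generating set is term ergodic with respect to a quasi-invariant probability measure $\mu$ if every measurable set $B$ with $g^{-1}(B)=B$ for every generator $g$ satisfies $\mu(B)=0$ or $\mu(B)=1$. For the action group generated by $\mathcal{G}$ the generating set is $\mathcal{G}\cup\mathcal{G}^{-1}$. Robustness: a property holds $C^{1+\alpha}$-robustly for the action group generated by $\mathcal{G}=\{g_1,\dots,g_s\}$ if it holds for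 the action group generated by every $\{f_1,\dots,f_s\}$ whose elements are $C^{1+\alpha}$-perturbations of the elements of $\mathcal{G}$, i.e. there are neighborhoods $\mathcal{U}_i$ of $g_i$ in the $C^{1+\alpha}$-topology such that it holds for all choices $f_i\in\mathcal{U}_i$.
   Formalization: The manifold M is assumed connected (and nonempty); without connectedness the claim fails, e.g. for the disjoint union of a sphere and a torus, where each component is invariant under every diffeomorphism and has volume strictly between 0 and 1. *)

theory Defs
  imports "HOL-Probability.Probability"
begin

section \<open>Smooth manifolds\<close>

text \<open>
  A manifold is an abstract topology \<open>X\<close> together with an atlas. A chart is a pair \<open>(U, \<phi>)\<close>;
  \<open>\<phi>\<close> is a total function of which only the values on \<open>U\<close> matter. Likewise only the values on
  \<open>topspace X\<close> of a self-map of the manifold matter. As charts map onto open subsets of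
  Euclidean space, all manifolds are without boundary.
\<close>

type_synonym ('a, 'n) chart = "'a set \<times> ('a \<Rightarrow> real ^ 'n)"

abbreviation chart_inv :: "('a, 'n::finite) chart \<Rightarrow> real ^ 'n \<Rightarrow> 'a" where
  "chart_inv c \<equiv> inv_into (fst c) (snd c)"

text \<open>Only meant for open \<open>S\<close>.\<close>

fun Ck_on :: "nat \<Rightarrow> 'b::euclidean_space set \<Rightarrow> ('b \<Rightarrow> 'c::real_normed_vector) \<Rightarrow> bool" where
  "Ck_on 0 S f \<longleftrightarrow> continuous_on S f"
| "Ck_on (Suc k) S f \<longleftrightarrow> (\<forall>x\<in>S. f differentiable (at x)) \<and>
     (\<forall>v. Ck_on k S (\<lambda>x. frechet_derivative f (at x) v))"

definition smooth_on :: "'b::euclidean_space set \<Rightarrow> ('b \<Rightarrow> 'c::real_normed_vector) \<Rightarrow> bool" where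
  "smooth_on S f \<longleftrightarrow> (\<forall>k. Ck_on k S f)"

definition coord_dom :: "('a, 'n::finite) chart \<Rightarrow> ('a, 'n) chart \<Rightarrow> ('a \<Rightarrow> 'a) \<Rightarrow> (real ^ 'n) set" where
  "coord_dom c d f = snd c ` (fst c \<inter> f -` fst d)"

definition coord_rep :: "('a, 'n::finite) chart \<Rightarrow> ('a, 'n) chart \<Rightarrow> ('a \<Rightarrow> 'a) \<Rightarrow> real ^ 'n \<Rightarrow> real ^ 'n" where
  "coord_rep c d f = snd d \<circ> f \<circ> chart_inv c"

definition is_chart :: "'a topology \<Rightarrow> ('a, 'n::finite) chart \<Rightarrow> bool" where
  "is_chart X c \<longleftrightarrow> openin X (fst c) \<and> open (snd c ` fst c) \<and>
     homeomorphic_map (subtopology X (fst c)) (top_of_set (snd c ` fst c)) (snd c)"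

definition smooth_atlas :: "'a topology \<Rightarrow> ('a, 'n::finite) chart set \<Rightarrow> bool" where
  "smooth_atlas X A \<longleftrightarrow> (\<forall>c\<in>A. is_chart X c) \<and> (\<Union>c\<in>A. fst c) = topspace X \<and>
     (\<forall>c\<in>A. \<forall>d\<in>A. smooth_on (coord_dom c d id) (coord_rep c d id))"

text \<open>
  Second countability is automatic, being implied by compactness. Connectedness is the usual
  convention; without it no group of diffeomorphisms need be ergodic, e.g. for the disjoint union of two
  non-homeomorphic surfaces.
\<close>

definition compact_connected_manifold :: "'a topology \<Rightarrow> ('a, 'n::finite) chart set \<Rightarrow> bool" where
  "compact_connected_manifold X A \<longleftrightarrow> Hausdorff_space X \<and> compact_space X \<and> connected_space X \<and>
     topspace X \<noteq> {} \<and> smooth_atlas X A"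


section \<open>Riemannian metrics and volume\<close>

text \<open>
  A Riemannian metric is given by its Gram matrices: \<open>G c p\<close> is the matrix of the inner product
  on the tangent space at \<open>p\<close> in the coordinates of the chart \<open>c\<close>. The last conjunct is the
  transformation law of a covariant 2-tensor.
\<close>

definition riemannian_metric ::
  "('a, 'n::finite) chart set \<Rightarrow> (('a, 'n) chart \<Rightarrow> 'a \<Rightarrow> real ^ 'n ^ 'n) \<Rightarrow> bool" where
  "riemannian_metric A G \<longleftrightarrow>
     (\<forall>c\<in>A. smooth_on (snd c ` fst c) (\<lambda>x. G c (chart_inv c x))) \<and>
     (\<forall>c\<in>A. \<forall>p\<in>fst c. transpose (G c p) = G c p \<and> (\<forall>v. v \<noteq> 0 \<longrightarrow> v \<bullet> (G c p *v v) > 0)) \<and>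
     (\<forall>c\<in>A. \<forall>d\<in>A. \<forall>p\<in>fst c \<inter> fst d.
        let J = jacobian (coord_rep c d id) (at (snd c p))
        in G c p = transpose J ** G d p ** J)"

definition is_riemannian_volume ::
  "'a topology \<Rightarrow> ('a, 'n::finite) chart set \<Rightarrow> (('a, 'n) chart \<Rightarrow> 'a \<Rightarrow> real ^ 'n ^ 'n) \<Rightarrow> 'a measure \<Rightarrow> bool" where
  "is_riemannian_volume X A G \<nu> \<longleftrightarrow>
     space \<nu> = topspace X \<and> sets \<nu> = sigma_sets (topspace X) {U. openin X U} \<and>
     (\<forall>c\<in>A. \<forall>B\<in>sets \<nu>. B \<subseteq> fst c \<longrightarrow>
        emeasure \<nu> B = (\<integral>\<^sup>+x\<in>snd c ` B. ennreal (sqrt (det (G c (chart_inv c x)))) \<partial>lborel))"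

text \<open>The volume exists and is unique on a compact manifold, as finitely many charts cover it.\<close>

definition riemannian_volume ::
  "'a topology \<Rightarrow> ('a, 'n::finite) chart set \<Rightarrow> (('a, 'n) chart \<Rightarrow> 'a \<Rightarrow> real ^ 'n ^ 'n) \<Rightarrow> 'a measure" where
  "riemannian_volume X A G = (THE \<nu>. is_riemannian_volume X A G \<nu>)"

definition normalized_volume ::
  "'a topology \<Rightarrow> ('a, 'n::finite) chart set \<Rightarrow> (('a, 'n) chart \<Rightarrow> 'a \<Rightarrow> real ^ 'n ^ 'n) \<Rightarrow> 'a measure" where
  "normalized_volume X A G = uniform_measure (riemannian_volume X A G) (topspace X)"


section \<open>Diffeomorphisms of class \<open>C\<^sup>1\<^sup>+\<^sup>\<alpha>\<close>\<close>

text \<open>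
  \<open>C\<^sup>1\<^sup>+\<^sup>\<alpha>\<close> means \<open>C\<^sup>1\<close> with \<open>\<alpha>\<close>-Hoelder derivative (so Lipschitz derivative for \<open>\<alpha> = 1\<close>). On a
  noncompact coordinate domain the Hoelder condition is imposed on compact subsets.
\<close>

definition C1a_map :: "'a topology \<Rightarrow> ('a, 'n::finite) chart set \<Rightarrow> real \<Rightarrow> ('a \<Rightarrow> 'a) \<Rightarrow> bool" where
  "C1a_map X A \<alpha> f \<longleftrightarrow> continuous_map X X f \<and>
     (\<forall>c\<in>A. \<forall>d\<in>A. let F = coord_rep c d f; DF = (\<lambda>x. jacobian F (at x)) in
        Ck_on 1 (coord_dom c d f) F \<and>
        (\<forall>K. compact K \<and> K \<subseteq> coord_dom c d f \<longrightarrow>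
           (\<exists>C. \<forall>x\<in>K. \<forall>y\<in>K. norm (DF x - DF y) \<le> C * dist x y powr \<alpha>)))"

definition C1a_diffeo :: "'a topology \<Rightarrow> ('a, 'n::finite) chart set \<Rightarrow> real \<Rightarrow> ('a \<Rightarrow> 'a) set" where
  "C1a_diffeo X A \<alpha> = {f. bij_betw f (topspace X) (topspace X) \<and>
     C1a_map X A \<alpha> f \<and> C1a_map X A \<alpha> (inv_into (topspace X) f)}"

text \<open>
  The bound \<open>\<delta>\<close> says that the \<open>C\<^sup>1\<^sup>+\<^sup>\<alpha>\<close> norm of the difference of the coordinate representations
  of \<open>f\<close> and \<open>g\<close> on \<open>K\<close> (the maximum of the sup norms of value and derivative and of the
  \<open>\<alpha>\<close>-Hoelder seminorm of the derivative) is less than \<open>\<epsilon>\<close>.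
\<close>

definition C1a_subbasic_nhd ::
  "'a topology \<Rightarrow> ('a, 'n::finite) chart set \<Rightarrow> real \<Rightarrow> ('a \<Rightarrow> 'a) \<Rightarrow>
   ('a, 'n) chart \<Rightarrow> ('a, 'n) chart \<Rightarrow> 'a set \<Rightarrow> real \<Rightarrow> ('a \<Rightarrow> 'a) set" where
  "C1a_subbasic_nhd X A \<alpha> g c d K \<epsilon> = {f \<in> C1a_diffeo X A \<alpha>. f ` K \<subseteq> fst d \<and>
     (let F = coord_rep c d f; H = coord_rep c d g;
          E = (\<lambda>x. jacobian F (at x) - jacobian H (at x))
      in \<exists>\<delta><\<epsilon>. (\<forall>x\<in>snd c ` K. norm (F x - H x) \<le> \<delta> \<and> norm (E x) \<le> \<delta>) \<and>
           (\<forall>x\<in>snd c ` K. \<forall>y\<in>snd c ` K. norm (E x - E y) \<le> \<delta> * dist x y powr \<alpha>))}"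

definition C1a_topology :: "'a topology \<Rightarrow> ('a, 'n::finite) chart set \<Rightarrow> real \<Rightarrow> ('a \<Rightarrow> 'a) topology" where
  "C1a_topology X A \<alpha> = topology_generated_by
     {C1a_subbasic_nhd X A \<alpha> g c d K \<epsilon> | g c d K \<epsilon>.
        g \<in> C1a_diffeo X A \<alpha> \<and> c \<in> A \<and> d \<in> A \<and> compactin X K \<and> K \<subseteq> fst c \<and> g ` K \<subseteq> fst d \<and> \<epsilon> > 0}"


section \<open>Term ergodicity and robustness\<close>

definition quasi_invariant :: "('a \<Rightarrow> 'a) set \<Rightarrow> 'a measure \<Rightarrow> bool" where
  "quasi_invariant S \<mu> \<longleftrightarrow> (\<forall>g\<in>S. g \<in> measurable \<mu> \<mu> \<and> absolutely_continuous \<mu> (distr \<mu> \<mu> g))"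

text \<open>
  That \<open>\<mu>\<close> is a quasi-invariant probability measure is a precondition of the notion and is
  included here as part of it. Term ergodicity of the action semigroup generated by \<open>S\<close>
  (the finite compositions of elements of \<open>S\<close>, and the identity) refers only to the
  generating set \<open>S\<close>.
\<close>

definition term_ergodic :: "('a \<Rightarrow> 'a) set \<Rightarrow> 'a measure \<Rightarrow> bool" where
  "term_ergodic S \<mu> \<longleftrightarrow> prob_space \<mu> \<and> quasi_invariant S \<mu> \<and>
     (\<forall>B\<in>sets \<mu>. (\<forall>g\<in>S. g -` B \<inter> space \<mu> = B) \<longrightarrow> measure \<mu> B = 0 \<or> measure \<mu> B = 1)"

definition group_generators :: "'a topology \<Rightarrow> ('a \<Rightarrow> 'a) set \<Rightarrow> ('a \<Rightarrow> 'a) set" where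
  "group_generators X S = S \<union> (\<lambda>g. inv_into (topspace X) g) ` S"

definition action_group_term_ergodic :: "'a topology \<Rightarrow> 'a measure \<Rightarrow> ('a \<Rightarrow> 'a) set \<Rightarrow> bool" where
  "action_group_term_ergodic X \<mu> S \<longleftrightarrow> term_ergodic (group_generators X S) \<mu>"

text \<open>The perturbation of the generator \<open>g\<close> is \<open>f g\<close>.\<close>

definition C1a_robustly ::
  "'a topology \<Rightarrow> ('a, 'n::finite) chart set \<Rightarrow> real \<Rightarrow> (('a \<Rightarrow> 'a) set \<Rightarrow> bool) \<Rightarrow> ('a \<Rightarrow> 'a) set \<Rightarrow> bool" where
  "C1a_robustly X A \<alpha> P S \<longleftrightarrow>
     (\<exists>U. (\<forall>g\<in>S. openin (C1a_topology X A \<alpha>) (U g) \<and> g \<in> U g) \<and>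
          (\<forall>f. (\<forall>g\<in>S. f g \<in> U g) \<longrightarrow> P (f ` S)))"

end

theory Submission imports Defs
begin

text \<open>
  Four of the generators act, in one chart, near a ball \<open>D\<close> of radius \<open>s\<close> almost as the contractions
  \<open>x \<mapsto> z + (9/10) (x - z) + s i\<close>, where \<open>i\<close> runs over four vectors of length \<open>1/2\<close>; their images of
  \<open>D\<close> cover \<open>D\<close> with room to spare. Away from the ball they are cut off to the identity. The other
  generators carry every point of the surface into \<open>D\<close>. Both features persist under
  \<open>C\<^sup>1\<close>-small perturbations, and the perturbed maps still have Hoelder continuous derivatives; ergodicity
  is derived from these facts alone.

  The main step is local: a set \<open>B\<close> that is invariant under the four contractions \<open>h\<^sub>i\<close> and meets \<open>D\<close>
  in positive measure has full measure in some small ball (\<open>smoothing_ifs.full_ball\<close>). Take a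
  Lipschitz partition of unity \<open>\<xi>\<^sub>i\<close> on \<open>D\<close> with \<open>\<xi>\<^sub>i\<close> supported in \<open>h\<^sub>i(D)\<close> and the transfer operator
  \<open>L \<phi> = \<Sum>\<^sub>i (\<xi>\<^sub>i \<phi>) \<circ> h\<^sub>i |det Dh\<^sub>i|\<close>. A change of variables gives \<open>\<integral> g L\<phi> = \<integral> g \<phi>\<close> for every invariant
  \<open>g\<close>, so \<open>L\<close> moves no mass between \<open>B\<close> and its complement. On the other hand \<open>L\<close> smooths. Let
  \<open>N\<^sub>r(\<phi>)\<close> be the integral over \<open>x\<close> of the oscillation of \<open>\<phi>\<close> on the ball of radius \<open>r\<close> around \<open>x\<close>. As the
  \<open>h\<^sub>i\<close> contract by \<open>\<kappa> < 1\<close> and the weights are \<open>\<alpha>\<close>-Hoelder, there is a Lasota-Yorke inequality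
  \<open>N\<^sub>r(L\<phi>) + \<integral>\<phi> \<le> (1 + C r\<^sup>\<alpha>) (N\<^sub>\<kappa>\<^sub>r(\<phi>) + \<integral>\<phi>)\<close>. The product of the factors along the radii \<open>\<kappa>\<^sup>n r\<close>
  converges and is close to \<open>1\<close> for small \<open>r\<close>. Hence, for one small \<open>r\<close> and every continuous density,
  \<open>N\<^sub>r\<close> of a high iterate is at most half its mass. If \<open>\<phi>\<close> has almost all its mass in \<open>B\<close>, then so has
  \<open>L\<^sup>n \<phi>\<close>, which moreover is bounded below on a ball of radius \<open>r\<close>; so \<open>B\<close> fills this ball up to a small
  set, and compactness of \<open>D\<close> gives a ball that \<open>B\<close> fills up to a null set. Working in \<open>L\<^sup>1\<close>, where
  \<open>L\<close> preserves mass, makes the estimate insensitive to the shapes of the images of \<open>D\<close> under long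
  compositions of the \<open>h\<^sub>i\<close>, which may be very thin.

  The rest is soft. The set of points near which \<open>B\<close> has full measure is open and invariant
  (\<open>full_invariant\<close>). Every point of \<open>D\<close> is a limit of images of all of \<open>D\<close> under compositions of the
  \<open>h\<^sub>i\<close>, so that set contains \<open>D\<close> as soon as it contains a ball centred in \<open>D\<close>
  (\<open>near_affine_ifs.reach\<close>), and then it is the whole surface because every point can be carried
  into \<open>D\<close>. If \<open>B \<inter> D\<close> is null, the same applies to the complement of \<open>B\<close>.

  Besides this, the proof has to construct the diffeomorphisms, which are small compactly supported
  displacements in charts and compositions of these, with the connectedness of the surface giving
  transitivity (\<open>diffeo_transitive\<close>), and the Riemannian volume, whose null sets are those that are
  Lebesgue null in the charts (\<open>\<mu>_null_iff\<close>).
\<close>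


section \<open>Smoothing by transfer operators of contractions\<close>

lemma holder_continuous_on:
  fixes f :: "'b::metric_space \<Rightarrow> 'c::metric_space"
  assumes \<alpha>: "\<alpha> > 0" and h: "\<And>x y. x \<in> S \<Longrightarrow> y \<in> S \<Longrightarrow> dist (f x) (f y) \<le> C * dist x y powr \<alpha>"
  shows "continuous_on S f"
  unfolding continuous_on_def
proof
  fix x assume x: "x \<in> S"
  have "((\<lambda>y. C * dist y x powr \<alpha>) \<longlongrightarrow> C * 0 powr \<alpha>) (at x within S)"
    by (intro tendsto_intros) (use \<alpha> in \<open>auto intro!: tendsto_eq_intros\<close>)
  then have "((\<lambda>y. C * dist y x powr \<alpha>) \<longlongrightarrow> 0) (at x within S)" using \<alpha> by simp
  moreover have "\<forall>\<^sub>F y in at x within S. norm (dist (f y) (f x)) \<le> C * dist y x powr \<alpha>"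
    unfolding eventually_at_filter
  proof (rule always_eventually, intro allI impI)
    fix y assume "y \<in> S"
    then show "norm (dist (f y) (f x)) \<le> C * dist y x powr \<alpha>" using h[of y x] x by simp
  qed
  ultimately have "((\<lambda>y. dist (f y) (f x)) \<longlongrightarrow> 0) (at x within S)"
    by (rule Lim_null_comparison[rotated])
  then show "(f \<longlongrightarrow> f x) (at x within S)" by (subst tendsto_dist_iff)
qed

definition osc :: "real \<Rightarrow> ('b::euclidean_space \<Rightarrow> real) \<Rightarrow> 'b \<Rightarrow> ennreal" where
  "osc r \<phi> x = (\<Squnion>y\<in>ball x r. ennreal \<bar>\<phi> y - \<phi> x\<bar>)"

lemma osc_ge: "y \<in> ball x r \<Longrightarrow> ennreal \<bar>\<phi> y - \<phi> x\<bar> \<le> osc r \<phi> x"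
  unfolding osc_def by (rule SUP_upper)

lemma osc_le: "(\<And>y. y \<in> ball x r \<Longrightarrow> ennreal \<bar>\<phi> y - \<phi> x\<bar> \<le> c) \<Longrightarrow> osc r \<phi> x \<le> c"
  unfolding osc_def by (rule SUP_least)

text \<open>The strict superlevel sets are open: a pair of points that witnesses a large oscillation at
  \<open>x\<close> still does so at nearby points.\<close>
lemma measurable_osc:
  assumes "continuous_on UNIV \<phi>"
  shows "osc r \<phi> \<in> borel_measurable borel"
proof (rule borel_measurableI_greater)
  fix a :: ennreal
  have "open {x. a < osc r \<phi> x}"
  proof (subst open_subopen, safe)
    fix x assume "a < osc r \<phi> x"
    then obtain y where y: "y \<in> ball x r" "a < ennreal \<bar>\<phi> y - \<phi> x\<bar>"
      unfolding osc_def by (auto simp: less_SUP_iff)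
    have c: "continuous_on UNIV (\<lambda>x. ennreal \<bar>\<phi> y - \<phi> x\<bar>)"
      by (intro continuous_on_ennreal continuous_intros assms)
    have "open ({x. a < ennreal \<bar>\<phi> y - \<phi> x\<bar>} \<inter> ball y r)"
      using c by (intro open_Int open_ball open_Collect_less continuous_on_const)
    moreover have "{x. a < ennreal \<bar>\<phi> y - \<phi> x\<bar>} \<inter> ball y r \<subseteq> {x. a < osc r \<phi> x}"
    proof
      fix x' assume x': "x' \<in> {x. a < ennreal \<bar>\<phi> y - \<phi> x\<bar>} \<inter> ball y r"
      then have "ennreal \<bar>\<phi> y - \<phi> x'\<bar> \<le> osc r \<phi> x'"
        by (intro osc_ge) (auto simp: dist_commute)
      with x' show "x' \<in> {x. a < osc r \<phi> x}" by auto
    qed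
    ultimately show "\<exists>T. open T \<and> x \<in> T \<and> T \<subseteq> {x. a < osc r \<phi> x}"
      using y by (intro exI conjI) (auto simp: dist_commute)
  qed
  then show "{x \<in> space borel. a < osc r \<phi> x} \<in> sets borel"
    by simp
qed

lemma osc_tendsto_0:
  fixes \<phi> :: "'b::euclidean_space \<Rightarrow> real"
  assumes c: "continuous_on UNIV \<phi>" and z: "\<And>x. x \<notin> cball z s \<Longrightarrow> \<phi> x = 0" and e: "e > 0" "s > 0"
  shows "\<exists>r0>0. \<forall>r\<le>r0. (\<integral>\<^sup>+x. osc r \<phi> x \<partial>lborel) \<le> ennreal e"
proof -
  define V where "V = measure lborel (cball z (2 * s)) + 1"
  have Vpos: "V > 0" unfolding V_def by (simp add: add_nonneg_pos)
  have "uniformly_continuous_on (cball z (3 * s)) \<phi>"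
    by (rule compact_uniformly_continuous) (auto intro: continuous_on_subset[OF c])
  then obtain d where d: "d > 0"
    "\<And>x x'. x \<in> cball z (3 * s) \<Longrightarrow> x' \<in> cball z (3 * s) \<Longrightarrow> dist x' x < d \<Longrightarrow> dist (\<phi> x') (\<phi> x) < e / V"
    unfolding uniformly_continuous_on_def using e Vpos by (metis divide_pos_pos)
  define r0 where "r0 = min d s"
  have "(\<integral>\<^sup>+x. osc r \<phi> x \<partial>lborel) \<le> ennreal e" if r: "r \<le> r0" for r
  proof -
    have "osc r \<phi> x \<le> ennreal (e/V) * indicator (cball z (2 * s)) x" for x
    proof (rule osc_le)
      fix y assume y: "y \<in> ball x r"
      show "ennreal \<bar>\<phi> y - \<phi> x\<bar> \<le> ennreal (e/V) * indicator (cball z (2 * s)) x"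
      proof (cases "x \<in> cball z (2 * s)")
        case True
        have "dist z y \<le> dist z x + dist x y" by (rule dist_triangle)
        then have "y \<in> cball z (3 * s)" using y r True unfolding r0_def by auto
        moreover have "x \<in> cball z (3 * s)" using True e by auto
        ultimately have "dist (\<phi> y) (\<phi> x) < e / V"
          using d(2)[of x y] y r unfolding r0_def by (auto simp: dist_commute)
        then show ?thesis using True by (auto simp: dist_real_def intro!: ennreal_leI)
      next
        case False
        have "dist z x \<le> dist z y + dist y x" by (rule dist_triangle)
        then have "y \<notin> cball z s" using y r False unfolding r0_def by (auto simp: dist_commute)
        moreover have "x \<notin> cball z s" using False e by auto
        ultimately show ?thesis using z by simp
      qed
    qed
    then have "(\<integral>\<^sup>+x. osc r \<phi> x \<partial>lborel) \<le> (\<integral>\<^sup>+x. ennreal (e/V) * indicator (cball z (2 * s)) x \<partial>lborel)"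
      by (intro nn_integral_mono) auto
    also have "\<dots> = ennreal (e/V) * emeasure lborel (cball z (2 * s))"
      by (simp add: nn_integral_cmult_indicator)
    also have "\<dots> = ennreal (e/V) * ennreal (measure lborel (cball z (2 * s)))"
      using emeasure_lborel_cball_finite[of z "2 * s"] by (subst emeasure_eq_ennreal_measure) (auto simp: less_top)
    also have "\<dots> = ennreal (e/V * measure lborel (cball z (2 * s)))"
      using e Vpos by (intro ennreal_mult[symmetric]) auto
    also have "\<dots> \<le> ennreal e"
      using e Vpos unfolding V_def by (intro ennreal_leI) (simp add: field_simps)
    finally show ?thesis .
  qed
  then show ?thesis using d e unfolding r0_def by (intro exI[of _ "min d s"]) auto
qed

text \<open>The weight \<open>w i\<close> stands for \<open>(\<xi>\<^sub>i \<circ> h\<^sub>i) |det Dh\<^sub>i|\<close>, and the last two assumptions are what remains of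
  the change of variables; in this form the estimates below involve no derivatives. The weights
  live on the ball of radius \<open>s\<close>; the ball of radius \<open>4 s\<close> leaves room for oscillations at scales up to \<open>s\<close>.\<close>
locale smoothing_ifs =
  fixes z :: "'b::euclidean_space" and s \<alpha> \<kappa> H K :: real and I :: "'i set"
    and h :: "'i \<Rightarrow> 'b \<Rightarrow> 'b" and w \<xi> :: "'i \<Rightarrow> 'b \<Rightarrow> real"
  assumes s: "s > 0" and \<alpha>: "\<alpha> > 0" and \<kappa>: "0 < \<kappa>" "\<kappa> < 1" and H: "H \<ge> 0" and K: "K \<ge> 0"
    and fin: "finite I"
    and h_borel [measurable]: "\<And>i. i \<in> I \<Longrightarrow> h i \<in> borel_measurable borel"
    and contr: "\<And>i y y'. i \<in> I \<Longrightarrow> y \<in> ball z (4 * s) \<Longrightarrow> y' \<in> ball z (4 * s) \<Longrightarrow>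
        dist (h i y) (h i y') \<le> \<kappa> * dist y y'"
    and w_nonneg: "\<And>i y. i \<in> I \<Longrightarrow> w i y \<ge> 0"
    and w_zero: "\<And>i y. i \<in> I \<Longrightarrow> y \<notin> cball z s \<Longrightarrow> w i y = 0"
    and w_holder: "\<And>i y y'. i \<in> I \<Longrightarrow> y \<in> ball z (4 * s) \<Longrightarrow> y' \<in> ball z (4 * s) \<Longrightarrow>
        \<bar>w i y - w i y'\<bar> \<le> H * dist y y' powr \<alpha>"
    and \<xi>_borel [measurable]: "\<And>i. i \<in> I \<Longrightarrow> \<xi> i \<in> borel_measurable borel"
    and \<xi>_nonneg: "\<And>i x. i \<in> I \<Longrightarrow> \<xi> i x \<ge> 0"
    and \<xi>_le: "\<And>x. (\<Sum>i\<in>I. \<xi> i x) \<le> 1"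
    and \<xi>_eq: "\<And>x. x \<in> cball z s \<Longrightarrow> (\<Sum>i\<in>I. \<xi> i x) = 1"
    and transport: "\<And>i g. i \<in> I \<Longrightarrow> g \<in> borel_measurable borel \<Longrightarrow>
        (\<integral>\<^sup>+y. ennreal (w i y) * g (h i y) \<partial>lborel) = (\<integral>\<^sup>+x. ennreal (\<xi> i x) * g x \<partial>lborel)"
    and pull: "\<And>i g. i \<in> I \<Longrightarrow> g \<in> borel_measurable borel \<Longrightarrow>
        (\<integral>\<^sup>+y. indicator (ball z (4 * s)) y * g (h i y) \<partial>lborel) \<le> ennreal K * (\<integral>\<^sup>+x. g x \<partial>lborel)"
begin

definition admissible :: "('b \<Rightarrow> real) \<Rightarrow> bool" where
  "admissible \<phi> \<longleftrightarrow> continuous_on UNIV \<phi> \<and> (\<forall>x. \<phi> x \<ge> 0) \<and> (\<forall>x. x \<notin> cball z s \<longrightarrow> \<phi> x = 0)"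

text \<open>This is dual to composition: an invariant \<open>g\<close> has the same integral against \<open>\<phi>\<close> and its transfer.\<close>
definition transfer :: "('b \<Rightarrow> real) \<Rightarrow> 'b \<Rightarrow> real" where
  "transfer \<phi> y = (\<Sum>i\<in>I. w i y * \<phi> (h i y))"

abbreviation total_osc :: "real \<Rightarrow> ('b \<Rightarrow> real) \<Rightarrow> ennreal" where
  "total_osc r \<phi> \<equiv> \<integral>\<^sup>+x. osc r \<phi> x \<partial>lborel"

lemma w_continuous:
  assumes i: "i \<in> I" shows "continuous_on UNIV (w i)"
proof -
  have 1: "continuous_on (ball z (4 * s)) (w i)"
    using w_holder[OF i] by (intro holder_continuous_on[OF \<alpha>]) (auto simp: dist_real_def)
  have 2: "continuous_on (- cball z s) (w i)"
    by (rule continuous_on_eq[of _ "\<lambda>_. 0"]) (use w_zero[OF i] in auto)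
  have "continuous_on (ball z (4 * s) \<union> - cball z s) (w i)"
    by (rule continuous_on_open_Un[OF _ _ 1 2]) auto
  moreover have "ball z (4 * s) \<union> - cball z s = UNIV" using s by auto
  ultimately show ?thesis by simp
qed

lemma h_continuous:
  assumes i: "i \<in> I" shows "continuous_on (ball z (4 * s)) (h i)"
proof (rule continuous_onI)
  fix x0 and e :: real assume "x0 \<in> ball z (4 * s)" "0 < e"
  then show "\<exists>d>0. \<forall>x'\<in>ball z (4 * s). dist x' x0 < d \<longrightarrow> dist (h i x') (h i x0) \<le> e"
    using contr[OF i] \<kappa> by (intro exI[of _ e]) (smt (verit, best) mult_left_le_one_le zero_le_dist)
qed

lemma admissible_transfer:
  assumes "admissible \<phi>" shows "admissible (transfer \<phi>)"
proof -
  have c: "continuous_on UNIV \<phi>" using assms by (simp add: admissible_def)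
  have 1: "continuous_on (ball z (4 * s)) (transfer \<phi>)"
    unfolding transfer_def
    by (intro continuous_on_sum continuous_on_mult continuous_on_subset[OF w_continuous]
        continuous_on_compose2[OF c] h_continuous) auto
  have 2: "continuous_on (- cball z s) (transfer \<phi>)"
    by (rule continuous_on_eq[of _ "\<lambda>_. 0"]) (use w_zero in \<open>auto simp: transfer_def\<close>)
  have "continuous_on (ball z (4 * s) \<union> - cball z s) (transfer \<phi>)"
    by (rule continuous_on_open_Un[OF _ _ 1 2]) auto
  moreover have "ball z (4 * s) \<union> - cball z s = UNIV" using s by auto
  ultimately show ?thesis
    using assms w_nonneg w_zero unfolding admissible_def
    by (auto simp: transfer_def intro!: sum_nonneg mult_nonneg_nonneg)
qed

lemma borel_admissible: "admissible \<phi> \<Longrightarrow> \<phi> \<in> borel_measurable borel"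
  unfolding admissible_def by (auto intro: borel_measurable_continuous_onI)

lemma w_borel [measurable]: "i \<in> I \<Longrightarrow> w i \<in> borel_measurable borel"
  by (intro borel_measurable_continuous_onI w_continuous)

text \<open>For \<open>g = 1\<close> this is conservation of mass, for the indicator of the complement of an invariant
  set it says that no mass leaks out of the set. The invariance of \<open>g\<close> turns \<open>(\<phi> \<circ> h\<^sub>i) g\<close> into
  \<open>(\<phi> g) \<circ> h\<^sub>i\<close> on the support of \<open>w\<^sub>i\<close>; then the pieces are transported back and add up by \<open>\<Sum> \<xi>\<^sub>i = 1\<close>.\<close>
lemma integral_transfer:
  assumes \<phi>: "admissible \<phi>" and [measurable]: "g \<in> borel_measurable borel"
    and g: "\<And>i y. i \<in> I \<Longrightarrow> y \<in> cball z s \<Longrightarrow> g (h i y) = g y"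
  shows "(\<integral>\<^sup>+y. ennreal (transfer \<phi> y) * g y \<partial>lborel) = (\<integral>\<^sup>+y. ennreal (\<phi> y) * g y \<partial>lborel)"
proof -
  note [measurable] = borel_admissible[OF \<phi>]
  have \<phi>0: "\<phi> x \<ge> 0" for x using \<phi> by (auto simp: admissible_def)
  have "(\<integral>\<^sup>+y. ennreal (transfer \<phi> y) * g y \<partial>lborel)
      = (\<integral>\<^sup>+y. (\<Sum>i\<in>I. ennreal (w i y) * (ennreal (\<phi> (h i y)) * g (h i y))) \<partial>lborel)"
  proof (rule nn_integral_cong)
    fix y
    have "ennreal (transfer \<phi> y) * g y = (\<Sum>i\<in>I. ennreal (w i y) * ennreal (\<phi> (h i y))) * g y"
      unfolding transfer_def using w_nonneg \<phi>0
      by (subst sum_ennreal[symmetric]) (auto simp: ennreal_mult intro!: sum.cong)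
    also have "\<dots> = (\<Sum>i\<in>I. ennreal (w i y) * (ennreal (\<phi> (h i y)) * g (h i y)))"
      unfolding sum_distrib_right
    proof (rule sum.cong[OF refl])
      fix i assume "i \<in> I"
      then show "ennreal (w i y) * ennreal (\<phi> (h i y)) * g y = ennreal (w i y) * (ennreal (\<phi> (h i y)) * g (h i y))"
        using g[of i y] w_zero[of i y] by (cases "y \<in> cball z s") (auto simp: mult.assoc)
    qed
    finally show "ennreal (transfer \<phi> y) * g y = \<dots>" .
  qed
  also have "\<dots> = (\<Sum>i\<in>I. \<integral>\<^sup>+y. ennreal (w i y) * (ennreal (\<phi> (h i y)) * g (h i y)) \<partial>lborel)"
    by (rule nn_integral_sum) measurable
  also have "\<dots> = (\<Sum>i\<in>I. \<integral>\<^sup>+x. ennreal (\<xi> i x) * (ennreal (\<phi> x) * g x) \<partial>lborel)"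
    by (intro sum.cong refl transport[of _ "\<lambda>x. ennreal (\<phi> x) * g x"]) auto
  also have "\<dots> = (\<integral>\<^sup>+x. (\<Sum>i\<in>I. ennreal (\<xi> i x) * (ennreal (\<phi> x) * g x)) \<partial>lborel)"
    by (rule nn_integral_sum[symmetric]) measurable
  also have "\<dots> = (\<integral>\<^sup>+y. ennreal (\<phi> y) * g y \<partial>lborel)"
  proof (rule nn_integral_cong)
    fix x
    have "(\<Sum>i\<in>I. ennreal (\<xi> i x) * (ennreal (\<phi> x) * g x)) = ennreal (\<Sum>i\<in>I. \<xi> i x) * (ennreal (\<phi> x) * g x)"
      using \<xi>_nonneg by (simp add: sum_distrib_right[symmetric])
    also have "\<dots> = ennreal (\<phi> x) * g x"
      using \<xi>_eq[of x] \<phi> by (cases "x \<in> cball z s") (auto simp: admissible_def)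
    finally show "(\<Sum>i\<in>I. ennreal (\<xi> i x) * (ennreal (\<phi> x) * g x)) = ennreal (\<phi> x) * g x" .
  qed
  finally show ?thesis .
qed

text \<open>Two points at distance less than \<open>r\<close> have images at distance less than \<open>\<kappa> r\<close>. Writing
  \<open>w' \<phi>' - w \<phi> = w (\<phi>' - \<phi>) + (w' - w) \<phi>'\<close>, the first term is controlled by the oscillation of \<open>\<phi>\<close> at
  scale \<open>\<kappa> r\<close>, the second by the modulus of continuity of the weight.\<close>
lemma osc_transfer:
  assumes \<phi>: "admissible \<phi>" and r: "0 < r" "r \<le> s"
  shows "osc r (transfer \<phi>) y \<le> (\<Sum>i\<in>I. ennreal (w i y) * osc (\<kappa>*r) \<phi> (h i y)
     + ennreal (H * r powr \<alpha>) * (indicator (ball z (4 * s)) y * (ennreal (\<phi> (h i y)) + osc (\<kappa>*r) \<phi> (h i y))))"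
    (is "_ \<le> ?R")
proof (rule osc_le)
  fix y' assume y': "y' \<in> ball y r"
  have \<phi>0: "\<phi> x \<ge> 0" for x using \<phi> by (auto simp: admissible_def)
  show "ennreal \<bar>transfer \<phi> y' - transfer \<phi> y\<bar> \<le> ?R"
  proof (cases "y \<in> ball z (4 * s) \<and> y' \<in> ball z (4 * s)")
    case False
    have "dist z y \<le> dist z y' + dist y y'" "dist z y' \<le> dist z y + dist y y'"
      using dist_triangle[of z y y'] dist_triangle[of z y' y] by (auto simp: dist_commute)
    then have "y \<notin> cball z s" "y' \<notin> cball z s" using y' r s False by auto
    then have "transfer \<phi> y = 0" "transfer \<phi> y' = 0"
      using admissible_transfer[OF \<phi>] by (auto simp: admissible_def)
    then show ?thesis by simp
  next
    case True
    have "\<bar>transfer \<phi> y' - transfer \<phi> y\<bar> = \<bar>\<Sum>i\<in>I. w i y' * \<phi> (h i y') - w i y * \<phi> (h i y)\<bar>"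
      by (simp add: transfer_def sum_subtractf)
    also have "\<dots> \<le> (\<Sum>i\<in>I. \<bar>w i y' * \<phi> (h i y') - w i y * \<phi> (h i y)\<bar>)"
      by (rule sum_abs)
    also have "\<dots> \<le> (\<Sum>i\<in>I. w i y * \<bar>\<phi> (h i y') - \<phi> (h i y)\<bar> + H * r powr \<alpha> * (\<phi> (h i y) + \<bar>\<phi> (h i y') - \<phi> (h i y)\<bar>))"
    proof (rule sum_mono)
      fix i assume i: "i \<in> I"
      have "\<bar>w i y' - w i y\<bar> \<le> H * dist y' y powr \<alpha>" using w_holder[OF i] True by blast
      also have "\<dots> \<le> H * r powr \<alpha>"
        using y' \<alpha> H by (intro mult_left_mono powr_mono2) (auto simp: dist_commute)
      finally have a: "\<bar>w i y' - w i y\<bar> \<le> H * r powr \<alpha>" .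
      have "w i y' * \<phi> (h i y') - w i y * \<phi> (h i y)
          = w i y * (\<phi> (h i y') - \<phi> (h i y)) + (w i y' - w i y) * \<phi> (h i y')" by (simp add: algebra_simps)
      also have "\<bar>\<dots>\<bar> \<le> \<bar>w i y * (\<phi> (h i y') - \<phi> (h i y))\<bar> + \<bar>(w i y' - w i y) * \<phi> (h i y')\<bar>"
        by (rule abs_triangle_ineq)
      also have "\<dots> = w i y * \<bar>\<phi> (h i y') - \<phi> (h i y)\<bar> + \<bar>w i y' - w i y\<bar> * \<phi> (h i y')"
        using w_nonneg[OF i] \<phi>0 by (simp add: abs_mult)
      also have "\<dots> \<le> w i y * \<bar>\<phi> (h i y') - \<phi> (h i y)\<bar> + H * r powr \<alpha> * (\<phi> (h i y) + \<bar>\<phi> (h i y') - \<phi> (h i y)\<bar>)"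
        using a \<phi>0 by (intro add_left_mono mult_mono) auto
      finally show "\<bar>w i y' * \<phi> (h i y') - w i y * \<phi> (h i y)\<bar> \<le> \<dots>" .
    qed
    finally have "ennreal \<bar>transfer \<phi> y' - transfer \<phi> y\<bar> \<le> ennreal \<dots>" by (rule ennreal_leI)
    also have "\<dots> = (\<Sum>i\<in>I. ennreal (w i y) * ennreal \<bar>\<phi> (h i y') - \<phi> (h i y)\<bar>
        + ennreal (H * r powr \<alpha>) * (ennreal (\<phi> (h i y)) + ennreal \<bar>\<phi> (h i y') - \<phi> (h i y)\<bar>))"
      using w_nonneg \<phi>0 H
      by (subst sum_ennreal[symmetric])
        (auto intro!: sum.cong add_nonneg_nonneg mult_nonneg_nonneg simp: ennreal_plus[symmetric] ennreal_mult[symmetric] simp del: ennreal_plus)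
    also have "\<dots> \<le> ?R"
    proof (rule sum_mono)
      fix i assume i: "i \<in> I"
      have "dist (h i y) (h i y') \<le> \<kappa> * dist y y'" using contr[OF i] True by blast
      also have "\<dots> < \<kappa> * r" using y' \<kappa> by auto
      finally have "ennreal \<bar>\<phi> (h i y') - \<phi> (h i y)\<bar> \<le> osc (\<kappa>*r) \<phi> (h i y)"
        by (intro osc_ge) auto
      then show "ennreal (w i y) * ennreal \<bar>\<phi> (h i y') - \<phi> (h i y)\<bar>
        + ennreal (H * r powr \<alpha>) * (ennreal (\<phi> (h i y)) + ennreal \<bar>\<phi> (h i y') - \<phi> (h i y)\<bar>)
        \<le> ennreal (w i y) * osc (\<kappa>*r) \<phi> (h i y)
     + ennreal (H * r powr \<alpha>) * (indicator (ball z (4 * s)) y * (ennreal (\<phi> (h i y)) + osc (\<kappa>*r) \<phi> (h i y)))"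
        using True by (auto intro!: add_mono mult_left_mono)
    qed
    finally show ?thesis .
  qed
qed

text \<open>Integrate \<open>osc_transfer\<close>. The main term keeps the factor \<open>1\<close> because the weights are transported
  to the \<open>\<xi>\<^sub>i\<close>, whose sum is at most \<open>1\<close>. Adding the mass on both sides puts the estimate into
  multiplicative form, ready for iteration.\<close>
lemma lasota_yorke:
  assumes \<phi>: "admissible \<phi>" and r: "0 < r" "r \<le> s"
  defines "C \<equiv> H * K * card I"
  shows "total_osc r (transfer \<phi>) + (\<integral>\<^sup>+x. \<phi> x \<partial>lborel)
    \<le> ennreal (1 + C * r powr \<alpha>) * (total_osc (\<kappa>*r) \<phi> + (\<integral>\<^sup>+x. \<phi> x \<partial>lborel))"
proof -
  note [measurable] = borel_admissible[OF \<phi>]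
  have c: "continuous_on UNIV \<phi>" using \<phi> by (simp add: admissible_def)
  let ?m = "\<integral>\<^sup>+x. \<phi> x \<partial>lborel"
  define o1 where "o1 = osc (\<kappa>*r) \<phi>"
  let ?N1 = "\<integral>\<^sup>+x. o1 x \<partial>lborel"
  have o [measurable]: "o1 \<in> borel_measurable borel" unfolding o1_def by (rule measurable_osc[OF c])
  have [measurable]: "(\<lambda>y. o1 (h i y)) \<in> borel_measurable borel"
    "(\<lambda>y. \<phi> (h i y)) \<in> borel_measurable borel" if "i \<in> I" for i
    using measurable_compose[OF h_borel[OF that] o]
      measurable_compose[OF h_borel[OF that] borel_admissible[OF \<phi>]] by auto
  have C: "C \<ge> 0" unfolding C_def using H K by simp
  have m1: "(\<lambda>y. ennreal (w i y) * o1 (h i y)) \<in> borel_measurable borel" if "i \<in> I" for i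
    using that by measurable
  have m2: "(\<lambda>y. ennreal (\<phi> (h i y)) + o1 (h i y)) \<in> borel_measurable borel" if "i \<in> I" for i
    using that by measurable
  have m3: "(\<lambda>y. indicator (ball z (4 * s)) y * (ennreal (\<phi> (h i y)) + o1 (h i y))) \<in> borel_measurable borel" if "i \<in> I" for i
    by (intro borel_measurable_times_ennreal borel_measurable_indicator m2 that) auto
  have "total_osc r (transfer \<phi>) \<le> (\<integral>\<^sup>+y. (\<Sum>i\<in>I. ennreal (w i y) * o1 (h i y)
     + ennreal (H * r powr \<alpha>) * (indicator (ball z (4 * s)) y * (ennreal (\<phi> (h i y)) + o1 (h i y)))) \<partial>lborel)"
    unfolding o1_def by (intro nn_integral_mono osc_transfer assms)
  also have "\<dots> = (\<Sum>i\<in>I. \<integral>\<^sup>+y. (ennreal (w i y) * o1 (h i y)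
     + ennreal (H * r powr \<alpha>) * (indicator (ball z (4 * s)) y * (ennreal (\<phi> (h i y)) + o1 (h i y)))) \<partial>lborel)"
    by (rule nn_integral_sum) (use m1 m3 in measurable)
  also have "\<dots> = (\<Sum>i\<in>I. (\<integral>\<^sup>+y. ennreal (w i y) * o1 (h i y) \<partial>lborel)
     + ennreal (H * r powr \<alpha>) * (\<integral>\<^sup>+y. indicator (ball z (4 * s)) y * (ennreal (\<phi> (h i y)) + o1 (h i y)) \<partial>lborel))"
    using m1 m3 by (intro sum.cong refl) (simp add: nn_integral_add nn_integral_cmult)
  also have "\<dots> \<le> (\<Sum>i\<in>I. (\<integral>\<^sup>+x. ennreal (\<xi> i x) * o1 x \<partial>lborel)
     + ennreal (H * r powr \<alpha>) * (ennreal K * (\<integral>\<^sup>+x. ennreal (\<phi> x) + o1 x \<partial>lborel)))"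
    by (intro sum_mono add_mono mult_left_mono pull[of _ "\<lambda>x. ennreal (\<phi> x) + o1 x"] eq_refl[OF transport]) auto
  also have "\<dots> = (\<Sum>i\<in>I. \<integral>\<^sup>+x. ennreal (\<xi> i x) * o1 x \<partial>lborel) + ennreal (C * r powr \<alpha>) * (?m + ?N1)"
  proof -
    have "ennreal (real (card I)) * (ennreal (H * r powr \<alpha>) * (ennreal K * q)) = ennreal (C * r powr \<alpha>) * q" for q
      unfolding C_def using H K by (simp add: ennreal_mult mult.assoc mult.commute mult.left_commute)
    then show ?thesis
      by (simp add: sum.distrib nn_integral_add ennreal_of_nat_eq_real_of_nat)
  qed
  also have "(\<Sum>i\<in>I. \<integral>\<^sup>+x. ennreal (\<xi> i x) * o1 x \<partial>lborel) = (\<integral>\<^sup>+x. (\<Sum>i\<in>I. ennreal (\<xi> i x) * o1 x) \<partial>lborel)"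
    by (rule nn_integral_sum[symmetric]) measurable
  also have "\<dots> \<le> ?N1"
  proof (rule nn_integral_mono)
    fix x
    have "(\<Sum>i\<in>I. ennreal (\<xi> i x) * o1 x) = ennreal (\<Sum>i\<in>I. \<xi> i x) * o1 x"
      using \<xi>_nonneg by (simp add: sum_distrib_right[symmetric])
    also have "\<dots> \<le> 1 * o1 x"
      using \<xi>_le by (intro mult_right_mono) (auto simp: ennreal_le_1)
    finally show "(\<Sum>i\<in>I. ennreal (\<xi> i x) * o1 x) \<le> o1 x" by simp
  qed
  finally have "total_osc r (transfer \<phi>) + ?m \<le> ?N1 + ennreal (C * r powr \<alpha>) * (?m + ?N1) + ?m"
    by (auto intro!: add_right_mono)
  also have "\<dots> = ennreal (1 + C * r powr \<alpha>) * (?N1 + ?m)"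
    using C by (simp add: distrib_right distrib_left add_ac)
  finally show ?thesis unfolding o1_def .
qed

lemma admissible_funpow: "admissible \<phi> \<Longrightarrow> admissible ((transfer ^^ n) \<phi>)"
  by (induction n) (auto intro: admissible_transfer)

lemma integral_transfer_funpow:
  assumes "admissible \<phi>" and "g \<in> borel_measurable borel"
    and "\<And>i y. i \<in> I \<Longrightarrow> y \<in> cball z s \<Longrightarrow> g (h i y) = g y"
  shows "(\<integral>\<^sup>+y. ennreal ((transfer ^^ n) \<phi> y) * g y \<partial>lborel) = (\<integral>\<^sup>+y. ennreal (\<phi> y) * g y \<partial>lborel)"
proof (induction n)
  case (Suc n)
  show ?case
    using integral_transfer[OF admissible_funpow[OF assms(1), of n] assms(2,3)] Suc by simp
qed simp

text \<open>The \<open>k\<close>-th application is made at scale \<open>\<kappa>\<^sup>k r\<close>, so the exponents form a geometric series.\<close>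
lemma iterated_lasota_yorke:
  assumes \<phi>: "admissible \<phi>" and r: "0 < r" "r \<le> s"
  defines "C \<equiv> H * K * card I"
  shows "total_osc r ((transfer ^^ n) \<phi>) + (\<integral>\<^sup>+x. \<phi> x \<partial>lborel)
    \<le> ennreal (exp (C * r powr \<alpha> * (\<Sum>k<n. (\<kappa> powr \<alpha>)^k))) * (total_osc (\<kappa>^n*r) \<phi> + (\<integral>\<^sup>+x. \<phi> x \<partial>lborel))"
  using r
proof (induction n arbitrary: r)
  case 0 then show ?case by simp
next
  case (Suc n)
  let ?m = "\<integral>\<^sup>+x. \<phi> x \<partial>lborel" and ?q = "\<kappa> powr \<alpha>"
  have C: "C \<ge> 0" unfolding C_def using H K by simp
  have r': "0 < \<kappa> * r" "\<kappa> * r \<le> s"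
    using Suc.prems \<kappa> by (auto intro: order_trans[OF mult_left_le_one_le])
  have m: "(\<integral>\<^sup>+x. (transfer ^^ n) \<phi> x \<partial>lborel) = ?m"
    using integral_transfer_funpow[OF \<phi>, of "\<lambda>_. 1" n] by simp
  have S: "(\<Sum>k<Suc n. ?q^k) = 1 + ?q * (\<Sum>k<n. ?q^k)"
    by (simp add: sum.lessThan_Suc_shift sum_distrib_left del: sum.lessThan_Suc)
  have p: "(\<kappa>*r) powr \<alpha> = ?q * r powr \<alpha>" using \<kappa> Suc.prems by (simp add: powr_mult)
  have "total_osc r ((transfer ^^ Suc n) \<phi>) + ?m \<le> ennreal (1 + C * r powr \<alpha>) * (total_osc (\<kappa>*r) ((transfer ^^ n) \<phi>) + ?m)"
    using lasota_yorke[OF admissible_funpow[OF \<phi>, of n] Suc.prems] by (simp add: m C_def)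
  also have "\<dots> \<le> ennreal (exp (C * r powr \<alpha>)) * (ennreal (exp (C * (\<kappa>*r) powr \<alpha> * (\<Sum>k<n. ?q^k))) * (total_osc (\<kappa>^n*(\<kappa>*r)) \<phi> + ?m))"
    by (intro mult_mono Suc.IH r') (auto intro!: ennreal_leI)
  also have "\<dots> = ennreal (exp (C * r powr \<alpha>) * exp (C * (\<kappa>*r) powr \<alpha> * (\<Sum>k<n. ?q^k))) * (total_osc (\<kappa>^n*(\<kappa>*r)) \<phi> + ?m)"
    by (simp add: ennreal_mult mult.assoc)
  also have "exp (C * r powr \<alpha>) * exp (C * (\<kappa>*r) powr \<alpha> * (\<Sum>k<n. ?q^k)) = exp (C * r powr \<alpha> * (\<Sum>k<Suc n. ?q^k))"
    unfolding exp_add[symmetric] S p by (simp add: algebra_simps)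
  also have "\<kappa>^n*(\<kappa>*r) = \<kappa>^Suc n * r" by simp
  finally show ?case .
qed

lemma integral_admissible_finite:
  assumes \<phi>: "admissible \<phi>" shows "(\<integral>\<^sup>+x. \<phi> x \<partial>lborel) < \<top>"
proof -
  have c: "continuous_on UNIV \<phi>" and z0: "\<And>x. x \<notin> cball z s \<Longrightarrow> \<phi> x = 0"
    using \<phi> by (auto simp: admissible_def)
  have "bounded (\<phi> ` cball z s)"
    by (intro compact_imp_bounded compact_continuous_image) (auto intro: continuous_on_subset[OF c])
  then have "\<exists>M. \<forall>x\<in>cball z s. \<bar>\<phi> x\<bar> \<le> M" by (auto simp: bounded_iff)
  then obtain M where M: "\<And>x. x \<in> cball z s \<Longrightarrow> \<bar>\<phi> x\<bar> \<le> M" by blast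
  have "(\<integral>\<^sup>+x. \<phi> x \<partial>lborel) \<le> (\<integral>\<^sup>+x. ennreal M * indicator (cball z s) x \<partial>lborel)"
    using M z0 by (intro nn_integral_mono) (force split: split_indicator intro!: ennreal_leI)
  also have "\<dots> < \<top>"
    using emeasure_lborel_cball_finite[of z s]
    by (auto simp: nn_integral_cmult_indicator ennreal_mult_eq_top_iff less_top[symmetric])
  finally show ?thesis .
qed

text \<open>Choose \<open>r\<close> so small that the accumulated factor is at most \<open>5/4\<close>, and then \<open>n\<close> so large that the
  oscillation of \<open>\<phi>\<close> at scale \<open>\<kappa>\<^sup>n r\<close> has integral at most \<open>m/5\<close>, where \<open>m\<close> is the mass: this leaves
  \<open>(5/4) (m/5 + m) - m = m/2\<close>. The scale \<open>r\<close> is the same for all \<open>\<phi>\<close>.\<close>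
lemma eventually_regular:
  obtains r where "0 < r" "r \<le> s"
    "\<And>\<phi>. admissible \<phi> \<Longrightarrow> 0 < (\<integral>\<^sup>+x. \<phi> x \<partial>lborel) \<Longrightarrow> \<exists>n. total_osc r ((transfer ^^ n) \<phi>) \<le> ennreal (1/2) * (\<integral>\<^sup>+x. \<phi> x \<partial>lborel)"
proof -
  define C where "C = H * K * card I / (1 - \<kappa> powr \<alpha>)"
  have q: "0 < \<kappa> powr \<alpha>" "\<kappa> powr \<alpha> < 1" using \<kappa> \<alpha> powr_less_mono2[of \<alpha> \<kappa> 1] by auto
  have C: "C \<ge> 0" unfolding C_def using H K q by simp
  \<comment> \<open>The sum of the geometric series of exponents is at most \<open>C r\<^sup>\<alpha>\<close>.\<close>
  define r where "r = min s ((ln (5/4) / (C+1)) powr (1/\<alpha>))"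
  have l: "ln (5/4::real) > 0" by simp
  have r: "0 < r" "r \<le> s" unfolding r_def using s C l by auto
  have "r powr \<alpha> \<le> ((ln (5/4) / (C+1)) powr (1/\<alpha>)) powr \<alpha>"
    using r \<alpha> unfolding r_def by (intro powr_mono2) auto
  also have "\<dots> = ln (5/4) / (C+1)" using \<alpha> l C by (simp add: powr_powr)
  finally have "C * r powr \<alpha> \<le> C * (ln (5/4) / (C+1))" using C by (rule mult_left_mono)
  also have "\<dots> \<le> ln (5/4)" using C l by (simp add: field_simps)
  finally have Cr: "C * r powr \<alpha> \<le> ln (5/4)" .
  have "\<exists>n. total_osc r ((transfer ^^ n) \<phi>) \<le> ennreal (1/2) * (\<integral>\<^sup>+x. \<phi> x \<partial>lborel)"
    if \<phi>: "admissible \<phi>" and pos: "0 < (\<integral>\<^sup>+x. \<phi> x \<partial>lborel)" for \<phi>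
  proof -
    let ?m = "\<integral>\<^sup>+x. \<phi> x \<partial>lborel"
    have c: "continuous_on UNIV \<phi>" and z0: "\<And>x. x \<notin> cball z s \<Longrightarrow> \<phi> x = 0"
      using \<phi> by (auto simp: admissible_def)
    have "?m < \<top>" by (rule integral_admissible_finite[OF \<phi>])
    then obtain m where m: "?m = ennreal m" "m \<ge> 0" by (cases "?m") auto
    with pos have mp: "m > 0" by auto
    obtain r0 where r0: "r0 > 0" "\<forall>r\<le>r0. total_osc r \<phi> \<le> ennreal (m/5)"
      using osc_tendsto_0[OF c z0, of z s "m/5"] mp s by auto
    have "(\<lambda>n. \<kappa>^n * r) \<longlonglongrightarrow> 0 * r"
      using \<kappa> by (intro tendsto_mult LIMSEQ_power_zero) auto
    then have "eventually (\<lambda>n. \<kappa>^n * r < r0) sequentially" using r0 by (intro order_tendstoD) auto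
    then obtain n where n: "\<kappa>^n * r < r0" by (auto simp: eventually_sequentially)
    have geo: "(\<Sum>k<n. (\<kappa> powr \<alpha>)^k) \<le> 1 / (1 - \<kappa> powr \<alpha>)"
    proof -
      have "(\<Sum>k<n. (\<kappa> powr \<alpha>)^k) = (1 - (\<kappa> powr \<alpha>)^n) / (1 - \<kappa> powr \<alpha>)"
        using q by (simp add: sum_gp_strict)
      also have "\<dots> \<le> 1 / (1 - \<kappa> powr \<alpha>)" using q by (intro divide_right_mono) auto
      finally show ?thesis .
    qed
    have "H * K * card I * r powr \<alpha> * (\<Sum>k<n. (\<kappa> powr \<alpha>)^k) \<le> H * K * card I * r powr \<alpha> * (1 / (1 - \<kappa> powr \<alpha>))"
      using geo H K by (intro mult_left_mono) auto
    also have "\<dots> = C * r powr \<alpha>" unfolding C_def by simp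
    also note Cr
    finally have "exp (H * K * card I * r powr \<alpha> * (\<Sum>k<n. (\<kappa> powr \<alpha>)^k)) \<le> exp (ln (5/4))"
      by (simp only: exp_le_cancel_iff)
    then have e: "exp (H * K * card I * r powr \<alpha> * (\<Sum>k<n. (\<kappa> powr \<alpha>)^k)) \<le> 5/4"
      by simp
    have "total_osc r ((transfer ^^ n) \<phi>) + ennreal m \<le> ennreal (5/4) * (ennreal (m/5) + ennreal m)"
      using order_trans[OF iterated_lasota_yorke[OF \<phi> r, of n] mult_mono[OF ennreal_leI[OF e] add_mono[OF r0(2)[rule_format, of "\<kappa>^n*r"] order_refl]]]
        n m by auto
    also have "\<dots> = ennreal (m/2) + ennreal m" using mp
      by (simp add: ennreal_plus[symmetric] ennreal_mult[symmetric] del: ennreal_plus)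
    finally have "total_osc r ((transfer ^^ n) \<phi>) \<le> ennreal (m/2)"
      by (simp add: add.commute[of _ "ennreal m"] ennreal_add_left_cancel_le)
    also have "\<dots> = ennreal (1/2) * ?m" unfolding m using mp by (subst ennreal_mult[symmetric]) auto
    finally show ?thesis by blast
  qed
  with r show ?thesis using that by blast
qed

text \<open>Start from a density that is \<open>1\<close> on a compact part of \<open>B\<close> and has almost no mass outside \<open>B\<close>. A high
  iterate has the same mass inside and outside \<open>B\<close>, but now it exceeds its own oscillation by a
  fixed constant \<open>c\<close> somewhere, since otherwise the total oscillation would be more than half the mass. There it
  is at least \<open>c\<close> on a whole ball of radius \<open>r\<close>, so that the part of the ball outside \<open>B\<close> is small.\<close>
lemma almost_full_balls:
  assumes B: "B \<in> sets borel"
    and inv: "\<And>i y. i \<in> I \<Longrightarrow> y \<in> cball z s \<Longrightarrow> h i y \<in> B \<longleftrightarrow> y \<in> B"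
    and pos: "emeasure lborel (B \<inter> ball z s) > 0"
  obtains r c where "0 < r" "0 < c"
    "\<And>e. e > 0 \<Longrightarrow> \<exists>x\<in>cball z s. ennreal c * emeasure lborel (ball x r - B) \<le> ennreal e"
proof -
  note [measurable] = B
  let ?S = "B \<inter> ball z s"
  have S: "?S \<in> sets lborel" by simp
  have "emeasure lborel ?S \<le> emeasure lborel (ball z s)" by (intro emeasure_mono) auto
  then have "emeasure lborel ?S < \<top>" using emeasure_lborel_ball_finite[of z s] by (auto simp: less_top[symmetric] top_unique)
  then obtain b where b: "emeasure lborel ?S = ennreal b" "b \<ge> 0" by (cases "emeasure lborel ?S") auto
  have bp: "b > 0" using pos b by auto
  have Sl: "?S \<in> sets lebesgue" using S by auto
  obtain T where T: "closed T" "T \<subseteq> ?S" "emeasure lebesgue (?S - T) < ennreal b"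
    using sets_lebesgue_inner_closed[OF Sl bp] by metis
  have Tb: "T \<in> sets borel" using T by auto
  have "emeasure lborel T \<noteq> 0"
  proof
    assume "emeasure lborel T = 0"
    moreover have "emeasure lborel ?S \<le> emeasure lborel (?S - T) + emeasure lborel T"
      using T Tb by (subst plus_emeasure) (auto intro!: emeasure_mono)
    ultimately show False using T b by auto
  qed
  moreover have "emeasure lborel T \<le> emeasure lborel ?S" using T Tb by (intro emeasure_mono) auto
  ultimately obtain b0 where b0: "emeasure lborel T = ennreal b0" "b0 > 0"
    using b by (cases "emeasure lborel T") (auto simp: top_unique)
  have "emeasure lborel (cball z s) < \<top>" using emeasure_lborel_cball_finite[of z s] by simp
  then obtain V where V: "emeasure lborel (cball z s) = ennreal V" "V \<ge> 0"
    by (cases "emeasure lborel (cball z s)") auto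
  obtain r where r: "0 < r" "r \<le> s"
    "\<And>\<phi>. admissible \<phi> \<Longrightarrow> 0 < (\<integral>\<^sup>+x. \<phi> x \<partial>lborel) \<Longrightarrow> \<exists>n. total_osc r ((transfer ^^ n) \<phi>) \<le> ennreal (1/2) * (\<integral>\<^sup>+x. \<phi> x \<partial>lborel)"
    using eventually_regular by blast
  \<comment> \<open>With this threshold, \<open>c\<close> times the volume \<open>V\<close> of the disc is at most a quarter of the mass of any of the densities below.\<close>
  define c where "c = b0 / (4 * (V + 1))"
  have c: "c > 0" unfolding c_def using b0 V by auto
  have cV: "c * V \<le> b0 / 4" unfolding c_def using b0 V by (simp add: field_simps)
  have "\<exists>x\<in>cball z s. ennreal c * emeasure lborel (ball x r - B) \<le> ennreal e" if e: "e > 0" for e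
  proof -
    have "T \<in> sets lebesgue" using Tb by auto
    then obtain U where U: "open U" "T \<subseteq> U" "emeasure lebesgue (U - T) < ennreal e"
      using sets_lebesgue_outer_open[OF _ e] by metis
    obtain \<phi> :: "'b \<Rightarrow> real" where \<phi>: "continuous_on UNIV \<phi>" "\<And>x. \<phi> x \<in> closed_segment 1 0"
        "\<And>x. x \<in> T \<Longrightarrow> \<phi> x = 1" "\<And>x. x \<in> - (U \<inter> ball z s) \<Longrightarrow> \<phi> x = 0"
    proof (rule Urysohn[OF T(1), of "- (U \<inter> ball z s)" "1::real" 0])
      show "closed (- (U \<inter> ball z s))" using U(1) by (intro closed_Compl open_Int open_ball)
      show "T \<inter> - (U \<inter> ball z s) = {}" using T(2) U(2) by auto
    qed (rule that)
    have \<phi>01: "0 \<le> \<phi> x" "\<phi> x \<le> 1" for x using \<phi>(2)[of x] by (auto simp: closed_segment_eq_real_ivl split: if_splits)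
    have adm: "admissible \<phi>" using \<phi> \<phi>01 by (auto simp: admissible_def)
    note [measurable] = borel_admissible[OF adm]
    let ?m = "\<integral>\<^sup>+x. \<phi> x \<partial>lborel"
    have "ennreal b0 = (\<integral>\<^sup>+x. indicator T x \<partial>lborel)" using b0 Tb by simp
    also have "\<dots> \<le> ?m" using \<phi> by (intro nn_integral_mono) (auto split: split_indicator)
    finally have m: "ennreal b0 \<le> ?m" .
    then have m0: "0 < ?m" using b0 by (metis ennreal_less_zero_iff less_le_trans)
    obtain m where mm: "?m = ennreal m" "m \<ge> 0" using integral_admissible_finite[OF adm] by (cases ?m) auto
    have b0m: "b0 \<le> m" using m mm b0 by (simp add: ennreal_le_iff)
    obtain n where n: "total_osc r ((transfer ^^ n) \<phi>) \<le> ennreal (1/2) * ?m" using r(3)[OF adm m0] by auto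
    \<comment> \<open>By \<open>integral_transfer_funpow\<close>, the iterate has as much mass in the complement of \<open>B\<close> as \<open>\<phi>\<close>, which is less than \<open>e\<close>.\<close>
    define \<psi> where "\<psi> = (transfer ^^ n) \<phi>"
    have a\<psi>: "admissible \<psi>" unfolding \<psi>_def by (rule admissible_funpow[OF adm])
    note [measurable] = borel_admissible[OF a\<psi>]
    have c\<psi>: "continuous_on UNIV \<psi>" using a\<psi> by (simp add: admissible_def)
    have [measurable]: "osc r \<psi> \<in> borel_measurable borel" by (rule measurable_osc[OF c\<psi>])
    have \<psi>0: "\<psi> x \<ge> 0" for x using a\<psi> by (simp add: admissible_def)
    have "(\<integral>\<^sup>+y. \<psi> y \<partial>lborel) = ?m"
      unfolding \<psi>_def using integral_transfer_funpow[OF adm, of "\<lambda>_. 1" n] by simp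
    have "\<exists>x\<in>cball z s. osc r \<psi> x + ennreal c \<le> ennreal (\<psi> x)"
    proof (rule ccontr)
      assume "\<not> ?thesis"
      then have le: "ennreal (\<psi> x) \<le> osc r \<psi> x + ennreal c * indicator (cball z s) x" for x
        using a\<psi> by (cases "x \<in> cball z s") (force simp: admissible_def not_le intro: less_imp_le)+
      have "?m = (\<integral>\<^sup>+y. \<psi> y \<partial>lborel)" using \<open>_ = ?m\<close> by simp
      also have "\<dots> \<le> (\<integral>\<^sup>+x. osc r \<psi> x + ennreal c * indicator (cball z s) x \<partial>lborel)"
        using le by (intro nn_integral_mono) auto
      also have "\<dots> = total_osc r \<psi> + ennreal c * ennreal V"
        by (subst nn_integral_add)
          (auto simp: nn_integral_cmult_indicator V intro!: borel_measurable_times_ennreal borel_measurable_indicator)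
      also have "\<dots> \<le> ennreal (1/2) * ennreal m + ennreal (b0/4)"
        using n cV c V unfolding \<psi>_def mm by (intro add_mono) (auto simp: ennreal_mult[symmetric] intro!: ennreal_leI)
      also have "ennreal (1/2) * ennreal m = ennreal (m/2)" using mm by (subst ennreal_mult[symmetric]) auto
      also have "\<dots> + ennreal (b0/4) = ennreal (m/2 + b0/4)"
        using mm b0 by (intro ennreal_plus[symmetric]) auto
      finally have "m \<le> m/2 + b0/4" using mm b0 by (simp add: ennreal_le_iff del: ennreal_plus)
      then show False using b0m b0 by simp
    qed
    then obtain x where x: "x \<in> cball z s" "osc r \<psi> x + ennreal c \<le> ennreal (\<psi> x)" by blast
    have big: "c \<le> \<psi> y" if y: "y \<in> ball x r" for y
    proof -
      have "ennreal \<bar>\<psi> y - \<psi> x\<bar> + ennreal c \<le> ennreal (\<psi> x)"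
        using osc_ge[OF y, of \<psi>] x(2) by (meson add_right_mono order_trans)
      then have "\<bar>\<psi> y - \<psi> x\<bar> + c \<le> \<psi> x" using c \<psi>0[of x]
        by (subst (asm) ennreal_plus[symmetric]) (auto simp: ennreal_le_iff simp del: ennreal_plus)
      then show ?thesis by linarith
    qed
    have "ennreal c * emeasure lborel (ball x r - B) = (\<integral>\<^sup>+y. ennreal c * indicator (ball x r - B) y \<partial>lborel)"
      by (simp add: nn_integral_cmult_indicator)
    also have "\<dots> \<le> (\<integral>\<^sup>+y. ennreal (\<psi> y) * indicator (- B) y \<partial>lborel)"
      using big by (intro nn_integral_mono) (auto split: split_indicator intro!: ennreal_leI)
    also have "\<dots> = (\<integral>\<^sup>+y. ennreal (\<phi> y) * indicator (- B) y \<partial>lborel)"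
      unfolding \<psi>_def by (rule integral_transfer_funpow[OF adm]) (use inv in \<open>auto split: split_indicator\<close>)
    also have "\<dots> \<le> (\<integral>\<^sup>+y. indicator (U - T) y \<partial>lborel)"
    proof (rule nn_integral_mono)
      fix y show "ennreal (\<phi> y) * indicator (- B) y \<le> indicator (U - T) y"
        using \<phi>(4)[of y] \<phi>01[of y] T(2) by (auto split: split_indicator simp: ennreal_le_1)
    qed
    also have "\<dots> = emeasure lborel (U - T)" using U T by simp
    also have "\<dots> \<le> ennreal e" using U T by (auto simp: less_imp_le)
    finally show ?thesis using x by blast
  qed
  then show thesis using that r c by blast
qed

lemma full_ball:
  assumes B: "B \<in> sets borel"
    and inv: "\<And>i y. i \<in> I \<Longrightarrow> y \<in> cball z s \<Longrightarrow> h i y \<in> B \<longleftrightarrow> y \<in> B"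
    and pos: "emeasure lborel (B \<inter> ball z s) > 0"
  shows "\<exists>x\<in>cball z s. \<exists>r>0. emeasure lborel (ball x r - B) = 0"
proof (rule ccontr)
  assume contra: "\<not> ?thesis"
  obtain r c where r: "0 < r" "0 < c"
    "\<And>e. e > 0 \<Longrightarrow> \<exists>x\<in>cball z s. ennreal c * emeasure lborel (ball x r - B) \<le> ennreal e"
    using almost_full_balls[OF assms] by metis
  have "compact (cball z s)" by simp
  moreover have "\<And>x. x \<in> cball z s \<Longrightarrow> open (ball x (r/2))" by simp
  moreover have "cball z s \<subseteq> (\<Union>x\<in>cball z s. ball x (r/2))" using r by auto
  ultimately obtain F where F: "F \<subseteq> cball z s" "finite F" "cball z s \<subseteq> (\<Union>x\<in>F. ball x (r/2))"
    by (rule compactE_image)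
  define m where "m = Min ((\<lambda>x. emeasure lborel (ball x (r/2) - B)) ` F)"
  have "F \<noteq> {}" using F s by force
  then have "m \<in> (\<lambda>x. emeasure lborel (ball x (r/2) - B)) ` F" unfolding m_def using F by (intro Min_in) auto
  then obtain x0 where x0: "x0 \<in> F" "m = emeasure lborel (ball x0 (r/2) - B)" by blast
  have "m > 0" using contra r F x0 by (metis half_gt_zero subsetD zero_less_iff_neq_zero)
  moreover have "m \<le> emeasure lborel (ball x0 (r/2))" unfolding x0(2) by (intro emeasure_mono) auto
  then have "m < \<top>" using emeasure_lborel_ball_finite[of x0 "r/2"] by (auto simp: less_top[symmetric] top_unique)
  ultimately obtain m' where m': "m = ennreal m'" "m' > 0" by (cases m) auto
  obtain x where x: "x \<in> cball z s" "ennreal c * emeasure lborel (ball x r - B) \<le> ennreal (c * m' / 2)"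
    using r(3)[of "c * m' / 2"] r m' by (metis divide_pos_pos mult_pos_pos zero_less_numeral)
  obtain y where y: "y \<in> F" "x \<in> ball y (r/2)" using F x by blast
  have "ball y (r/2) \<subseteq> ball x r"
  proof
    fix u assume "u \<in> ball y (r/2)"
    then show "u \<in> ball x r" using y dist_triangle[of x u y] by (auto simp: dist_commute)
  qed
  then have "emeasure lborel (ball y (r/2) - B) \<le> emeasure lborel (ball x r - B)"
    using B by (intro emeasure_mono) auto
  moreover have "m \<le> emeasure lborel (ball y (r/2) - B)"
    unfolding m_def using F y by (intro Min_le) auto
  ultimately have "m \<le> emeasure lborel (ball x r - B)" by simp
  then have "ennreal c * ennreal m' \<le> ennreal (c * m' / 2)"
    using x(2) m' by (metis mult_left_mono order_trans zero_le)
  then show False using r m' by (simp add: ennreal_mult[symmetric] ennreal_le_iff)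
qed

end

section \<open>Change of variables for nonnegative integrands\<close>

lemma emeasure_differentiable_image:
  fixes g :: "real^'m::{finite,wellorder} \<Rightarrow> real^'m::_"
  assumes S: "S \<in> sets borel"
    and der: "\<And>x. x \<in> S \<Longrightarrow> (g has_derivative g' x) (at x within S)"
    and inj: "inj_on g S" and gS: "g ` S \<in> sets borel" "bounded (g ` S)"
  shows "emeasure lborel (g ` S) = (\<integral>\<^sup>+x. ennreal \<bar>det (matrix (g' x))\<bar> * indicator S x \<partial>lborel)"
proof -
  have "g ` S \<in> lmeasurable" using gS by (intro bounded_set_imp_lmeasurable) auto
  moreover have "S \<in> sets lebesgue" using S by auto
  ultimately have "((\<lambda>x. \<bar>det (matrix (g' x))\<bar>) has_integral measure lebesgue (g ` S)) S"
    using has_measure_differentiable_image[of S g g' "measure lebesgue (g ` S)"] der inj by auto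
  then have "(\<integral>\<^sup>+x. ennreal \<bar>det (matrix (g' x))\<bar> * indicator S x \<partial>lborel) = ennreal (measure lebesgue (g ` S))"
    by (intro nn_integral_has_integral_lebesgue') auto
  also have "\<dots> = emeasure lebesgue (g ` S)"
    using \<open>g ` S \<in> lmeasurable\<close> by (simp add: emeasure_eq_measure2)
  finally show ?thesis using gS by simp
qed

text \<open>Both sides are integrals of \<open>f\<close> with respect to measures, which agree on bounded sets by the formula for the
  measure of an image.\<close>
theorem nn_integral_change_of_variables:
  fixes g :: "real^'m::{finite,wellorder} \<Rightarrow> real^'m::_"
  assumes S: "S \<in> sets borel"
    and der: "\<And>x. x \<in> S \<Longrightarrow> (g has_derivative g' x) (at x within S)"
    and inj: "inj_on g S" and gS: "g ` S \<in> sets borel"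
    and J: "(\<lambda>x. ennreal \<bar>det (matrix (g' x))\<bar> * indicator S x) \<in> borel_measurable borel"
    and f: "f \<in> borel_measurable borel"
  shows "(\<integral>\<^sup>+x. indicator (g ` S) x * f x \<partial>lborel)
    = (\<integral>\<^sup>+y. ennreal \<bar>det (matrix (g' y))\<bar> * indicator S y * f (g y) \<partial>lborel)"
proof -
  define j where "j = (\<lambda>x. ennreal \<bar>det (matrix (g' x))\<bar> * indicator S x)"
  define g0 where "g0 = (\<lambda>x. if x \<in> S then g x else 0)"
  note [measurable] = S gS f
  have j [measurable]: "j \<in> borel_measurable borel" unfolding j_def by (rule J)
  have "continuous_on S g"
    using der by (auto simp: continuous_on_eq_continuous_within intro!: has_derivative_continuous)
  then have g0 [measurable]: "g0 \<in> borel_measurable borel"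
    unfolding g0_def using S
    by (intro borel_measurable_continuous_on_if) auto
  define M where "M = distr (density lborel j) borel g0"
  define M' where "M' = density lborel (indicator (g ` S) :: _ \<Rightarrow> ennreal)"
  have eqb: "emeasure M' E = emeasure M E" if E: "E \<in> sets borel" "bounded E" for E
  proof -
    note [measurable] = E(1)
    define S' where "S' = S \<inter> g0 -` E"
    have S': "S' \<in> sets borel" unfolding S'_def using measurable_sets[OF g0 E(1)] S by auto
    have im: "g ` S' = E \<inter> g ` S" by (auto simp: S'_def g0_def)
    have "emeasure M' E = emeasure lborel (g ` S')"
      unfolding M'_def im by (subst emeasure_density) (auto simp: indicator_inter_arith[symmetric] Int_commute)
    also have "\<dots> = (\<integral>\<^sup>+x. ennreal \<bar>det (matrix (g' x))\<bar> * indicator S' x \<partial>lborel)"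
    proof (rule emeasure_differentiable_image[OF S'])
      show "(g has_derivative g' x) (at x within S')" if "x \<in> S'" for x
        using der[of x] that by (auto simp: S'_def intro: has_derivative_subset)
      show "inj_on g S'" using inj by (auto simp: S'_def inj_on_def)
      show "g ` S' \<in> sets borel" "bounded (g ` S')" unfolding im using E gS by (auto intro: bounded_subset)
    qed
    also have "\<dots> = (\<integral>\<^sup>+x. j x * indicator E (g0 x) \<partial>lborel)"
      by (intro nn_integral_cong) (auto simp: j_def S'_def g0_def split: split_indicator)
    also have "\<dots> = emeasure M E"
    proof -
      have "emeasure M E = emeasure (density lborel j) (g0 -` E)"
        unfolding M_def by (subst emeasure_distr) auto
      also have "\<dots> = (\<integral>\<^sup>+x. j x * indicator (g0 -` E) x \<partial>lborel)"
        using measurable_sets[OF g0 E(1)] by (intro emeasure_density) auto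
      finally show ?thesis by (simp add: indicator_def vimage_def)
    qed
    finally show ?thesis .
  qed
  have "M' = M"
  proof (rule measure_eqI)
    show "sets M' = sets M" by (simp add: M_def M'_def)
    fix E assume "E \<in> sets M'"
    then have E: "E \<in> sets borel" by (simp add: M'_def)
    let ?A = "\<lambda>n::nat. E \<inter> ball 0 (real n)"
    have r: "range ?A \<subseteq> sets borel" using E by auto
    have inc: "incseq ?A" by (auto simp: incseq_def)
    have U: "(\<Union>n. ?A n) = E"
      by (auto intro: reals_Archimedean2)
    have "emeasure M' E = (SUP n. emeasure M' (?A n))"
      using SUP_emeasure_incseq[of ?A M', OF _ inc] r unfolding U by (simp add: M'_def)
    also have "\<dots> = (SUP n. emeasure M (?A n))"
      using E by (intro SUP_cong refl eqb) (auto intro: bounded_subset[OF bounded_ball])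
    also have "\<dots> = emeasure M E"
      using SUP_emeasure_incseq[of ?A M, OF _ inc] r unfolding U by (simp add: M_def)
    finally show "emeasure M' E = emeasure M E" .
  qed
  have "(\<integral>\<^sup>+x. indicator (g ` S) x * f x \<partial>lborel) = (\<integral>\<^sup>+x. f x \<partial>M')"
    unfolding M'_def by (subst nn_integral_density) auto
  also have "\<dots> = (\<integral>\<^sup>+y. j y * f (g0 y) \<partial>lborel)"
    unfolding \<open>M' = M\<close> M_def by (simp add: nn_integral_distr nn_integral_density)
  also have "\<dots> = (\<integral>\<^sup>+y. ennreal \<bar>det (matrix (g' y))\<bar> * indicator S y * f (g y) \<partial>lborel)"
    by (intro nn_integral_cong) (auto simp: j_def g0_def split: split_indicator)
  finally show ?thesis .
qed

section \<open>Nearly affine contractions of the plane\<close>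

lemma norm_matrix_vector_le: 
  fixes M :: "real^'n^'m" shows "norm (M *v x) \<le> norm M * norm x"
proof -
  have "norm (M *v x) = L2_set (\<lambda>i. (M *v x) $ i) UNIV" by (simp add: norm_vec_def L2_set_def)
  also have "\<dots> = L2_set (\<lambda>i. \<bar>M $ i \<bullet> x\<bar>) UNIV"
    by (simp add: matrix_mult_dot L2_set_def)
  also have "\<dots> \<le> L2_set (\<lambda>i. norm (M $ i) * norm x) UNIV"
    by (intro L2_set_mono Cauchy_Schwarz_ineq2) auto
  also have "\<dots> = norm M * norm x" by (simp add: L2_set_left_distrib[symmetric] norm_vec_def[of M])
  finally show ?thesis .
qed

text \<open>The four points around which the discs of radius \<open>9/10\<close>, even of radius \<open>74/100\<close>, cover the unit disc.\<close>
definition centers :: "(real^2) set" where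
  "centers = {(1/2) *\<^sub>R axis 1 1, - ((1/2) *\<^sub>R axis 1 1), (1/2) *\<^sub>R axis 2 1, - ((1/2) *\<^sub>R axis 2 1)}"

lemma finite_centers: "finite centers" by (simp add: centers_def)

lemma norm_center: "i \<in> centers \<Longrightarrow> norm i = 1/2"
  by (auto simp: centers_def)

lemma card_centers: "card centers \<le> 4"
  unfolding centers_def by (rule card_insert_le_m1 | simp add: card_insert_if)+

text \<open>With \<open>m\<close> the larger of the absolute values of the coordinates, the nearest centre is at squared
  distance \<open>|p|\<^sup>2 - m + 1/4\<close>. This is estimated by \<open>|p| \<le> 1\<close> when \<open>m\<close> is large and by
  \<open>|p|\<^sup>2 \<le> 2 m\<^sup>2\<close> when \<open>m\<close> is small.\<close>
lemma centers_cover: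
  assumes p: "norm (p :: real^2) \<le> 1" shows "\<exists>i\<in>centers. norm (p - i) \<le> 74/100"
proof -
  define a b where "a = p $ 1" and "b = p $ 2"
  have n2: "norm q \<le> 74/100 \<longleftrightarrow> (q $ 1)^2 + (q $ 2)^2 \<le> (74/100)^2" for q :: "real^2"
  proof -
    have "(norm q)^2 = (q $ 1)^2 + (q $ 2)^2" by (simp add: norm_vec_def L2_set_def sum_2)
    then show ?thesis using abs_le_square_iff[of "norm q" "74/100"] by simp
  qed
  have "(norm p)^2 \<le> 1" using p by (simp add: power_le_one)
  then have ab: "a^2 + b^2 \<le> 1" by (simp add: a_def b_def norm_vec_def L2_set_def sum_2)
  define m where "m = max \<bar>a\<bar> \<bar>b\<bar>"
  have m0: "m \<ge> 0" by (simp add: m_def)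
  have "a^2 \<le> m^2" "b^2 \<le> m^2" unfolding m_def by (auto simp: abs_le_square_iff[symmetric])
  then have s2: "a^2 + b^2 \<le> 2 * m^2" by simp
  have key: "a^2 + b^2 - m \<le> 2976/10000"
  proof (cases "m \<ge> 705/1000")
    case True then show ?thesis using ab by simp
  next
    case False
    have "2 * m^2 - m = m * (2 * m - 1)" by (simp add: power2_eq_square algebra_simps)
    also have "\<dots> \<le> 705/1000 * (410/1000)"
    proof (cases "2 * m - 1 \<ge> 0")
      case True then show ?thesis using False m0 by (intro mult_mono) auto
    next
      case F: False
      then have "m * (2 * m - 1) \<le> 0" using m0 by (simp add: mult_le_0_iff)
      then show ?thesis by simp
    qed
    finally show ?thesis using s2 by simp
  qed
  have "m = a \<or> m = - a \<or> m = b \<or> m = - b" unfolding m_def by (auto simp: max_def abs_if)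
  then consider "m = a" | "m = - a" | "m = b" | "m = - b" by blast
  then show ?thesis
  proof cases
    case 1
    have "norm (p - (1/2) *\<^sub>R axis 1 1) \<le> 74/100"
      unfolding n2 using key 1 by (simp add: a_def b_def axis_def power2_eq_square algebra_simps)
    then show ?thesis by (auto simp: centers_def)
  next
    case 2
    have "norm (p - (- ((1/2) *\<^sub>R axis 1 1))) \<le> 74/100"
      unfolding n2 using key 2 by (simp add: a_def b_def axis_def power2_eq_square algebra_simps)
    then show ?thesis unfolding centers_def by blast
  next
    case 3
    have "norm (p - (1/2) *\<^sub>R axis 2 1) \<le> 74/100"
      unfolding n2 using key 3 by (simp add: a_def b_def axis_def power2_eq_square algebra_simps)
    then show ?thesis unfolding centers_def by blast
  next
    case 4
    have "norm (p - (- ((1/2) *\<^sub>R axis 2 1))) \<le> 74/100"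
      unfolding n2 using key 4 by (simp add: a_def b_def axis_def power2_eq_square algebra_simps)
    then show ?thesis unfolding centers_def by blast
  qed
qed

text \<open>Contractions that are \<open>C\<^sup>1\<close>-close to \<open>y \<mapsto> z + (9/10) (y - z) + s i\<close>, with derivative \<open>J i y\<close>. The
  tolerance \<open>1/100\<close> accounts for the cutoff of the generators and for their perturbation, half each.\<close>
locale near_affine_ifs =
  fixes z :: "real^2" and s \<alpha> C :: real and h :: "real^2 \<Rightarrow> real^2 \<Rightarrow> real^2" and J :: "real^2 \<Rightarrow> real^2 \<Rightarrow> real^2^2"
  assumes s: "s > 0" and \<alpha>: "0 < \<alpha>" "\<alpha> \<le> 1" and C: "C \<ge> 0"
    and der: "\<And>i y. i \<in> centers \<Longrightarrow> y \<in> cball z (4 * s) \<Longrightarrow> (h i has_derivative (\<lambda>v. J i y *v v)) (at y)"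
    and near: "\<And>i y. i \<in> centers \<Longrightarrow> y \<in> cball z (4 * s) \<Longrightarrow>
        norm (h i y - (z + (9/10) *\<^sub>R (y - z) + s *\<^sub>R i)) \<le> s / 100"
    and J_near: "\<And>i y v. i \<in> centers \<Longrightarrow> y \<in> cball z (4 * s) \<Longrightarrow> norm (J i y *v v - (9/10) *\<^sub>R v) \<le> 1/100 * norm v"
    and J_holder: "\<And>i y y'. i \<in> centers \<Longrightarrow> y \<in> cball z (4 * s) \<Longrightarrow> y' \<in> cball z (4 * s) \<Longrightarrow>
        norm (J i y - J i y') \<le> C * dist y y' powr \<alpha>"
    and inj: "\<And>i. i \<in> centers \<Longrightarrow> inj_on (h i) (cball z (4 * s))"
begin

lemma contraction:
  assumes i: "i \<in> centers" and y: "y \<in> cball z (4 * s)" "y' \<in> cball z (4 * s)"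
  shows "dist (h i y) (h i y') \<le> 91/100 * dist y y'"
  unfolding dist_norm
proof (rule differentiable_bound[OF convex_cball _ _ y])
  fix u assume u: "u \<in> cball z (4 * s)"
  show "(h i has_derivative (\<lambda>v. J i u *v v)) (at u within cball z (4 * s))"
    by (rule has_derivative_at_withinI[OF der[OF i u]])
  show "onorm (\<lambda>v. J i u *v v) \<le> 91/100"
  proof (rule onorm_le)
    fix v
    have "norm (J i u *v v) \<le> norm (J i u *v v - (9/10) *\<^sub>R v) + norm ((9/10) *\<^sub>R v)" by norm
    also have "\<dots> \<le> 1/100 * norm v + 9/10 * norm v" using J_near[OF i u, of v] by simp
    finally show "norm (J i u *v v) \<le> 91/100 * norm v" by simp
  qed
qed

text \<open>A Newton iteration with the unperturbed derivative solves \<open>h i y = x\<close>.\<close>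
lemma onto:
  assumes i: "i \<in> centers" and x: "dist x (z + s *\<^sub>R i) \<le> 88/100 * s"
  shows "\<exists>y\<in>cball z s. h i y = x"
proof -
  \<comment> \<open>The fixed points of \<open>T\<close> are the solutions of \<open>h i y = x\<close>.\<close>
  define T where "T = (\<lambda>y. y + (10/9) *\<^sub>R (x - h i y))"
  have sub: "cball z s \<subseteq> cball z (4 * s)" using s by auto
  have "\<exists>!y\<in>cball z s. T y = y"
  proof (rule Banach_fix[OF compact_imp_complete[OF compact_cball]])
    show "cball z s \<noteq> {}" using s by auto
    show "0 \<le> (1/10::real)" "(1/10::real) < 1" by auto
    show "T ` cball z s \<subseteq> cball z s"
    proof safe
      fix y assume y: "y \<in> cball z s"
      define e where "e = h i y - (z + (9/10) *\<^sub>R (y - z) + s *\<^sub>R i)"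
      have e: "norm e \<le> s / 100" unfolding e_def using near[OF i] y sub by blast
      have "T y - z = (10/9) *\<^sub>R ((x - (z + s *\<^sub>R i)) - e)"
        unfolding T_def e_def by (simp add: algebra_simps scaleR_add_left[symmetric])
      then have "norm (T y - z) = 10/9 * norm ((x - (z + s *\<^sub>R i)) - e)" by simp
      also have "\<dots> \<le> 10/9 * (88/100 * s + s / 100)"
        using e x norm_triangle_ineq4[of "x - (z + s *\<^sub>R i)" e] by (intro mult_left_mono) (auto simp: dist_norm)
      also have "\<dots> \<le> s" using s by simp
      finally show "T y \<in> cball z s" by (simp add: dist_norm norm_minus_commute)
    qed
    fix y y' assume yy': "y \<in> cball z s" "y' \<in> cball z s"
    show "dist (T y) (T y') \<le> 1/10 * dist y y'"
      unfolding dist_norm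
    proof (rule differentiable_bound[OF convex_cball _ _ yy'])
      fix u assume "u \<in> cball z s"
      then have u: "u \<in> cball z (4 * s)" using sub by blast
      show "(T has_derivative (\<lambda>v. v + (10/9) *\<^sub>R (0 - J i u *v v))) (at u within cball z s)"
        unfolding T_def by (intro derivative_intros has_derivative_at_withinI[OF der[OF i u]])
      show "onorm (\<lambda>v. v + (10/9) *\<^sub>R (0 - J i u *v v)) \<le> 1/10"
      proof (rule onorm_le)
        fix v
        have "v + (10/9) *\<^sub>R (0 - J i u *v v) = - ((10/9) *\<^sub>R (J i u *v v - (9/10) *\<^sub>R v))"
          by (simp add: algebra_simps)
        then have "norm (v + (10/9) *\<^sub>R (0 - J i u *v v)) = 10/9 * norm (J i u *v v - (9/10) *\<^sub>R v)" by simp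
        also have "\<dots> \<le> 10/9 * (1/100 * norm v)" by (intro mult_left_mono J_near[OF i u]) auto
        also have "\<dots> \<le> 1/10 * norm v" by simp
        finally show "norm (v + (10/9) *\<^sub>R (0 - J i u *v v)) \<le> 1/10 * norm v" .
      qed
    qed
  qed
  then obtain y where "y \<in> cball z s" "T y = y" by blast
  then show ?thesis by (intro bexI[of _ y]) (auto simp: T_def)
qed

text \<open>Since the images of \<open>D\<close> cover \<open>D\<close>, every \<open>p\<close> in \<open>D\<close> has a backward orbit that stays in \<open>D\<close>. The
  composition \<open>k\<close> of the \<open>n\<close> contractions along it maps all of \<open>D\<close> into the ball of radius
  \<open>2 s (91/100)\<^sup>n\<close> around \<open>p\<close>, hence into \<open>V\<close>.\<close>
lemma reach:
  assumes p: "p \<in> cball z s" and r: "r > 0" "ball p r \<subseteq> V"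
    and inv: "\<And>i y. i \<in> centers \<Longrightarrow> y \<in> cball z (3 * s) \<Longrightarrow> h i y \<in> V \<Longrightarrow> y \<in> V"
  shows "cball z s \<subseteq> V"
proof -
  have claim: "\<exists>k. (\<forall>x\<in>cball z s. dist (k x) p \<le> 2 * s * (91/100)^n \<and> (k x \<in> V \<longrightarrow> x \<in> V))"
    if "p \<in> cball z s" for p n
    using that
  proof (induction n arbitrary: p)
    case 0
    have "dist x p \<le> 2 * s" if "x \<in> cball z s" for x
      using dist_triangle2[of x p z] that 0 by (auto simp: dist_commute)
    then show ?case by (intro exI[of _ "\<lambda>x. x"]) auto
  next
    case (Suc n)
    have "norm ((1/s) *\<^sub>R (p - z)) \<le> 1" using Suc.prems s by (simp add: dist_norm norm_minus_commute)
    then obtain i where i: "i \<in> centers" "norm ((1/s) *\<^sub>R (p - z) - i) \<le> 74/100" using centers_cover by blast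
    have "p - (z + s *\<^sub>R i) = s *\<^sub>R ((1/s) *\<^sub>R (p - z) - i)" using s by (simp add: algebra_simps)
    then have "dist p (z + s *\<^sub>R i) = s * norm ((1/s) *\<^sub>R (p - z) - i)" using s by (simp add: dist_norm)
    also have "\<dots> \<le> s * (74/100)" using i s by (intro mult_left_mono) auto
    also have "\<dots> \<le> 88/100 * s" using s by simp
    finally obtain p1 where p1: "p1 \<in> cball z s" "h i p1 = p" using onto[OF i(1)] by blast
    obtain k where k: "\<And>x. x \<in> cball z s \<Longrightarrow> dist (k x) p1 \<le> 2 * s * (91/100)^n"
        "\<And>x. x \<in> cball z s \<Longrightarrow> k x \<in> V \<Longrightarrow> x \<in> V"
      using Suc.IH[OF p1(1)] by blast
    show ?case
    proof (intro exI[of _ "\<lambda>x. h i (k x)"] ballI conjI impI)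
      fix x assume x: "x \<in> cball z s"
      have "(91/100)^n \<le> (1::real)" by (intro power_le_one) auto
      then have "2 * s * (91/100)^n \<le> 2 * s" using s by simp
      then have "dist (k x) p1 \<le> 2 * s" using k(1)[OF x] by linarith
      then have kx: "k x \<in> cball z (3 * s)" using dist_triangle[of z "k x" p1] p1(1) by (auto simp: dist_commute)
      then have kx4: "k x \<in> cball z (4 * s)" "p1 \<in> cball z (4 * s)" using s p1 by auto
      have "dist (h i (k x)) (h i p1) \<le> 91/100 * dist (k x) p1" by (rule contraction[OF i(1) kx4])
      also have "\<dots> \<le> 91/100 * (2 * s * (91/100)^n)" using k(1)[OF x] by (intro mult_left_mono) auto
      finally show "dist (h i (k x)) p \<le> 2 * s * (91/100)^Suc n" using p1 by simp
      assume "h i (k x) \<in> V"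
      then show "x \<in> V" using inv[OF i(1) kx] k(2)[OF x] by blast
    qed
  qed
  have "(\<lambda>n. 2 * s * (91/100)^n) \<longlonglongrightarrow> 2 * s * 0"
    by (intro tendsto_mult tendsto_const LIMSEQ_power_zero) auto
  then have "eventually (\<lambda>n. 2 * s * (91/100)^n < r) sequentially" using r by (intro order_tendstoD) auto
  then obtain n where n: "2 * s * (91/100)^n < r" by (auto simp: eventually_sequentially)
  obtain k where k: "\<And>x. x \<in> cball z s \<Longrightarrow> dist (k x) p \<le> 2 * s * (91/100)^n"
        "\<And>x. x \<in> cball z s \<Longrightarrow> k x \<in> V \<Longrightarrow> x \<in> V" using claim[OF p] by blast
  show ?thesis
  proof
    fix x assume x: "x \<in> cball z s"
    have "k x \<in> ball p r" using k(1)[OF x] n by (simp add: dist_commute)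
    then show "x \<in> V" using k(2)[OF x] r by blast
  qed
qed

text \<open>The radius \<open>88/100\<close> is larger than \<open>74/100\<close>, so that the hats cover the disc, and so much smaller than
  \<open>9/10\<close> that the support of each hat lies in the image of the disc under the perturbed contraction.\<close>
definition hat :: "real^2 \<Rightarrow> real^2 \<Rightarrow> real" where
  "hat i x = max 0 (88/100 * s - dist x (z + s *\<^sub>R i))"

text \<open>On the disc the sum of the hats is at least \<open>(88/100 - 74/100) s\<close>; cutting off at \<open>s/10\<close> keeps the quotient
  Lipschitz elsewhere.\<close>
definition hats :: "real^2 \<Rightarrow> real" where
  "hats x = max (s / 10) (\<Sum>j\<in>centers. hat j x)"

definition \<xi> :: "real^2 \<Rightarrow> real^2 \<Rightarrow> real" where
  "\<xi> i x = hat i x / hats x"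

lemma hat_nonneg: "hat i x \<ge> 0" by (simp add: hat_def)
lemma hats_pos: "hats x \<ge> s / 10" "hats x > 0" using s by (auto simp: hats_def less_max_iff_disj)
lemma hat_le_hats: "i \<in> centers \<Longrightarrow> hat i x \<le> hats x"
  unfolding hats_def using member_le_sum[of i centers "\<lambda>j. hat j x"] hat_nonneg finite_centers by (simp add: le_max_iff_disj)

lemma \<xi>_bounds: "i \<in> centers \<Longrightarrow> 0 \<le> \<xi> i x" "i \<in> centers \<Longrightarrow> \<xi> i x \<le> 1"
  unfolding \<xi>_def using hat_nonneg hats_pos(2)[of x] hat_le_hats by (auto simp: divide_le_eq_1)

lemma hat_lipschitz: "\<bar>hat i x - hat i y\<bar> \<le> dist x y"
  using dist_triangle[of x "z + s *\<^sub>R i" y] dist_triangle[of y "z + s *\<^sub>R i" x]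
  unfolding hat_def by (auto simp: dist_commute max_def)

lemma hats_lipschitz: "\<bar>hats x - hats y\<bar> \<le> 4 * dist x y"
proof -
  have "\<bar>hats x - hats y\<bar> \<le> \<bar>(\<Sum>j\<in>centers. hat j x) - (\<Sum>j\<in>centers. hat j y)\<bar>" unfolding hats_def by auto
  also have "\<dots> = \<bar>\<Sum>j\<in>centers. hat j x - hat j y\<bar>" by (simp add: sum_subtractf)
  also have "\<dots> \<le> (\<Sum>j\<in>centers. \<bar>hat j x - hat j y\<bar>)" by (rule sum_abs)
  also have "\<dots> \<le> (\<Sum>j\<in>centers. dist x y)" by (intro sum_mono hat_lipschitz)
  also have "\<dots> = real (card centers) * dist x y" by simp
  also have "\<dots> \<le> 4 * dist x y" using card_centers by (intro mult_right_mono) auto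
  finally show ?thesis .
qed

lemma \<xi>_lipschitz:
  assumes i: "i \<in> centers" shows "\<bar>\<xi> i x - \<xi> i y\<bar> \<le> 50 / s * dist x y"
proof -
  have "\<xi> i x - \<xi> i y = (hat i x - hat i y) / hats x + \<xi> i y * (hats y - hats x) / hats x"
    unfolding \<xi>_def using hats_pos(2)[of x] hats_pos(2)[of y] by (simp add: field_simps)
  also have "\<bar>\<dots>\<bar> \<le> \<bar>(hat i x - hat i y) / hats x\<bar> + \<bar>\<xi> i y * (hats y - hats x) / hats x\<bar>" by (rule abs_triangle_ineq)
  also have "\<dots> = \<bar>hat i x - hat i y\<bar> / hats x + \<xi> i y * \<bar>hats y - hats x\<bar> / hats x"
    using hats_pos(2)[of x] \<xi>_bounds[OF i, of y] by (simp add: abs_mult)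
  also have "\<dots> \<le> dist x y / (s / 10) + 1 * (4 * dist x y) / (s / 10)"
    using hats_pos[of x] \<xi>_bounds[OF i, of y] hat_lipschitz[of i x y] hats_lipschitz[of y x] s
    by (intro add_mono frac_le mult_mono) (auto simp: dist_commute)
  also have "\<dots> = 50 / s * dist x y" by simp
  finally show ?thesis .
qed

lemma sum_\<xi>: "(\<Sum>i\<in>centers. \<xi> i x) \<le> 1" "x \<in> cball z s \<Longrightarrow> (\<Sum>i\<in>centers. \<xi> i x) = 1"
proof -
  have e: "(\<Sum>i\<in>centers. \<xi> i x) = (\<Sum>i\<in>centers. hat i x) / hats x" unfolding \<xi>_def by (simp add: sum_divide_distrib)
  show "(\<Sum>i\<in>centers. \<xi> i x) \<le> 1" unfolding e using hats_pos(2)[of x] by (simp add: divide_le_eq_1 hats_def)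
  assume x: "x \<in> cball z s"
  have "norm ((1/s) *\<^sub>R (x - z)) \<le> 1" using x s by (simp add: dist_norm norm_minus_commute)
  then obtain i where i: "i \<in> centers" "norm ((1/s) *\<^sub>R (x - z) - i) \<le> 74/100" using centers_cover by blast
  have "x - (z + s *\<^sub>R i) = s *\<^sub>R ((1/s) *\<^sub>R (x - z) - i)" using s by (simp add: algebra_simps)
  then have "dist x (z + s *\<^sub>R i) = s * norm ((1/s) *\<^sub>R (x - z) - i)" using s by (simp add: dist_norm)
  also have "\<dots> \<le> s * (74/100)" using i s by (intro mult_left_mono) auto
  finally have "s / 10 \<le> hat i x" unfolding hat_def using s by simp
  also have "\<dots> \<le> (\<Sum>j\<in>centers. hat j x)" using i hat_nonneg finite_centers by (intro member_le_sum) auto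
  finally have "hats x = (\<Sum>j\<in>centers. hat j x)" by (simp add: hats_def)
  then show "(\<Sum>i\<in>centers. \<xi> i x) = 1" unfolding e using hats_pos(2)[of x] by simp
qed

lemma \<xi>_support: "\<xi> i x \<noteq> 0 \<Longrightarrow> dist x (z + s *\<^sub>R i) \<le> 88/100 * s"
  unfolding \<xi>_def hat_def by (auto simp: max_def split: if_splits)

lemma \<xi>_pullback_support:
  assumes i: "i \<in> centers" and y: "y \<in> cball z (4 * s)" "y \<notin> cball z s" shows "\<xi> i (h i y) = 0"
proof (rule ccontr)
  assume "\<xi> i (h i y) \<noteq> 0"
  then have a: "norm (h i y - (z + s *\<^sub>R i)) \<le> 88/100 * s" using \<xi>_support by (simp add: dist_norm)
  have "(9/10) *\<^sub>R (y - z) = (h i y - (z + s *\<^sub>R i)) - (h i y - (z + (9/10) *\<^sub>R (y - z) + s *\<^sub>R i))" by simp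
  then have "norm ((9/10) *\<^sub>R (y - z)) \<le> norm (h i y - (z + s *\<^sub>R i)) + norm (h i y - (z + (9/10) *\<^sub>R (y - z) + s *\<^sub>R i))"
    by (metis norm_triangle_ineq4)
  then have "9/10 * norm (y - z) \<le> 88/100 * s + s / 100" using a near[OF i y(1)] by simp
  moreover have "norm (y - z) > s" using y(2) by (simp add: dist_norm norm_minus_commute)
  ultimately show False using s by simp
qed

lemma J_entry: "i \<in> centers \<Longrightarrow> y \<in> cball z (4 * s) \<Longrightarrow> \<bar>J i y $ a $ b - (if a = b then 9/10 else 0)\<bar> \<le> 1/100"
proof -
  assume i: "i \<in> centers" "y \<in> cball z (4 * s)"
  have "J i y $ a $ b - (if a = b then 9/10 else 0) = (J i y *v axis b 1 - (9/10) *\<^sub>R axis b 1) $ a"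
  proof -
    have "(J i y *v axis b 1) $ a = J i y $ a $ b" by (simp add: matrix_vector_mult_basis column_def)
    then show ?thesis by (simp add: axis_def)
  qed
  also have "\<bar>\<dots>\<bar> \<le> norm (J i y *v axis b 1 - (9/10) *\<^sub>R axis b 1)" by (rule component_le_norm_cart)
  also have "\<dots> \<le> 1/100" using J_near[OF i, of "axis b 1"] by simp
  finally show ?thesis .
qed

lemma J_entry_le: "i \<in> centers \<Longrightarrow> y \<in> cball z (4 * s) \<Longrightarrow> \<bar>J i y $ a $ b\<bar> \<le> 1"
proof -
  assume "i \<in> centers" "y \<in> cball z (4 * s)"
  note e = J_entry[OF this, of a b]
  show "\<bar>J i y $ a $ b\<bar> \<le> 1"
  proof (cases "a = b")
    case True
    then have "\<bar>J i y $ a $ b - 9/10\<bar> \<le> 1/100" using e by simp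
    then show ?thesis by linarith
  next
    case False
    then have "\<bar>J i y $ a $ b - 0\<bar> \<le> 1/100" using e by simp
    then show ?thesis by linarith
  qed
qed

lemma det_bounds:
  assumes i: "i \<in> centers" "y \<in> cball z (4 * s)" shows "1/2 \<le> \<bar>det (J i y)\<bar>" "\<bar>det (J i y)\<bar> \<le> 2"
proof -
  let ?M = "J i y"
  have e: "\<bar>?M $ 1 $ 1 - 9/10\<bar> \<le> 1/100" "\<bar>?M $ 2 $ 2 - 9/10\<bar> \<le> 1/100" "\<bar>?M $ 1 $ 2\<bar> \<le> 1/100" "\<bar>?M $ 2 $ 1\<bar> \<le> 1/100"
    using J_entry[OF i, of 1 1] J_entry[OF i, of 2 2] J_entry[OF i, of 1 2] J_entry[OF i, of 2 1] by auto
  have e': "89/100 \<le> ?M $ 1 $ 1" "89/100 \<le> ?M $ 2 $ 2" "?M $ 1 $ 1 \<le> 1" "?M $ 2 $ 2 \<le> 1"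
    using e(1,2) by linarith+
  have "(89/100) * (89/100) \<le> ?M $ 1 $ 1 * ?M $ 2 $ 2" using e' by (intro mult_mono) auto
  moreover have "\<bar>?M $ 1 $ 2 * ?M $ 2 $ 1\<bar> \<le> 1/100 * (1/100)" unfolding abs_mult using e by (intro mult_mono) auto
  moreover have "?M $ 1 $ 1 * ?M $ 2 $ 2 \<le> 1 * 1" using e' by (intro mult_mono) auto
  ultimately show "1/2 \<le> \<bar>det (J i y)\<bar>" "\<bar>det (J i y)\<bar> \<le> 2" unfolding det_2 by auto
qed

lemma det_holder:
  assumes i: "i \<in> centers" and y: "y \<in> cball z (4 * s)" "y' \<in> cball z (4 * s)"
  shows "\<bar>det (J i y) - det (J i y')\<bar> \<le> 4 * C * dist y y' powr \<alpha>"
proof -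
  let ?M = "J i y" and ?M' = "J i y'" and ?\<delta> = "C * dist y y' powr \<alpha>"
  have d: "\<bar>?M $ a $ b - ?M' $ a $ b\<bar> \<le> ?\<delta>" for a b
  proof -
    have "\<bar>?M $ a $ b - ?M' $ a $ b\<bar> = \<bar>(?M - ?M') $ a $ b\<bar>" by simp
    also have "\<dots> \<le> norm ((?M - ?M') $ a)" by (rule component_le_norm_cart)
    also have "\<dots> \<le> norm (?M - ?M')" by (rule Finite_Cartesian_Product.norm_nth_le)
    finally show ?thesis using J_holder[OF i y] by linarith
  qed
  have p: "\<bar>?M $ a $ b * ?M $ c $ e - ?M' $ a $ b * ?M' $ c $ e\<bar> \<le> 2 * ?\<delta>" for a b c e
  proof -
    have "?M $ a $ b * ?M $ c $ e - ?M' $ a $ b * ?M' $ c $ e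
      = (?M $ a $ b - ?M' $ a $ b) * ?M $ c $ e + ?M' $ a $ b * (?M $ c $ e - ?M' $ c $ e)" by (simp add: algebra_simps)
    also have "\<bar>\<dots>\<bar> \<le> \<bar>(?M $ a $ b - ?M' $ a $ b) * ?M $ c $ e\<bar> + \<bar>?M' $ a $ b * (?M $ c $ e - ?M' $ c $ e)\<bar>"
      by (rule abs_triangle_ineq)
    also have "\<dots> \<le> ?\<delta> * 1 + 1 * ?\<delta>"
      unfolding abs_mult using d J_entry_le[OF i] y C by (intro add_mono mult_mono) auto
    finally show ?thesis by simp
  qed
  show ?thesis unfolding det_2 using p[of 1 1 2 2] p[of 1 2 2 1] by linarith
qed

definition w :: "real^2 \<Rightarrow> real^2 \<Rightarrow> real" where
  "w i y = (if y \<in> cball z s then \<xi> i (h i y) * \<bar>det (J i y)\<bar> else 0)"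

definition h' :: "real^2 \<Rightarrow> real^2 \<Rightarrow> real^2" where
  "h' i y = (if y \<in> cball z (4 * s) then h i y else z)"

lemma det_continuous: "i \<in> centers \<Longrightarrow> continuous_on (cball z (4 * s)) (\<lambda>y. det (J i y))"
  using det_holder by (intro holder_continuous_on[OF \<alpha>(1)]) (auto simp: dist_real_def)

lemma h_continuous: "i \<in> centers \<Longrightarrow> continuous_on (cball z (4 * s)) (h i)"
  using der by (intro has_derivative_continuous_on) (blast intro: has_derivative_at_withinI)

lemma change_variables:
  assumes i: "i \<in> centers" and S: "S \<subseteq> cball z (4 * s)" "S \<in> sets borel" "h i ` S \<in> sets borel"
    and f: "f \<in> borel_measurable borel"
  shows "(\<integral>\<^sup>+x. indicator (h i ` S) x * f x \<partial>lborel) = (\<integral>\<^sup>+y. ennreal \<bar>det (J i y)\<bar> * indicator S y * f (h i y) \<partial>lborel)"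
proof -
  have "(\<integral>\<^sup>+x. indicator (h i ` S) x * f x \<partial>lborel)
      = (\<integral>\<^sup>+y. ennreal \<bar>det (matrix (\<lambda>v. J i y *v v))\<bar> * indicator S y * f (h i y) \<partial>lborel)"
  proof (rule nn_integral_change_of_variables[OF S(2) _ _ S(3) _ f])
    show "(h i has_derivative (\<lambda>v. J i x *v v)) (at x within S)" if "x \<in> S" for x
      using that S by (intro has_derivative_at_withinI[OF der[OF i]]) auto
    show "inj_on (h i) S" using inj[OF i] S by (auto intro: inj_on_subset)
    have "continuous_on S (\<lambda>x. ennreal \<bar>det (J i x)\<bar>)"
      by (intro continuous_on_ennreal continuous_intros continuous_on_subset[OF det_continuous[OF i] S(1)])
    then have "(\<lambda>x. if x \<in> S then ennreal \<bar>det (J i x)\<bar> else 0) \<in> borel_measurable borel"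
      using S by (intro borel_measurable_continuous_on_if) auto
    moreover have "(\<lambda>x. ennreal \<bar>det (matrix (\<lambda>v. J i x *v v))\<bar> * indicator S x) = (\<lambda>x. if x \<in> S then ennreal \<bar>det (J i x)\<bar> else 0)"
      by (auto simp: matrix_of_matrix_vector_mul)
    ultimately show "(\<lambda>x. ennreal \<bar>det (matrix (\<lambda>v. J i x *v v))\<bar> * indicator S x) \<in> borel_measurable borel" by simp
  qed
  then show ?thesis by (simp add: matrix_of_matrix_vector_mul)
qed

lemma \<xi>_borel: "i \<in> centers \<Longrightarrow> \<xi> i \<in> borel_measurable borel"
proof (rule borel_measurable_continuous_onI)
  assume i: "i \<in> centers"
  show "continuous_on UNIV (\<xi> i)"
    using \<xi>_lipschitz[OF i] by (intro holder_continuous_on[where \<alpha> = 1 and C = "50/s"]) (auto simp: dist_real_def)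
qed

text \<open>On the whole ball of radius \<open>4 s\<close> the formula \<open>(\<xi>\<^sub>i \<circ> h\<^sub>i) |det J|\<close> for \<open>w\<close> is valid by
  \<open>\<xi>_pullback_support\<close>. The Lipschitz factor is turned into a Hoelder one, the distances being at most \<open>8 s\<close>.\<close>
lemma w_holder:
  assumes i: "i \<in> centers" and y: "y \<in> ball z (4 * s)" "y' \<in> ball z (4 * s)"
  shows "\<bar>w i y - w i y'\<bar> \<le> (100 / s * (8 * s) powr (1 - \<alpha>) + 4 * C) * dist y y' powr \<alpha>"
proof -
  have yc: "y \<in> cball z (4 * s)" "y' \<in> cball z (4 * s)" using y by auto
  have w: "w i v = \<xi> i (h i v) * \<bar>det (J i v)\<bar>" if "v \<in> cball z (4 * s)" for v
    using \<xi>_pullback_support[OF i that] by (auto simp: w_def)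
  have "dist y y' \<le> 8 * s" using dist_triangle2[of y y' z] yc by (auto simp: dist_commute)
  then have "dist y y' powr (1 - \<alpha>) \<le> (8 * s) powr (1 - \<alpha>)" using \<alpha> by (intro powr_mono2) auto
  then have "dist y y' powr (1 - \<alpha>) * dist y y' powr \<alpha> \<le> (8 * s) powr (1 - \<alpha>) * dist y y' powr \<alpha>"
    by (rule mult_right_mono) simp
  then have dd: "dist y y' \<le> (8 * s) powr (1 - \<alpha>) * dist y y' powr \<alpha>"
    by (cases "y = y'") (auto simp: powr_add[symmetric])
  have "w i y - w i y' = (\<xi> i (h i y) - \<xi> i (h i y')) * \<bar>det (J i y)\<bar> + \<xi> i (h i y') * (\<bar>det (J i y)\<bar> - \<bar>det (J i y')\<bar>)"
    unfolding w[OF yc(1)] w[OF yc(2)] by (simp add: algebra_simps)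
  also have "\<bar>\<dots>\<bar> \<le> \<bar>(\<xi> i (h i y) - \<xi> i (h i y')) * \<bar>det (J i y)\<bar>\<bar> + \<bar>\<xi> i (h i y') * (\<bar>det (J i y)\<bar> - \<bar>det (J i y')\<bar>)\<bar>"
    by (rule abs_triangle_ineq)
  also have "\<dots> \<le> (50 / s * dist y y') * 2 + 1 * (4 * C * dist y y' powr \<alpha>)"
    unfolding abs_mult abs_abs
  proof (intro add_mono mult_mono)
    have "\<bar>\<xi> i (h i y) - \<xi> i (h i y')\<bar> \<le> 50 / s * dist (h i y) (h i y')" by (rule \<xi>_lipschitz[OF i])
    also have "\<dots> \<le> 50 / s * dist y y'"
      using contraction[OF i yc] s zero_le_dist[of y y'] by (intro mult_left_mono) (linarith, simp)
    finally show "\<bar>\<xi> i (h i y) - \<xi> i (h i y')\<bar> \<le> 50 / s * dist y y'" .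
    show "\<bar>\<bar>det (J i y)\<bar> - \<bar>det (J i y')\<bar>\<bar> \<le> 4 * C * dist y y' powr \<alpha>" using det_holder[OF i yc] by linarith
  qed (use s det_bounds[OF i yc(1)] \<xi>_bounds[OF i, of "h i y'"] in auto)
  also have "\<dots> = 100 / s * dist y y' + 4 * C * dist y y' powr \<alpha>" by simp
  also have "\<dots> \<le> 100 / s * ((8 * s) powr (1 - \<alpha>) * dist y y' powr \<alpha>) + 4 * C * dist y y' powr \<alpha>"
    using dd s by (intro add_right_mono mult_left_mono) auto
  also have "\<dots> = (100 / s * (8 * s) powr (1 - \<alpha>) + 4 * C) * dist y y' powr \<alpha>" by (simp add: algebra_simps)
  finally show ?thesis .
qed

text \<open>The support of \<open>\<xi> i\<close> lies in the image of the disc, so nothing is lost when \<open>\<xi> i\<close> is pulled back.\<close>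
lemma transport:
  assumes i: "i \<in> centers" and g: "g \<in> borel_measurable borel"
  shows "(\<integral>\<^sup>+y. ennreal (w i y) * g (h' i y) \<partial>lborel) = (\<integral>\<^sup>+x. ennreal (\<xi> i x) * g x \<partial>lborel)"
proof -
  let ?S = "cball z s"
  have S: "?S \<subseteq> cball z (4 * s)" using s by auto
  have "compact (h i ` ?S)" by (intro compact_continuous_image continuous_on_subset[OF h_continuous[OF i] S]) auto
  then have hS: "h i ` ?S \<in> sets borel" by (auto intro: borel_closed compact_imp_closed)
  have m: "(\<lambda>x. ennreal (\<xi> i x) * g x) \<in> borel_measurable borel" using \<xi>_borel[OF i] g by measurable
  have "(\<integral>\<^sup>+x. ennreal (\<xi> i x) * g x \<partial>lborel) = (\<integral>\<^sup>+x. indicator (h i ` ?S) x * (ennreal (\<xi> i x) * g x) \<partial>lborel)"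
  proof (rule nn_integral_cong)
    fix x show "ennreal (\<xi> i x) * g x = indicator (h i ` ?S) x * (ennreal (\<xi> i x) * g x)"
    proof (cases "\<xi> i x = 0")
      case False
      then have "x \<in> h i ` ?S" using onto[OF i \<xi>_support[OF False]] by blast
      then show ?thesis by simp
    qed simp
  qed
  also have "\<dots> = (\<integral>\<^sup>+y. ennreal \<bar>det (J i y)\<bar> * indicator ?S y * (ennreal (\<xi> i (h i y)) * g (h i y)) \<partial>lborel)"
    by (rule change_variables[OF i S _ hS m]) auto
  also have "\<dots> = (\<integral>\<^sup>+y. ennreal (w i y) * g (h' i y) \<partial>lborel)"
  proof (rule nn_integral_cong)
    fix y
    show "ennreal \<bar>det (J i y)\<bar> * indicator ?S y * (ennreal (\<xi> i (h i y)) * g (h i y)) = ennreal (w i y) * g (h' i y)"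
      using S s \<xi>_bounds[OF i, of "h i y"] by (auto simp: w_def h'_def ennreal_mult mult_ac split: split_indicator)
  qed
  finally show ?thesis by simp
qed

lemma pull:
  assumes i: "i \<in> centers" and g: "g \<in> borel_measurable borel"
  shows "(\<integral>\<^sup>+y. indicator (ball z (4 * s)) y * g (h' i y) \<partial>lborel) \<le> ennreal 2 * (\<integral>\<^sup>+x. g x \<partial>lborel)"
proof -
  let ?S = "ball z (4 * s)"
  have S: "?S \<subseteq> cball z (4 * s)" by auto
  have "open (h i ` ?S)"
    by (rule invariance_of_domain[OF continuous_on_subset[OF h_continuous[OF i] S] open_ball inj_on_subset[OF inj[OF i] S]])
  then have hS: "h i ` ?S \<in> sets borel" by auto
  have eq: "(\<integral>\<^sup>+x. indicator (h i ` ?S) x * g x \<partial>lborel) = (\<integral>\<^sup>+y. ennreal \<bar>det (J i y)\<bar> * indicator ?S y * g (h i y) \<partial>lborel)"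
    by (rule change_variables[OF i S _ hS g]) auto
  have hm: "h' i \<in> borel_measurable borel"
    unfolding h'_def using h_continuous[OF i] by (intro borel_measurable_continuous_on_if) auto
  have "(\<integral>\<^sup>+y. indicator ?S y * g (h' i y) \<partial>lborel) \<le> (\<integral>\<^sup>+y. ennreal 2 * (ennreal \<bar>det (J i y)\<bar> * indicator ?S y * g (h i y)) \<partial>lborel)"
  proof (rule nn_integral_mono)
    fix y
    show "indicator ?S y * g (h' i y) \<le> ennreal 2 * (ennreal \<bar>det (J i y)\<bar> * indicator ?S y * g (h i y))"
    proof (cases "y \<in> ?S")
      case True
      then have y: "y \<in> cball z (4 * s)" by auto
      have "1 \<le> ennreal 2 * ennreal \<bar>det (J i y)\<bar>"
        using det_bounds(1)[OF i y] by (subst ennreal_mult[symmetric]) (auto simp: ennreal_1[symmetric] simp del: ennreal_1 intro!: ennreal_leI)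
      then have "1 * g (h i y) \<le> (ennreal 2 * ennreal \<bar>det (J i y)\<bar>) * g (h i y)" by (rule mult_right_mono) simp
      then show ?thesis using True y by (simp add: h'_def mult.assoc)
    qed simp
  qed
  also have "\<dots> = ennreal 2 * (\<integral>\<^sup>+y. ennreal \<bar>det (J i y)\<bar> * indicator ?S y * g (h i y) \<partial>lborel)"
  proof (rule nn_integral_cmult)
    have "continuous_on ?S (\<lambda>x. ennreal \<bar>det (J i x)\<bar>)"
      by (intro continuous_on_ennreal continuous_intros continuous_on_subset[OF det_continuous[OF i] S])
    then have "(\<lambda>x. if x \<in> ?S then ennreal \<bar>det (J i x)\<bar> else 0) \<in> borel_measurable borel"
      by (intro borel_measurable_continuous_on_if) auto
    moreover have "(\<lambda>y. g (h' i y)) \<in> borel_measurable borel" using hm g by (rule measurable_compose)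
    ultimately have "(\<lambda>y. (if y \<in> ?S then ennreal \<bar>det (J i y)\<bar> else 0) * g (h' i y)) \<in> borel_measurable borel" by measurable
    moreover have "(\<lambda>y. (if y \<in> ?S then ennreal \<bar>det (J i y)\<bar> else 0) * g (h' i y)) = (\<lambda>y. ennreal \<bar>det (J i y)\<bar> * indicator ?S y * g (h i y))"
      by (auto simp: h'_def fun_eq_iff)
    ultimately show "(\<lambda>y. ennreal \<bar>det (J i y)\<bar> * indicator ?S y * g (h i y)) \<in> borel_measurable lborel" by simp
  qed
  also have "\<dots> \<le> ennreal 2 * (\<integral>\<^sup>+x. g x \<partial>lborel)"
    unfolding eq[symmetric] by (intro mult_left_mono nn_integral_mono) (auto split: split_indicator)
  finally show ?thesis .
qed

lemma smoothing: "smoothing_ifs z s \<alpha> (91/100) (100 / s * (8 * s) powr (1 - \<alpha>) + 4 * C) 2 centers h' w \<xi>"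
proof
  show "0 \<le> 100 / s * (8 * s) powr (1 - \<alpha>) + 4 * C" using s C by simp
  show "h' i \<in> borel_measurable borel" if "i \<in> centers" for i
    unfolding h'_def using h_continuous[OF that] by (intro borel_measurable_continuous_on_if) auto
  show "dist (h' i y) (h' i y') \<le> 91/100 * dist y y'" if "i \<in> centers" "y \<in> ball z (4 * s)" "y' \<in> ball z (4 * s)" for i y y'
    using contraction[OF that(1), of y y'] that(2,3) by (simp add: h'_def)
  show "0 \<le> w i y" if "i \<in> centers" for i y using \<xi>_bounds[OF that] by (simp add: w_def)
  show "w i y = 0" if "y \<notin> cball z s" for i y using that by (simp add: w_def)
qed (fact s \<alpha> finite_centers | rule w_holder \<xi>_borel \<xi>_bounds sum_\<xi> transport pull | simp)+

theorem full_ball: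
  assumes B: "B \<in> sets borel"
    and inv: "\<And>i y. i \<in> centers \<Longrightarrow> y \<in> cball z s \<Longrightarrow> h i y \<in> B \<longleftrightarrow> y \<in> B"
    and pos: "emeasure lborel (B \<inter> ball z s) > 0"
  shows "\<exists>x\<in>cball z s. \<exists>r>0. emeasure lborel (ball x r - B) = 0"
proof -
  have "h' i y \<in> B \<longleftrightarrow> y \<in> B" if "i \<in> centers" "y \<in> cball z s" for i y
    using inv[OF that] that(2) s by (simp add: h'_def)
  then show ?thesis by (rule smoothing_ifs.full_ball[OF smoothing B _ pos])
qed

end

section \<open>Maps with locally Hoelder derivative\<close>

text \<open>The derivative exists and satisfies a Hoelder condition near \<open>x\<close>. A condition at each point is easier to
  compose and to glue than a condition on compact sets, which it implies by
  \<open>local_holder_imp_holder_on_compact\<close>.\<close>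
definition C1a_at :: "real \<Rightarrow> 'b::euclidean_space set \<Rightarrow> ('b \<Rightarrow> 'c::euclidean_space) \<Rightarrow> 'b \<Rightarrow> bool" where
  "C1a_at \<alpha> S f x \<longleftrightarrow> (\<exists>e>0. \<exists>f' C. ball x e \<subseteq> S \<and>
     (\<forall>y\<in>ball x e. (f has_derivative f' y) (at y)) \<and>
     (\<forall>y\<in>ball x e. \<forall>z\<in>ball x e. \<forall>v. norm (f' y v - f' z v) \<le> C * dist y z powr \<alpha> * norm v))"

definition C1a_on :: "real \<Rightarrow> 'b::euclidean_space set \<Rightarrow> ('b \<Rightarrow> 'c::euclidean_space) \<Rightarrow> bool" where
  "C1a_on \<alpha> S f \<longleftrightarrow> (\<forall>x\<in>S. C1a_at \<alpha> S f x)"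

lemma C1a_atI:
  assumes "e > 0" "ball x e \<subseteq> S" "\<And>y. y \<in> ball x e \<Longrightarrow> (f has_derivative f' y) (at y)"
    and "\<And>y z v. y \<in> ball x e \<Longrightarrow> z \<in> ball x e \<Longrightarrow> norm (f' y v - f' z v) \<le> C * dist y z powr \<alpha> * norm v"
  shows "C1a_at \<alpha> S f x"
  unfolding C1a_at_def
  by (rule exI[of _ e], rule conjI[OF assms(1)], rule exI[of _ f'], rule exI[of _ C],
      intro conjI ballI allI assms)

lemma C1a_onE:
  assumes "C1a_on \<alpha> S f" "x \<in> S"
  obtains e f' C where "e > 0" "ball x e \<subseteq> S" "\<forall>y\<in>ball x e. (f has_derivative f' y) (at y)"
    "\<forall>y\<in>ball x e. \<forall>z\<in>ball x e. \<forall>v. norm (f' y v - f' z v) \<le> C * dist y z powr \<alpha> * norm v"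
proof -
  from assms have "C1a_at \<alpha> S f x" unfolding C1a_on_def by (rule bspec)
  then show thesis unfolding C1a_at_def by (elim exE conjE) (rule that)
qed

text \<open>This is how coordinate representations are treated: near each point they agree with a composition of
  simpler maps.\<close>
lemma C1a_on_local:
  assumes "\<And>x. x \<in> S \<Longrightarrow> \<exists>V g. open V \<and> x \<in> V \<and> V \<subseteq> S \<and> C1a_on \<alpha> V g \<and> (\<forall>y\<in>V. f y = g y)"
  shows "C1a_on \<alpha> S f"
  unfolding C1a_on_def
proof
  fix x assume "x \<in> S"
  then obtain V g where V: "open V" "x \<in> V" "V \<subseteq> S" "C1a_on \<alpha> V g" "\<forall>y\<in>V. f y = g y"
    using assms by blast
  obtain e g' C where e: "e > 0" "ball x e \<subseteq> V" "\<forall>y\<in>ball x e. (g has_derivative g' y) (at y)"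
    "\<forall>y\<in>ball x e. \<forall>z\<in>ball x e. \<forall>v. norm (g' y v - g' z v) \<le> C * dist y z powr \<alpha> * norm v"
    by (rule C1a_onE[OF V(4,2)])
  have "(f has_derivative g' y) (at y)" if "y \<in> ball x e" for y
    by (rule has_derivative_transform_within_open[of g _ _ UNIV "ball x e"]) (use e V that in auto)
  then show "C1a_at \<alpha> S f x"
    using e V by (intro C1a_atI[of e x S f g' C]) auto
qed

lemma C1a_on_cong:
  assumes g: "C1a_on \<alpha> S g" and S: "open S" and fg: "\<And>y. y \<in> S \<Longrightarrow> f y = g y"
  shows "C1a_on \<alpha> S f"
proof (rule C1a_on_local)
  fix x assume x: "x \<in> S"
  have "\<forall>y\<in>S. f y = g y" using fg by (rule ballI)
  with g S x have "open S \<and> x \<in> S \<and> S \<subseteq> S \<and> C1a_on \<alpha> S g \<and> (\<forall>y\<in>S. f y = g y)"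
    by (intro conjI subset_refl)
  then show "\<exists>V g. open V \<and> x \<in> V \<and> V \<subseteq> S \<and> C1a_on \<alpha> V g \<and> (\<forall>y\<in>V. f y = g y)"
    by (intro exI)
qed

lemma C1a_on_subset:
  assumes "C1a_on \<alpha> S f" "open T" "T \<subseteq> S" shows "C1a_on \<alpha> T f"
  unfolding C1a_on_def
proof
  fix x assume x: "x \<in> T"
  obtain d where d: "d > 0" "ball x d \<subseteq> T" using assms x by (auto simp: open_contains_ball)
  obtain e f' C where "e > 0" "ball x e \<subseteq> S" "\<forall>y\<in>ball x e. (f has_derivative f' y) (at y)"
    "\<forall>y\<in>ball x e. \<forall>z\<in>ball x e. \<forall>v. norm (f' y v - f' z v) \<le> C * dist y z powr \<alpha> * norm v"
    by (rule C1a_onE[OF assms(1)]) (use assms(3) x in auto)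
  then show "C1a_at \<alpha> T f x"
    using d by (intro C1a_atI[of "min d e" x T f f' C]) auto
qed

text \<open>On a smaller ball one constant bounds the map and its derivative, as well as both moduli of
  continuity. The radius \<open>1/2\<close> makes distances at most \<open>1\<close>, hence bounded by their \<open>\<alpha>\<close>-th powers.\<close>
lemma C1a_on_boundsE:
  assumes f: "C1a_on \<alpha> S f" and x: "x \<in> S" and \<alpha>: "\<alpha> > 0"
  obtains e f' C where "0 < e" "e \<le> 1/2" "C \<ge> 0" "ball x e \<subseteq> S"
    "\<And>y. y \<in> ball x e \<Longrightarrow> (f has_derivative f' y) (at y)"
    "\<And>y z v. y \<in> ball x e \<Longrightarrow> z \<in> ball x e \<Longrightarrow> norm (f' y v - f' z v) \<le> C * dist y z powr \<alpha> * norm v"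
    "\<And>y v. y \<in> ball x e \<Longrightarrow> norm (f' y v) \<le> C * norm v"
    "\<And>y z. y \<in> ball x e \<Longrightarrow> z \<in> ball x e \<Longrightarrow> norm (f y - f z) \<le> C * dist y z"
    "\<And>y. y \<in> ball x e \<Longrightarrow> norm (f y) \<le> C"
proof -
  obtain e0 f' C0 where e0: "e0 > 0" "ball x e0 \<subseteq> S"
    and d': "\<forall>y\<in>ball x e0. (f has_derivative f' y) (at y)"
    and h': "\<forall>y\<in>ball x e0. \<forall>z\<in>ball x e0. \<forall>v. norm (f' y v - f' z v) \<le> C0 * dist y z powr \<alpha> * norm v"
    by (rule C1a_onE[OF f x])
  have d: "\<And>y. y \<in> ball x e0 \<Longrightarrow> (f has_derivative f' y) (at y)" using d' by blast
  have h: "\<And>y z v. y \<in> ball x e0 \<Longrightarrow> z \<in> ball x e0 \<Longrightarrow> norm (f' y v - f' z v) \<le> C0 * dist y z powr \<alpha> * norm v"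
    using h' by blast
  define e where "e = min e0 (1/2)"
  have e: "e > 0" "e \<le> 1/2" "ball x e \<subseteq> ball x e0" using e0 unfolding e_def by auto
  define L where "L = \<bar>C0\<bar> + onorm (f' x)"
  define C where "C = L + norm (f x)"
  have bl: "bounded_linear (f' x)" using d[of x] e0 by (auto intro: has_derivative_bounded_linear)
  have L: "L \<ge> 0" "C0 \<le> L" "L \<le> C" "C \<ge> 0" using onorm_pos_le[OF bl] unfolding L_def C_def by auto
  have b: "norm (f' y v) \<le> L * norm v" if y: "y \<in> ball x e" for y v
  proof -
    have "norm (f' y v) \<le> norm (f' y v - f' x v) + norm (f' x v)" by norm
    also have "norm (f' y v - f' x v) \<le> C0 * dist y x powr \<alpha> * norm v"
      using h[of y x v] y e e0 by auto
    also have "\<dots> \<le> \<bar>C0\<bar> * 1 * norm v"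
    proof (intro mult_right_mono mult_mono)
      show "dist y x powr \<alpha> \<le> 1" using y e \<alpha> powr_mono2[of \<alpha> "dist y x" 1] by (auto simp: dist_commute)
    qed auto
    also have "norm (f' x v) \<le> onorm (f' x) * norm v" by (rule onorm[OF bl])
    finally show ?thesis by (simp add: L_def algebra_simps)
  qed
  have lip: "norm (f y - f z) \<le> L * dist y z" if "y \<in> ball x e" "z \<in> ball x e" for y z
    unfolding dist_norm
  proof (rule differentiable_bound[OF convex_ball])
    show "(f has_derivative f' u) (at u within ball x e)" if "u \<in> ball x e" for u
      by (rule has_derivative_at_withinI[OF d]) (use that e in auto)
    show "onorm (f' u) \<le> L" if "u \<in> ball x e" for u using b[OF that] L by (intro onorm_le) auto
  qed (use that in auto)
  show thesis
  proof (rule that[of e C f'])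
    show "norm (f' y v - f' z v) \<le> C * dist y z powr \<alpha> * norm v" if "y \<in> ball x e" "z \<in> ball x e" for y z v
    proof -
      have "norm (f' y v - f' z v) \<le> C0 * dist y z powr \<alpha> * norm v" using h that e by blast
      also have "\<dots> \<le> C * dist y z powr \<alpha> * norm v" using L by (intro mult_right_mono) auto
      finally show ?thesis .
    qed
    show "norm (f' y v) \<le> C * norm v" if "y \<in> ball x e" for y v
      using b[OF that, of v] L by (meson mult_right_mono norm_ge_zero order_trans)
    show "norm (f y - f z) \<le> C * dist y z" if "y \<in> ball x e" "z \<in> ball x e" for y z
      using lip[OF that] L by (meson mult_right_mono zero_le_dist order_trans)
    show "norm (f y) \<le> C" if "y \<in> ball x e" for y
    proof -
      have "norm (f y) \<le> norm (f y - f x) + norm (f x)" by norm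
      also have "norm (f y - f x) \<le> L * dist y x" using that e by (intro lip) auto
      also have "\<dots> \<le> L * 1" using that e L by (intro mult_left_mono) (auto simp: dist_commute)
      finally show ?thesis by (simp add: C_def)
    qed
  qed (use e e0 d L in auto)
qed

lemma dist_le_powr: "0 < \<alpha> \<Longrightarrow> \<alpha> \<le> 1 \<Longrightarrow> dist y z \<le> 1 \<Longrightarrow> dist y z \<le> dist y z powr \<alpha>"
  using powr_mono'[of \<alpha> 1 "dist y z"] by (cases "y = z") auto

lemma half_ball_dist: "e \<le> 1/2 \<Longrightarrow> y \<in> ball x e \<Longrightarrow> z \<in> ball x e \<Longrightarrow> dist y z \<le> (1::real)"
  using dist_triangle[of y z x] by (auto simp: dist_commute)

lemma C1a_on_compose:
  fixes f :: "'b::euclidean_space \<Rightarrow> 'c::euclidean_space" and g :: "'c \<Rightarrow> 'd::euclidean_space"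
  assumes f: "C1a_on \<alpha> S f" and g: "C1a_on \<alpha> T g" and im: "f ` S \<subseteq> T" and \<alpha>: "\<alpha> > 0"
  shows "C1a_on \<alpha> S (\<lambda>x. g (f x))"
  unfolding C1a_on_def
proof
  fix x assume x: "x \<in> S"
  obtain e f' C where f1: "0 < e" "e \<le> 1/2" "C \<ge> 0" "ball x e \<subseteq> S"
    "\<And>y. y \<in> ball x e \<Longrightarrow> (f has_derivative f' y) (at y)"
    "\<And>y z v. y \<in> ball x e \<Longrightarrow> z \<in> ball x e \<Longrightarrow> norm (f' y v - f' z v) \<le> C * dist y z powr \<alpha> * norm v"
    "\<And>y v. y \<in> ball x e \<Longrightarrow> norm (f' y v) \<le> C * norm v"
    "\<And>y z. y \<in> ball x e \<Longrightarrow> z \<in> ball x e \<Longrightarrow> norm (f y - f z) \<le> C * dist y z"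
    by (rule C1a_on_boundsE[OF f x \<alpha>]) (rule that)
  have fx: "f x \<in> T" using x im by blast
  obtain d g' D where g1: "0 < d" "d \<le> 1/2" "D \<ge> 0" "ball (f x) d \<subseteq> T"
    "\<And>y. y \<in> ball (f x) d \<Longrightarrow> (g has_derivative g' y) (at y)"
    "\<And>y z v. y \<in> ball (f x) d \<Longrightarrow> z \<in> ball (f x) d \<Longrightarrow> norm (g' y v - g' z v) \<le> D * dist y z powr \<alpha> * norm v"
    "\<And>y v. y \<in> ball (f x) d \<Longrightarrow> norm (g' y v) \<le> D * norm v"
    by (rule C1a_on_boundsE[OF g fx \<alpha>]) (rule that)
  define r where "r = min e (d / (C + 1))"
  have r: "r > 0" "r \<le> e" unfolding r_def using f1 g1 by auto
  have im': "f y \<in> ball (f x) d" if y: "y \<in> ball x r" for y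
  proof -
    have "norm (f x - f y) \<le> C * dist x y" using y r f1 by (intro f1) auto
    also have "\<dots> \<le> C * (d / (C+1))" using y f1 unfolding r_def by (intro mult_left_mono) auto
    also have "\<dots> < d" using f1 g1 by (simp add: field_simps)
    finally show ?thesis by (simp add: dist_norm)
  qed
  show "C1a_at \<alpha> S (\<lambda>x. g (f x)) x"
  proof (rule C1a_atI)
    show "r > 0" by fact
    show "ball x r \<subseteq> S" using f1 r by auto
    fix y assume y: "y \<in> ball x r"
    show "((\<lambda>x. g (f x)) has_derivative (\<lambda>v. g' (f y) (f' y v))) (at y)"
      by (rule has_derivative_compose[OF f1(5) g1(5)[OF im'[OF y]]]) (use y r in auto)
    fix z and v :: 'b assume z: "z \<in> ball x r"
    have yz: "y \<in> ball x e" "z \<in> ball x e" using y z r by auto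
    have lin: "linear (g' (f y))" using g1(5)[OF im'[OF y]] has_derivative_linear by blast
    have "g' (f y) (f' y v) - g' (f z) (f' z v)
        = g' (f y) (f' y v - f' z v) + (g' (f y) (f' z v) - g' (f z) (f' z v))"
      by (simp add: linear_diff[OF lin])
    also have "norm \<dots> \<le> norm (g' (f y) (f' y v - f' z v)) + norm (g' (f y) (f' z v) - g' (f z) (f' z v))"
      by (rule norm_triangle_ineq)
    also have "\<dots> \<le> D * norm (f' y v - f' z v) + D * dist (f y) (f z) powr \<alpha> * norm (f' z v)"
      by (intro add_mono g1 im' y z)
    also have "\<dots> \<le> D * (C * dist y z powr \<alpha> * norm v) + D * (C * dist y z) powr \<alpha> * (C * norm v)"
      using f1 yz g1(3) \<alpha> by (intro add_mono mult_mono powr_mono2 mult_left_mono) (auto simp: dist_norm)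
    also have "(C * dist y z) powr \<alpha> = C powr \<alpha> * dist y z powr \<alpha>" using f1 by (simp add: powr_mult)
    also have "D * (C * dist y z powr \<alpha> * norm v) + D * (C powr \<alpha> * dist y z powr \<alpha>) * (C * norm v)
        = (D * C + D * C powr \<alpha> * C) * dist y z powr \<alpha> * norm v" by (simp add: algebra_simps)
    finally show "norm (g' (f y) (f' y v) - g' (f z) (f' z v)) \<le> (D * C + D * C powr \<alpha> * C) * dist y z powr \<alpha> * norm v" .
  qed
qed

lemma C1a_on_bilinear:
  fixes f :: "'b::euclidean_space \<Rightarrow> 'c::euclidean_space" and g :: "'b \<Rightarrow> 'd::euclidean_space"
    and mul :: "'c \<Rightarrow> 'd \<Rightarrow> 'e::euclidean_space"
  assumes f: "C1a_on \<alpha> S f" and g: "C1a_on \<alpha> S g" and "bounded_bilinear mul" and \<alpha>: "0 < \<alpha>" "\<alpha> \<le> 1"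
  shows "C1a_on \<alpha> S (\<lambda>x. mul (f x) (g x))"
  unfolding C1a_on_def
proof
  fix x assume x: "x \<in> S"
  interpret bounded_bilinear "mul" by fact
  obtain P where P: "P > 0" "\<And>a b. norm (mul a b) \<le> norm a * norm b * P" using pos_bounded by blast
  obtain e f' C where f1: "0 < e" "e \<le> 1/2" "C \<ge> 0" "ball x e \<subseteq> S"
    "\<And>y. y \<in> ball x e \<Longrightarrow> (f has_derivative f' y) (at y)"
    "\<And>y z v. y \<in> ball x e \<Longrightarrow> z \<in> ball x e \<Longrightarrow> norm (f' y v - f' z v) \<le> C * dist y z powr \<alpha> * norm v"
    "\<And>y v. y \<in> ball x e \<Longrightarrow> norm (f' y v) \<le> C * norm v"
    "\<And>y z. y \<in> ball x e \<Longrightarrow> z \<in> ball x e \<Longrightarrow> norm (f y - f z) \<le> C * dist y z"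
    "\<And>y. y \<in> ball x e \<Longrightarrow> norm (f y) \<le> C"
    by (rule C1a_on_boundsE[OF f x \<alpha>(1)]) (rule that)
  obtain d g' D where g1: "0 < d" "d \<le> 1/2" "D \<ge> 0" "ball x d \<subseteq> S"
    "\<And>y. y \<in> ball x d \<Longrightarrow> (g has_derivative g' y) (at y)"
    "\<And>y z v. y \<in> ball x d \<Longrightarrow> z \<in> ball x d \<Longrightarrow> norm (g' y v - g' z v) \<le> D * dist y z powr \<alpha> * norm v"
    "\<And>y v. y \<in> ball x d \<Longrightarrow> norm (g' y v) \<le> D * norm v"
    "\<And>y z. y \<in> ball x d \<Longrightarrow> z \<in> ball x d \<Longrightarrow> norm (g y - g z) \<le> D * dist y z"
    "\<And>y. y \<in> ball x d \<Longrightarrow> norm (g y) \<le> D"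
    by (rule C1a_on_boundsE[OF g x \<alpha>(1)]) (rule that)
  define r where "r = min e d"
  have r: "r > 0" "ball x r \<subseteq> ball x e" "ball x r \<subseteq> ball x d" "r \<le> 1/2" unfolding r_def using f1 g1 by auto
  show "C1a_at \<alpha> S (\<lambda>x. mul (f x) (g x)) x"
  proof (rule C1a_atI)
    show "r > 0" by fact
    show "ball x r \<subseteq> S" using f1 r by auto
    fix y assume y: "y \<in> ball x r"
    show "((\<lambda>x. mul (f x) (g x)) has_derivative (\<lambda>v. mul (f y) (g' y v) + mul (f' y v) (g y))) (at y)"
      by (rule FDERIV[OF f1(5) g1(5)]) (use y r in auto)
    fix z and v :: 'b assume z: "z \<in> ball x r"
    let ?p = "dist y z powr \<alpha>" and ?n = "norm v"
    have dp: "dist y z \<le> ?p" using y z r by (intro dist_le_powr \<alpha> half_ball_dist[of r])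
    have ye: "y \<in> ball x e" "z \<in> ball x e" "y \<in> ball x d" "z \<in> ball x d" using y z r by auto
    have fl: "norm (f y - f z) \<le> C * ?p"
      using f1(8)[OF ye(1,2)] dp f1(3) by (meson mult_left_mono order_trans)
    have gl: "norm (g y - g z) \<le> D * ?p"
      using g1(8)[OF ye(3,4)] dp g1(3) by (meson mult_left_mono order_trans)
    have "mul (f y) (g' y v) + mul (f' y v) (g y) - (mul (f z) (g' z v) + mul (f' z v) (g z))
      = mul (f y) (g' y v - g' z v) + mul (f y - f z) (g' z v) + (mul (f' y v - f' z v) (g y) + mul (f' z v) (g y - g z))"
      by (simp add: diff_left diff_right)
    also have "norm \<dots> \<le> norm (f y) * norm (g' y v - g' z v) * P + norm (f y - f z) * norm (g' z v) * P
        + (norm (f' y v - f' z v) * norm (g y) * P + norm (f' z v) * norm (g y - g z) * P)"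
      by (intro norm_triangle_le add_mono P)
    also have "\<dots> \<le> C * (D * ?p * ?n) * P + (C * ?p) * (D * ?n) * P + ((C * ?p * ?n) * D * P + (C * ?n) * (D * ?p) * P)"
      using ye fl gl P(1) f1(3) g1(3)
      by (intro add_mono mult_right_mono mult_mono f1(6,7,9) g1(6,7,9)) auto
    also have "\<dots> = (4 * C * D * P) * ?p * ?n" by (simp add: algebra_simps)
    finally show "norm (mul (f y) (g' y v) + mul (f' y v) (g y) - (mul (f z) (g' z v) + mul (f' z v) (g z)))
      \<le> (4 * C * D * P) * ?p * ?n" .
  qed
qed

lemma C1a_on_bounded_linear: 
  assumes "bounded_linear f" "open S" shows "C1a_on \<alpha> S f"
  unfolding C1a_on_def
proof
  fix x assume "x \<in> S"
  then obtain e where "e > 0" "ball x e \<subseteq> S" using assms by (auto simp: open_contains_ball)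
  then show "C1a_at \<alpha> S f x"
    using bounded_linear_imp_has_derivative[OF assms(1)]
    by (intro C1a_atI[of e x S f "\<lambda>_. f" 0]) auto
qed

lemma C1a_on_const: 
  assumes "open S" shows "C1a_on \<alpha> S (\<lambda>_. c)"
  unfolding C1a_on_def
proof
  fix x assume "x \<in> S"
  then obtain e where "e > 0" "ball x e \<subseteq> S" using assms by (auto simp: open_contains_ball)
  then show "C1a_at \<alpha> S (\<lambda>_. c) x"
    by (intro C1a_atI[of e x S _ "\<lambda>_ _. 0" 0]) auto
qed

lemma C1a_on_add:
  fixes f g :: "'b::euclidean_space \<Rightarrow> 'c::euclidean_space"
  assumes f: "C1a_on \<alpha> S f" and g: "C1a_on \<alpha> S g"
  shows "C1a_on \<alpha> S (\<lambda>x. f x + g x)"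
  unfolding C1a_on_def
proof
  fix x assume x: "x \<in> S"
  obtain e f' C where f1: "0 < e" "ball x e \<subseteq> S"
    "\<forall>y\<in>ball x e. (f has_derivative f' y) (at y)"
    "\<forall>y\<in>ball x e. \<forall>z\<in>ball x e. \<forall>v. norm (f' y v - f' z v) \<le> C * dist y z powr \<alpha> * norm v"
    by (rule C1a_onE[OF f x])
  obtain d g' D where g1: "0 < d" "ball x d \<subseteq> S"
    "\<forall>y\<in>ball x d. (g has_derivative g' y) (at y)"
    "\<forall>y\<in>ball x d. \<forall>z\<in>ball x d. \<forall>v. norm (g' y v - g' z v) \<le> D * dist y z powr \<alpha> * norm v"
    by (rule C1a_onE[OF g x])
  have "norm (f' y v + g' y v - (f' z v + g' z v)) \<le> (C + D) * dist y z powr \<alpha> * norm v"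
    if "y \<in> ball x (min e d)" "z \<in> ball x (min e d)" for y z and v :: 'b
  proof -
    have "norm (f' y v + g' y v - (f' z v + g' z v)) \<le> norm (f' y v - f' z v) + norm (g' y v - g' z v)" by norm
    also have "\<dots> \<le> C * dist y z powr \<alpha> * norm v + D * dist y z powr \<alpha> * norm v"
      using that f1 g1 by (intro add_mono) auto
    finally show ?thesis by (simp add: algebra_simps)
  qed
  then show "C1a_at \<alpha> S (\<lambda>x. f x + g x) x"
    using f1 g1 by (intro C1a_atI[of "min e d" x S _ "\<lambda>y v. f' y v + g' y v" "C + D"]) (auto intro!: has_derivative_add)
qed

lemma norm_linear_le_Basis:
  fixes F :: "'b::euclidean_space \<Rightarrow> 'c::real_normed_vector" and M :: real
  assumes F: "linear F" and M: "\<And>b. b \<in> Basis \<Longrightarrow> norm (F b) \<le> M"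
  shows "norm (F v) \<le> DIM('b) * M * norm v"
proof -
  have "F v = F (\<Sum>b\<in>Basis. (v \<bullet> b) *\<^sub>R b)" by (simp add: euclidean_representation)
  also have "\<dots> = (\<Sum>b\<in>Basis. (v \<bullet> b) *\<^sub>R F b)"
    by (simp add: linear_sum[OF F] linear_cmul[OF F])
  also have "norm \<dots> \<le> (\<Sum>b\<in>(Basis::'b set). norm v * M)"
  proof (rule order_trans[OF norm_sum sum_mono])
    fix b :: 'b assume b: "b \<in> Basis"
    then show "norm ((v \<bullet> b) *\<^sub>R F b) \<le> norm v * M"
      using M[OF b] Basis_le_norm[OF b, of v] by (auto intro!: mult_mono)
  qed
  finally show ?thesis by (simp add: algebra_simps)
qed

lemma Ck_on_2_imp_C1a_on:
  fixes f :: "'b::euclidean_space \<Rightarrow> 'c::euclidean_space"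
  assumes f: "Ck_on 2 S f" and S: "open S" and \<alpha>: "0 < \<alpha>" "\<alpha> \<le> 1"
  shows "C1a_on \<alpha> S f"
  unfolding C1a_on_def
proof
  fix x assume x: "x \<in> S"
  define D where "D = (\<lambda>v y. frechet_derivative f (at y) v)"
  define D2 where "D2 = (\<lambda>v w y. frechet_derivative (D v) (at y) w)"
  have d: "(f has_derivative (\<lambda>v. D v y)) (at y)" if "y \<in> S" for y
    using f that unfolding D_def by (auto simp: numeral_2_eq_2 frechet_derivative_works[symmetric])
  have d2: "(D v has_derivative (\<lambda>w. D2 v w y)) (at y)" if "y \<in> S" for y v
    using f that unfolding D_def D2_def by (auto simp: numeral_2_eq_2 frechet_derivative_works[symmetric])
  have c: "continuous_on S (D2 v w)" for v w
    using f unfolding D_def D2_def by (auto simp: numeral_2_eq_2)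
  obtain e0 where e0: "e0 > 0" "cball x e0 \<subseteq> S" using S x by (auto simp: open_contains_cball)
  define e where "e = min e0 (1/2)"
  have e: "e > 0" "cball x e \<subseteq> S" "e \<le> 1/2" using e0 unfolding e_def by auto
  have "\<exists>M. \<forall>y\<in>cball x e. norm (D2 v w y) \<le> M" for v w
  proof -
    have "bounded (D2 v w ` cball x e)"
      using e by (intro compact_imp_bounded compact_continuous_image continuous_on_subset[OF c]) auto
    then show ?thesis by (auto simp: bounded_iff)
  qed
  then obtain M where M: "\<And>v w y. y \<in> cball x e \<Longrightarrow> norm (D2 v w y) \<le> M v w" by metis
  define M0 where "M0 = (\<Sum>v\<in>Basis. \<Sum>w\<in>Basis. \<bar>M v w\<bar>)"
  have M0: "norm (D2 v w y) \<le> M0" if "v \<in> Basis" "w \<in> Basis" "y \<in> cball x e" for v w y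
  proof -
    have "norm (D2 v w y) \<le> \<bar>M v w\<bar>" using M[OF that(3), of v w] by linarith
    also have "\<dots> \<le> (\<Sum>w\<in>Basis. \<bar>M v w\<bar>)" using that by (intro member_le_sum) auto
    also have "\<dots> \<le> M0" unfolding M0_def using that by (intro member_le_sum[of v Basis "\<lambda>v. \<Sum>w\<in>Basis. \<bar>M v w\<bar>"]) (auto intro: sum_nonneg)
    finally show ?thesis .
  qed
  have M0p: "M0 \<ge> 0" unfolding M0_def by (intro sum_nonneg) auto
  let ?d = "real DIM('b)"
  have lip: "norm (D b y - D b z) \<le> ?d * M0 * norm (y - z)" if b: "b \<in> Basis" and yz: "y \<in> ball x e" "z \<in> ball x e" for b y z
  proof (rule differentiable_bound[OF convex_ball])
    fix u assume u: "u \<in> ball x e"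
    then have uS: "u \<in> S" and uc: "u \<in> cball x e" using e by auto
    show "(D b has_derivative (\<lambda>w. D2 b w u)) (at u within ball x e)"
      by (rule has_derivative_at_withinI[OF d2[OF uS]])
    show "onorm (\<lambda>w. D2 b w u) \<le> ?d * M0"
      using norm_linear_le_Basis[OF has_derivative_linear[OF d2[OF uS]] M0[OF b _ uc]] M0p
      by (intro onorm_le) auto
  qed (use yz in auto)
  show "C1a_at \<alpha> S f x"
  proof (rule C1a_atI)
    show "e > 0" by fact
    show "ball x e \<subseteq> S" using e by auto
    fix y assume y: "y \<in> ball x e"
    show "(f has_derivative (\<lambda>v. D v y)) (at y)" by (rule d) (use y e in auto)
    fix z and v :: 'b assume z: "z \<in> ball x e"
    have "y \<in> S" "z \<in> S" using y z e by auto
    then have "linear (\<lambda>v. D v y - D v z)"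
      by (intro linear_compose_sub has_derivative_linear[OF d])
    then have "norm (D v y - D v z) \<le> ?d * (?d * M0 * norm (y - z)) * norm v"
      by (rule norm_linear_le_Basis) (intro lip y z)
    also have "\<dots> \<le> ?d * (?d * M0 * dist y z powr \<alpha>) * norm v"
      using dist_le_powr[OF \<alpha>, of y z] half_ball_dist[OF e(3) y z] M0p
      by (intro mult_right_mono mult_left_mono) (auto simp: dist_norm)
    finally show "norm (D v y - D v z) \<le> (?d * ?d * M0) * dist y z powr \<alpha> * norm v" by (simp add: mult.assoc)
  qed
qed

text \<open>Nearby pairs of points lie in one of finitely many balls. For pairs at distance at least \<open>d\<close> the
  bound \<open>2 B\<close> on the difference is absorbed into the constant \<open>2 B / d\<^sup>\<alpha>\<close>.\<close>
lemma local_holder_imp_holder_on_compact: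
  fixes F :: "'b::metric_space \<Rightarrow> 'c::real_normed_vector"
  assumes K: "compact K" and \<alpha>: "\<alpha> > 0"
    and loc: "\<And>x. x \<in> K \<Longrightarrow> \<exists>e>0. \<exists>C. \<forall>y\<in>ball x e. \<forall>z\<in>ball x e. norm (F y - F z) \<le> C * dist y z powr \<alpha>"
  shows "\<exists>C. \<forall>y\<in>K. \<forall>z\<in>K. norm (F y - F z) \<le> C * dist y z powr \<alpha>"
proof -
  obtain e C where eC: "\<And>x. x \<in> K \<Longrightarrow> e x > (0::real)"
    "\<And>x y z. x \<in> K \<Longrightarrow> y \<in> ball x (e x) \<Longrightarrow> z \<in> ball x (e x) \<Longrightarrow> norm (F y - F z) \<le> C x * dist y z powr \<alpha>"
    using loc by metis
  have "K \<subseteq> (\<Union>x\<in>K. ball x (min (e x / 2) 1))" using eC(1) by force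
  then obtain P where P: "P \<subseteq> K" "finite P" "K \<subseteq> (\<Union>x\<in>P. ball x (min (e x / 2) 1))"
    using compactE_image[OF K, of K "\<lambda>x. ball x (min (e x / 2) 1)"] by auto
  define d where "d = Min (insert 1 ((\<lambda>x. e x / 2) ` P))"
  have d: "d > 0" unfolding d_def using P eC(1) by (auto simp: subset_iff)
  have d2: "d \<le> e x / 2" if "x \<in> P" for x unfolding d_def using P that by (intro Min_le) auto
  define C0 where "C0 = (\<Sum>x\<in>P. \<bar>C x\<bar>)"
  have C0: "C x \<le> C0" if "x \<in> P" for x
    unfolding C0_def using member_le_sum[of x P "\<lambda>x. \<bar>C x\<bar>"] that P by fastforce
  have C0p: "C0 \<ge> 0" unfolding C0_def by (intro sum_nonneg) auto
  define B where "B = (\<Sum>x\<in>P. norm (F x) + C0 * e x powr \<alpha>)"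
  have B: "norm (F y) \<le> B" if y: "y \<in> K" for y
  proof -
    obtain x where x: "x \<in> P" "y \<in> ball x (e x)" using P y eC(1) by force
    have "norm (F y) \<le> norm (F y - F x) + norm (F x)" by norm
    also have "norm (F y - F x) \<le> C x * dist y x powr \<alpha>" using x P eC(1) by (intro eC(2)) auto
    also have "\<dots> \<le> C0 * e x powr \<alpha>"
      using x C0 C0p \<alpha> by (intro mult_mono powr_mono2) (auto simp: dist_commute)
    finally have "norm (F y) \<le> norm (F x) + C0 * e x powr \<alpha>" by simp
    also have "\<dots> \<le> B" unfolding B_def using x P C0p
      by (intro member_le_sum[of x P "\<lambda>x. norm (F x) + C0 * e x powr \<alpha>"]) (auto intro!: add_nonneg_nonneg mult_nonneg_nonneg)
    finally show ?thesis .
  qed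
  have Bp: "B \<ge> 0" unfolding B_def using C0p by (intro sum_nonneg add_nonneg_nonneg mult_nonneg_nonneg) auto
  have "norm (F y - F z) \<le> (C0 + 2 * B / d powr \<alpha>) * dist y z powr \<alpha>" if yz: "y \<in> K" "z \<in> K" for y z
  proof (cases "dist y z < d")
    case True
    obtain x where x: "x \<in> P" "y \<in> ball x (e x / 2)" using P yz by force
    have "z \<in> ball x (e x)" using dist_triangle[of x z y] x d2[of x] True by (auto simp: dist_commute)
    moreover have "y \<in> ball x (e x)" using x eC(1)[of x] P by (auto simp: subset_iff)
    ultimately have "norm (F y - F z) \<le> C x * dist y z powr \<alpha>" using eC(2) x P by blast
    also have "\<dots> \<le> (C0 + 2 * B / d powr \<alpha>) * dist y z powr \<alpha>"
      using C0[OF x(1)] Bp d by (intro mult_right_mono) (auto intro: order_trans)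
    finally show ?thesis .
  next
    case False
    have "norm (F y - F z) \<le> norm (F y) + norm (F z)" by norm
    also have "\<dots> \<le> 2 * B" using B yz by (smt (verit))
    also have "\<dots> = (2 * B / d powr \<alpha>) * d powr \<alpha>" using d by simp
    also have "\<dots> \<le> (C0 + 2 * B / d powr \<alpha>) * dist y z powr \<alpha>"
      using False d \<alpha> Bp C0p by (intro mult_mono powr_mono2) auto
    finally show ?thesis .
  qed
  then show ?thesis by blast
qed

lemma norm_matrix_le:
  fixes F :: "real^'n \<Rightarrow> real^'m" and B :: real
  assumes "\<And>v. norm (F v) \<le> B * norm v"
  shows "norm (matrix F) \<le> CARD('m) * CARD('n) * B"
proof -
  have "norm (matrix F) \<le> (\<Sum>i\<in>UNIV. norm (matrix F $ i))" unfolding norm_vec_def by (rule L2_set_le_sum) auto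
  also have "\<dots> \<le> (\<Sum>i\<in>(UNIV::'m set). \<Sum>j\<in>(UNIV::'n set). B)"
  proof (rule sum_mono)
    fix i :: 'm
    have "norm (matrix F $ i) \<le> (\<Sum>j\<in>UNIV. \<bar>matrix F $ i $ j\<bar>)" by (rule norm_le_l1_cart)
    also have "\<dots> \<le> (\<Sum>j\<in>(UNIV::'n set). B)"
    proof (rule sum_mono)
      fix j :: 'n
      have "\<bar>matrix F $ i $ j\<bar> = \<bar>F (axis j 1) $ i\<bar>" by (simp add: matrix_def)
      also have "\<dots> \<le> norm (F (axis j 1))" by (rule component_le_norm_cart)
      also have "\<dots> \<le> B" using assms[of "axis j 1"] by simp
      finally show "\<bar>matrix F $ i $ j\<bar> \<le> B" .
    qed
    finally show "norm (matrix F $ i) \<le> (\<Sum>j\<in>(UNIV::'n set). B)" .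
  qed
  finally show ?thesis by simp
qed

lemma C1a_on_continuous: 
  assumes "C1a_on \<alpha> S f" shows "continuous_on S f"
proof (rule continuous_at_imp_continuous_on, rule ballI)
  fix x assume "x \<in> S"
  then obtain e f' C where "e > 0" "\<forall>y\<in>ball x e. (f has_derivative f' y) (at y)"
    by (rule C1a_onE[OF assms])
  then show "continuous (at x) f" by (intro has_derivative_continuous[of f "f' x"]) auto
qed

lemma C1a_on_jacobian:
  fixes f :: "real^'n \<Rightarrow> real^'n"
  assumes f: "C1a_on \<alpha> S f" and \<alpha>: "\<alpha> > 0"
  shows "Ck_on 1 S f \<and> (\<forall>K. compact K \<and> K \<subseteq> S \<longrightarrow>
    (\<exists>C. \<forall>x\<in>K. \<forall>y\<in>K. norm (jacobian f (at x) - jacobian f (at y)) \<le> C * dist x y powr \<alpha>))"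
proof
  have loc: "\<exists>e>0. \<exists>C. \<forall>y\<in>ball x e. \<forall>z\<in>ball x e. f differentiable (at y) \<and> (\<forall>v.
      norm (frechet_derivative f (at y) v - frechet_derivative f (at z) v) \<le> C * dist y z powr \<alpha> * norm v)"
    if x: "x \<in> S" for x
  proof -
    obtain e f' C where e: "e > 0" and d: "\<forall>y\<in>ball x e. (f has_derivative f' y) (at y)"
      and h: "\<forall>y\<in>ball x e. \<forall>z\<in>ball x e. \<forall>v. norm (f' y v - f' z v) \<le> C * dist y z powr \<alpha> * norm v"
      by (rule C1a_onE[OF f x])
    have "frechet_derivative f (at y) = f' y" if "y \<in> ball x e" for y
      using d that by (metis frechet_derivative_at)
    then show ?thesis using e d h by (intro exI[of _ e] conjI exI[of _ C]) (auto simp: differentiable_def)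
  qed
  have diff: "f differentiable (at x)" if "x \<in> S" for x
    using loc[OF that] centre_in_ball by blast
  have "continuous_on S (\<lambda>x. frechet_derivative f (at x) v)" for v
  proof (rule continuous_at_imp_continuous_on, rule ballI)
    fix x assume "x \<in> S"
    then obtain e C where e: "e > 0" "\<And>y. y \<in> ball x e \<Longrightarrow>
      norm (frechet_derivative f (at y) v - frechet_derivative f (at x) v) \<le> C * dist y x powr \<alpha> * norm v"
      using loc by (metis centre_in_ball)
    have "((\<lambda>y. frechet_derivative f (at y) v - frechet_derivative f (at x) v) \<longlongrightarrow> 0) (at x)"
    proof (rule Lim_null_comparison)
      show "\<forall>\<^sub>F y in at x. norm (frechet_derivative f (at y) v - frechet_derivative f (at x) v) \<le> C * dist y x powr \<alpha> * norm v"
        using e by (auto simp: eventually_at dist_commute intro!: exI[of _ e])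
      have "((\<lambda>y. C * dist y x powr \<alpha> * norm v) \<longlongrightarrow> C * 0 powr \<alpha> * norm v) (at x)"
        by (rule tendsto_intros)+ (use \<alpha> in \<open>auto intro!: tendsto_eq_intros\<close>)
      then show "((\<lambda>y. C * dist y x powr \<alpha> * norm v) \<longlongrightarrow> 0) (at x)" using \<alpha> by simp
    qed
    then show "isCont (\<lambda>x. frechet_derivative f (at x) v) x"
      by (simp add: isCont_def LIM_zero_iff)
  qed
  then show "Ck_on 1 S f" using diff by simp
  show "\<forall>K. compact K \<and> K \<subseteq> S \<longrightarrow>
    (\<exists>C. \<forall>x\<in>K. \<forall>y\<in>K. norm (jacobian f (at x) - jacobian f (at y)) \<le> C * dist x y powr \<alpha>)"
  proof (intro allI impI local_holder_imp_holder_on_compact \<alpha>)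
    fix K x assume "compact K \<and> K \<subseteq> S" "x \<in> K"
    then have "x \<in> S" by blast
    then obtain e C where e: "e > 0" and h: "\<forall>y\<in>ball x e. \<forall>z\<in>ball x e. f differentiable (at y) \<and> (\<forall>v.
      norm (frechet_derivative f (at y) v - frechet_derivative f (at z) v) \<le> C * dist y z powr \<alpha> * norm v)"
      using loc by blast
    let ?n = "real CARD('n)"
    have "norm (jacobian f (at y) - jacobian f (at z)) \<le> (?n * ?n * C) * dist y z powr \<alpha>"
      if yz: "y \<in> ball x e" "z \<in> ball x e" for y z
    proof -
      have "jacobian f (at y) - jacobian f (at z) = matrix (\<lambda>v. frechet_derivative f (at y) v - frechet_derivative f (at z) v)"
        by (simp add: jacobian_def matrix_def vec_eq_iff)
      also have "norm \<dots> \<le> ?n * ?n * (C * dist y z powr \<alpha>)"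
        using norm_matrix_le[of "\<lambda>v. frechet_derivative f (at y) v - frechet_derivative f (at z) v" "C * dist y z powr \<alpha>"] h yz by simp
      finally show ?thesis by (simp add: mult.assoc)
    qed
    then show "\<exists>e>0. \<exists>C. \<forall>y\<in>ball x e. \<forall>z\<in>ball x e. norm (jacobian f (at y) - jacobian f (at z)) \<le> C * dist y z powr \<alpha>"
      using e by blast
  qed simp
qed

text \<open>The inverse of the derivative satisfies
  \<open>A\<^sup>-\<^sup>1 v - B\<^sup>-\<^sup>1 v = A\<^sup>-\<^sup>1 (B - A) B\<^sup>-\<^sup>1 v\<close>, where both inverses have norm at most \<open>1/m\<close>.\<close>
lemma C1a_on_inverse:
  fixes f g :: "'b::euclidean_space \<Rightarrow> 'b"
  assumes f: "C1a_on \<alpha> UNIV f" and m: "m > 0" "\<And>x y. m * dist x y \<le> dist (f x) (f y)"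
    and m': "\<And>x f' v. (f has_derivative f') (at x) \<Longrightarrow> m * norm v \<le> norm (f' v)"
    and fg: "\<And>x. f (g x) = x" and \<alpha>: "\<alpha> > 0"
  shows "C1a_on \<alpha> UNIV g"
  unfolding C1a_on_def
proof
  fix x :: 'b
  obtain e f' C where f1: "0 < e" "C \<ge> 0"
    "\<And>y. y \<in> ball (g x) e \<Longrightarrow> (f has_derivative f' y) (at y)"
    "\<And>y z v. y \<in> ball (g x) e \<Longrightarrow> z \<in> ball (g x) e \<Longrightarrow> norm (f' y v - f' z v) \<le> C * dist y z powr \<alpha> * norm v"
    by (rule C1a_on_boundsE[OF f UNIV_I \<alpha>, of "g x"]) (rule that)
  have lip: "dist (g y) (g z) \<le> dist y z / m" for y z
    using m(2)[of "g y" "g z"] m(1) by (simp add: fg field_simps)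
  have inb: "g y \<in> ball (g x) e" if "y \<in> ball x (m * e)" for y
  proof -
    have "dist (g x) (g y) \<le> dist x y / m" by (rule lip)
    also have "\<dots> < e" using that m by (simp add: field_simps)
    finally show ?thesis by simp
  qed
  have cg: "continuous (at y) g" for y
    unfolding continuous_at_eps_delta
  proof (intro allI impI)
    fix d :: real assume "d > 0"
    then show "\<exists>da>0. \<forall>x'. dist x' y < da \<longrightarrow> dist (g x') (g y) < d"
      using lip m by (intro exI[of _ "m * d"]) (auto intro: le_less_trans[OF lip] simp: field_simps)
  qed
  define g' where "g' = (\<lambda>y. inv (f' (g y)))"
  have f'g': "f' (g y) (g' y v) = v" and g'f': "g' y (f' (g y) v) = v" and lin: "linear (f' (g y))"
    if "y \<in> ball x (m * e)" for y v
  proof -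
    have d: "(f has_derivative f' (g y)) (at (g y))" using f1(3)[OF inb[OF that]] .
    show lin: "linear (f' (g y))" using d by (rule has_derivative_linear)
    have inj: "inj (f' (g y))"
    proof (rule linear_injective_0[OF lin, THEN iffD2], safe)
      fix v assume "f' (g y) v = 0"
      then show "v = 0" using m'[OF d, of v] m by (simp add: mult_le_0_iff)
    qed
    have surj: "surj (f' (g y))" by (rule linear_inj_imp_surj[OF lin inj])
    show "f' (g y) (g' y v) = v" unfolding g'_def using surj by (rule surj_f_inv_f)
    show "g' y (f' (g y) v) = v" unfolding g'_def using inj by (rule inv_f_f)
  qed
  have nb: "norm (g' y v) \<le> norm v / m" if "y \<in> ball x (m * e)" for y v
    using m'[OF f1(3)[OF inb[OF that]], of "g' y v"] f'g'[OF that, of v] m by (simp add: field_simps)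
  have dg: "(g has_derivative g' y) (at y)" if y: "y \<in> ball x (m * e)" for y
  proof (rule has_derivative_inverse_basic[where f = f and T = UNIV])
    show "(f has_derivative f' (g y)) (at (g y))" using f1(3)[OF inb[OF y]] .
    have "linear (g' y)"
    proof (rule linearI)
      fix u v and r :: real
      have "g' y (f' (g y) (g' y u + g' y v)) = g' y u + g' y v" using g'f'[OF y] .
      then show "g' y (u + v) = g' y u + g' y v" by (simp add: linear_add[OF lin[OF y]] f'g'[OF y])
      have "g' y (f' (g y) (r *\<^sub>R g' y v)) = r *\<^sub>R g' y v" using g'f'[OF y] .
      then show "g' y (r *\<^sub>R v) = r *\<^sub>R g' y v" by (simp add: linear_cmul[OF lin[OF y]] f'g'[OF y])
    qed
    then show "bounded_linear (g' y)" by (simp add: linear_linear) 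
    show "g' y \<circ> f' (g y) = id" using g'f'[OF y] by auto
  qed (use cg fg in auto)
  have hol: "norm (g' y v - g' z v) \<le> (C / m / m / m powr \<alpha>) * dist y z powr \<alpha> * norm v"
    if y: "y \<in> ball x (m * e)" and z: "z \<in> ball x (m * e)" for y z v
  proof -
    have "m * norm (g' y v - g' z v) \<le> norm (f' (g y) (g' y v - g' z v))"
      by (rule m'[OF f1(3)[OF inb[OF y]]])
    also have "f' (g y) (g' y v - g' z v) = f' (g z) (g' z v) - f' (g y) (g' z v)"
      by (simp add: linear_diff[OF lin[OF y]] f'g'[OF y] f'g'[OF z])
    also have "norm \<dots> \<le> C * dist (g z) (g y) powr \<alpha> * norm (g' z v)"
      by (intro f1(4) inb y z)
    also have "\<dots> \<le> C * (dist y z / m) powr \<alpha> * (norm v / m)"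
      using f1(2) lip[of z y] nb[OF z] m \<alpha> by (intro mult_mono powr_mono2) (auto simp: dist_commute)
    also have "(dist y z / m) powr \<alpha> = dist y z powr \<alpha> / m powr \<alpha>" using m by (simp add: powr_divide)
    finally show ?thesis using m by (simp add: field_simps)
  qed
  show "C1a_at \<alpha> UNIV g x"
  proof (rule C1a_atI)
    show "m * e > 0" using m f1 by simp
    fix y assume y: "y \<in> ball x (m * e)"
    show "(g has_derivative g' y) (at y)" by (rule dg[OF y])
    fix z v assume z: "z \<in> ball x (m * e)"
    show "norm (g' y v - g' z v) \<le> (C / m / m / m powr \<alpha>) * dist y z powr \<alpha> * norm v" by (rule hol[OF y z])
  qed simp
qed

section \<open>Compactly supported displacements\<close>

lemma pos_part_square_has_derivative:
  "((\<lambda>t::real. (max 0 t)^2) has_derivative (\<lambda>v. 2 * max 0 t * v)) (at t)"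
proof -
  have "((\<lambda>t::real. (max 0 t)^2) has_real_derivative 2 * max 0 t) (at t)"
  proof (cases "t = 0")
    case True
    have "((\<lambda>h::real. ((max 0 (0 + h))\<^sup>2 - (max 0 0)\<^sup>2) / h) \<longlongrightarrow> 0) (at 0)"
    proof (rule Lim_null_comparison)
      show "\<forall>\<^sub>F h in at 0. norm (((max 0 (0 + h))\<^sup>2 - (max 0 0)\<^sup>2) / h) \<le> \<bar>h::real\<bar>"
        by (intro always_eventually) (auto simp: max_def power2_eq_square)
      show "((\<lambda>h::real. \<bar>h\<bar>) \<longlongrightarrow> 0) (at 0)" by (auto intro!: tendsto_eq_intros)
    qed
    then show ?thesis using True by (simp add: DERIV_def)
  next
    case False
    show ?thesis
    proof (cases "t > 0")
      case True
      show ?thesis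
        by (rule has_field_derivative_transform_within_open[of "\<lambda>t. t^2" _ _ "{0<..}"])
          (use True in \<open>auto intro!: derivative_eq_intros\<close>)
    next
      case F: False
      show ?thesis
        by (rule has_field_derivative_transform_within_open[of "\<lambda>t. 0" _ _ "{..<0}"])
          (use False F in \<open>auto intro!: derivative_eq_intros\<close>)
    qed
  qed
  then show ?thesis by (simp add: has_field_derivative_def)
qed

lemma C1a_on_pos_part_square:
  assumes \<alpha>: "0 < \<alpha>" "\<alpha> \<le> 1" shows "C1a_on \<alpha> UNIV (\<lambda>t::real. (max 0 t)^2)"
  unfolding C1a_on_def
proof
  fix x :: real
  have "norm (2 * max 0 y * v - 2 * max 0 z * v) \<le> 2 * dist y z powr \<alpha> * norm v"
    if "y \<in> ball x (1/2)" "z \<in> ball x (1/2)" for y z v :: real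
  proof -
    have "2 * max 0 y * v - 2 * max 0 z * v = 2 * ((max 0 y - max 0 z) * v)" by (simp add: algebra_simps)
    also have "norm \<dots> = 2 * \<bar>max 0 y - max 0 z\<bar> * norm v" by (simp only: abs_mult real_norm_def abs_numeral mult.assoc)
    also have "\<dots> \<le> 2 * dist y z * norm v" by (intro mult_right_mono mult_left_mono) (auto simp: dist_real_def)
    also have "\<dots> \<le> 2 * dist y z powr \<alpha> * norm v"
      using half_ball_dist[OF order_refl that] by (intro mult_right_mono mult_left_mono dist_le_powr \<alpha>) auto
    finally show ?thesis .
  qed
  then show "C1a_at \<alpha> UNIV (\<lambda>t::real. (max 0 t)^2) x"
    using pos_part_square_has_derivative by (intro C1a_atI[of "1/2" x _ _ "\<lambda>y v. 2 * max 0 y * v" 2]) auto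
qed

text \<open>A cutoff with Lipschitz derivative, which is all that is required for \<open>\<alpha> \<le> 1\<close>. It is supported in the ball of
  radius \<open>100\<close>, and nearly \<open>1\<close> on the ball of radius \<open>4\<close> where the contractions are used.\<close>
definition bump :: "'b::euclidean_space \<Rightarrow> real" where
  "bump x = (max 0 (1 - (x \<bullet> x) / 10000))\<^sup>2"

definition bump' :: "'b::euclidean_space \<Rightarrow> 'b \<Rightarrow> real" where
  "bump' x v = 2 * max 0 (1 - (x \<bullet> x) / 10000) * (- (2 * (x \<bullet> v)) / 10000)"

text \<open>For \<open>m = -1/10\<close> this is nearly the contraction \<open>x \<mapsto> (9/10) x + w\<close> on a small ball; for \<open>m = 0\<close>
  it moves the origin to \<open>w\<close>. It is a diffeomorphism because the displacement is Lipschitz with constant \<open>3/5\<close>.\<close>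
definition kick :: "real \<Rightarrow> 'b \<Rightarrow> 'b::euclidean_space \<Rightarrow> 'b" where
  "kick m w x = x + bump x *\<^sub>R (m *\<^sub>R x + w)"

definition kick' :: "real \<Rightarrow> 'b \<Rightarrow> 'b::euclidean_space \<Rightarrow> 'b \<Rightarrow> 'b" where
  "kick' m w x v = v + (bump x *\<^sub>R (m *\<^sub>R v) + bump' x v *\<^sub>R (m *\<^sub>R x + w))"

lemma bump_has_derivative: "(bump has_derivative bump' x) (at x)"
proof -
  have "((\<lambda>x. 1 - (x \<bullet> x) / 10000) has_derivative (\<lambda>v. - (2 * (x \<bullet> v)) / 10000)) (at x)"
    by (auto intro!: derivative_eq_intros simp: inner_commute)
  from has_derivative_compose[OF this pos_part_square_has_derivative]
  show ?thesis unfolding bump_def bump'_def .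
qed

lemma kick_has_derivative: "(kick m w has_derivative kick' m w x) (at x)"
  unfolding kick_def[abs_def] kick'_def[abs_def]
  by (auto intro!: derivative_eq_intros bump_has_derivative)

lemma C1a_on_kick:
  assumes \<alpha>: "0 < \<alpha>" "\<alpha> \<le> 1" shows "C1a_on \<alpha> UNIV (kick m w)"
proof -
  have id: "C1a_on \<alpha> UNIV (\<lambda>x::'a. x)" by (rule C1a_on_bounded_linear) (auto intro: bounded_linear_ident)
  have "C1a_on \<alpha> UNIV (\<lambda>x::'a. 1 + (- 1 / 10000) *\<^sub>R (x \<bullet> x))"
    by (intro C1a_on_add C1a_on_const open_UNIV C1a_on_compose[OF C1a_on_bilinear[OF id id bounded_bilinear_inner \<alpha>]
        C1a_on_bounded_linear[OF bounded_linear_scaleR_right open_UNIV]] \<alpha>) auto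
  then have "C1a_on \<alpha> UNIV (\<lambda>x::'a. 1 - (x \<bullet> x) / 10000)" by simp
  from C1a_on_compose[OF this C1a_on_pos_part_square[OF \<alpha>] _ \<alpha>(1)]
  have b: "C1a_on \<alpha> UNIV (bump :: 'a \<Rightarrow> real)" unfolding bump_def[abs_def] by simp
  have "C1a_on \<alpha> UNIV (\<lambda>x::'a. m *\<^sub>R x + w)"
    by (intro C1a_on_add C1a_on_const C1a_on_bounded_linear bounded_linear_scaleR_right open_UNIV)
  from C1a_on_add[OF id C1a_on_bilinear[OF b this bounded_bilinear_scaleR \<alpha>]]
  show ?thesis unfolding kick_def[abs_def] .
qed

lemma bump_bounds: "0 \<le> bump x" "bump x \<le> 1"
  unfolding bump_def by (auto intro!: power_le_one)

lemma bump_outside: "norm x \<ge> 100 \<Longrightarrow> bump x = 0" "norm x \<ge> 100 \<Longrightarrow> bump' x v = 0"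
proof -
  assume "norm x \<ge> 100"
  then have "100^2 \<le> (norm x)^2" by (intro power_mono) auto
  then show "bump x = 0" "bump' x v = 0" by (auto simp: bump_def bump'_def power2_norm_eq_inner)
qed

lemma bump'_bound: "\<bar>bump' x v\<bar> \<le> 4 / 10000 * norm x * norm v"
proof -
  have "\<bar>bump' x v\<bar> = 4 / 10000 * (max 0 (1 - (x \<bullet> x) / 10000) * \<bar>x \<bullet> v\<bar>)"
    by (simp add: bump'_def abs_mult)
  also have "\<dots> \<le> 4 / 10000 * (1 * (norm x * norm v))"
    by (intro mult_left_mono mult_mono Cauchy_Schwarz_ineq2) auto
  finally show ?thesis by simp
qed

lemma kick_outside: "norm x \<ge> 100 \<Longrightarrow> kick m w x = x"
  by (simp add: kick_def bump_outside)

lemma kick_0: "kick m w 0 = w"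
  by (simp add: kick_def bump_def)

context
  fixes m :: real and w :: "'b::euclidean_space"
  assumes m: "\<bar>m\<bar> \<le> 1/10" and w: "norm w \<le> 1"
begin

lemma drift_bound: "norm (m *\<^sub>R x + w) \<le> norm x / 10 + 1"
proof -
  have "norm (m *\<^sub>R x + w) \<le> \<bar>m\<bar> * norm x + norm w" by (metis norm_scaleR norm_triangle_ineq)
  also have "\<dots> \<le> 1/10 * norm x + 1" using m w by (intro add_mono mult_right_mono) auto
  finally show ?thesis by simp
qed

text \<open>Inside the ball of radius \<open>100\<close> the gradient of the cutoff is at most \<open>4/100\<close> and \<open>m x + w\<close> is at most
  \<open>11\<close>. Together with \<open>|m| \<le> 1/10\<close> this gives \<open>54/100\<close>.\<close>
lemma kick'_near_id: "norm (kick' m w x v - v) \<le> 3/5 * norm v"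
proof (cases "norm x \<ge> 100")
  case True then show ?thesis by (simp add: kick'_def bump_outside)
next
  case False
  have "norm (kick' m w x v - v) \<le> norm (bump x *\<^sub>R (m *\<^sub>R v)) + norm (bump' x v *\<^sub>R (m *\<^sub>R x + w))"
    unfolding kick'_def add_diff_cancel_left' by (rule norm_triangle_ineq)
  also have "\<dots> = bump x * (\<bar>m\<bar> * norm v) + \<bar>bump' x v\<bar> * norm (m *\<^sub>R x + w)" using bump_bounds[of x] by (simp add: abs_mult)
  also have "\<dots> \<le> 1 * (1/10 * norm v) + (4 / 10000 * 100 * norm v) * (100 / 10 + 1)"
  proof (intro add_mono mult_mono)
    show "\<bar>bump' x v\<bar> \<le> 4 / 10000 * 100 * norm v"
      by (rule order_trans[OF bump'_bound]) (use False in \<open>intro mult_right_mono mult_left_mono, auto\<close>)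
    show "norm (m *\<^sub>R x + w) \<le> 100 / 10 + 1" using drift_bound[of x] False by simp
  qed (use bump_bounds[of x] m in auto)
  also have "\<dots> \<le> 3/5 * norm v" by simp
  finally show ?thesis .
qed

lemma kick_affine:
  assumes x: "norm x \<le> 4"
  shows "norm (kick m w x - ((1 + m) *\<^sub>R x + w)) \<le> 1/200"
    and "norm (kick' m w x v - (1 + m) *\<^sub>R v) \<le> 1/200 * norm v"
proof -
  define q where "q = (x \<bullet> x) / 10000"
  have "(norm x)^2 \<le> 4^2" using x by (intro power_mono) auto
  then have q: "0 \<le> q" "q \<le> 16 / 10000" unfolding q_def by (auto simp: power2_norm_eq_inner)
  have "bump x = (1 - q)^2" unfolding bump_def q_def[symmetric] using q by simp
  then have "1 - bump x = q * (2 - q)" by (simp add: power2_eq_square algebra_simps)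
  moreover have "q * (2 - q) \<le> 16/10000 * 2" using q by (intro mult_mono) auto
  moreover have "q * (2 - q) \<ge> 0" using q by (intro mult_nonneg_nonneg) auto
  ultimately have b: "\<bar>bump x - 1\<bar> \<le> 32 / 10000" by linarith
  have d: "norm (m *\<^sub>R x + w) \<le> 14/10" using drift_bound[of x] x by linarith
  have "kick m w x - ((1 + m) *\<^sub>R x + w) = (bump x - 1) *\<^sub>R (m *\<^sub>R x + w)"
    by (simp add: kick_def algebra_simps)
  also have "norm \<dots> = \<bar>bump x - 1\<bar> * norm (m *\<^sub>R x + w)" by simp
  also have "\<dots> \<le> 32/10000 * (14/10)" using b d by (intro mult_mono) auto
  finally show "norm (kick m w x - ((1 + m) *\<^sub>R x + w)) \<le> 1/200" by simp
  have "kick' m w x v - (1 + m) *\<^sub>R v = ((bump x - 1) * m) *\<^sub>R v + bump' x v *\<^sub>R (m *\<^sub>R x + w)"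
    by (simp add: kick'_def algebra_simps)
  also have "norm \<dots> \<le> norm (((bump x - 1) * m) *\<^sub>R v) + norm (bump' x v *\<^sub>R (m *\<^sub>R x + w))"
    by (rule norm_triangle_ineq)
  also have "\<dots> = \<bar>bump x - 1\<bar> * \<bar>m\<bar> * norm v + \<bar>bump' x v\<bar> * norm (m *\<^sub>R x + w)"
    by (simp add: abs_mult)
  also have "\<dots> \<le> 32/10000 * (1/10) * norm v + (4 / 10000 * 4 * norm v) * (14/10)"
  proof (intro add_mono mult_mono mult_right_mono)
    show "\<bar>bump' x v\<bar> \<le> 4 / 10000 * 4 * norm v"
      by (rule order_trans[OF bump'_bound]) (use x in \<open>intro mult_right_mono mult_left_mono, auto\<close>)
  qed (use b d m in auto)
  also have "\<dots> \<le> 1/200 * norm v" by simp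
  finally show "norm (kick' m w x v - (1 + m) *\<^sub>R v) \<le> 1/200 * norm v" .
qed

lemma kick_displacement_lipschitz: "dist (kick m w x - x) (kick m w y - y) \<le> 3/5 * dist x y"
  unfolding dist_norm
proof (rule differentiable_bound[OF convex_UNIV])
  fix u :: 'b
  show "((\<lambda>x. kick m w x - x) has_derivative (\<lambda>v. kick' m w u v - v)) (at u within UNIV)"
    by (auto intro!: derivative_eq_intros kick_has_derivative)
  show "onorm (\<lambda>v. kick' m w u v - v) \<le> 3/5" by (rule onorm_le) (rule kick'_near_id)
qed auto

lemma kick_expand: "2/5 * dist x y \<le> dist (kick m w x) (kick m w y)"
proof -
  have "norm (x - y) \<le> norm (kick m w x - kick m w y) + norm ((kick m w x - x) - (kick m w y - y))"
    using norm_triangle_ineq4[of "kick m w x - kick m w y" "(kick m w x - x) - (kick m w y - y)"] by simp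
  then show ?thesis using kick_displacement_lipschitz[of x y] by (simp add: dist_norm)
qed

lemma kick'_expand: "2/5 * norm v \<le> norm (kick' m w x v)"
proof -
  have "norm v \<le> norm (kick' m w x v) + norm (kick' m w x v - v)"
    using norm_triangle_ineq4[of "kick' m w x v" "kick' m w x v - v"] by simp
  then show ?thesis using kick'_near_id[of x v] by linarith
qed

lemma kick_surj: "\<exists>x. kick m w x = y"
proof -
  have "\<exists>!x. y - (kick m w x - x) = x"
  proof (rule banach_fix_type[of "3/5" "\<lambda>x. y - (kick m w x - x)"])
    show "\<forall>x x'. dist (y - (kick m w x - x)) (y - (kick m w x' - x')) \<le> 3/5 * dist x x'"
    proof (intro allI)
      fix x x' :: 'b
      have "dist (y - a) (y - b) = dist a b" for a b :: 'b by (simp add: dist_norm norm_minus_commute)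
      then show "dist (y - (kick m w x - x)) (y - (kick m w x' - x')) \<le> 3/5 * dist x x'"
        using kick_displacement_lipschitz by (simp only:)
    qed
  qed auto
  then obtain x where "y - (kick m w x - x) = x" by blast
  then show ?thesis by (intro exI[of _ x]) (simp add: algebra_simps)
qed

lemma kick_bij: "bij (kick m w)"
proof (rule bijI)
  show "inj (kick m w)"
  proof (rule injI)
    fix x y assume "kick m w x = kick m w y"
    then show "x = y" using kick_expand[of x y] by simp
  qed
  show "surj (kick m w)" using kick_surj by (metis surjI)
qed

lemma C1a_on_inv_kick:
  assumes \<alpha>: "0 < \<alpha>" "\<alpha> \<le> 1" shows "C1a_on \<alpha> UNIV (inv (kick m w))"
proof (rule C1a_on_inverse[OF C1a_on_kick[OF \<alpha>], where m = "2/5"])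
  fix x f' v assume "(kick m w has_derivative f') (at x)"
  then have "f' = kick' m w x" using kick_has_derivative by (rule has_derivative_unique)
  then show "2/5 * norm v \<le> norm (f' v)" using kick'_expand by simp
next
  fix x show "kick m w (inv (kick m w) x) = x" using kick_bij by (simp add: bij_is_surj surj_f_inv_f)
qed (use kick_expand \<alpha> in auto)

end
abbreviation kick_at :: "'b \<Rightarrow> real \<Rightarrow> real \<Rightarrow> 'b \<Rightarrow> 'b::euclidean_space \<Rightarrow> 'b" where
  "kick_at z s m w x \<equiv> z + s *\<^sub>R kick m w ((1/s) *\<^sub>R (x - z))"

section \<open>Diffeomorphisms of a closed manifold\<close>

locale closed_manifold =
  fixes X :: "'a topology" and A :: "('a, 'n::{finite,wellorder}) chart set"
  assumes mfd: "compact_connected_manifold X A"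
begin

lemma hausdorff: "Hausdorff_space X" and compact: "compact_space X" and connected: "connected_space X"
  and nonempty: "topspace X \<noteq> {}" and atlas: "smooth_atlas X A"
  using mfd by (auto simp: compact_connected_manifold_def)

lemma chart_is_chart: "c \<in> A \<Longrightarrow> is_chart X c"
  using atlas by (auto simp: smooth_atlas_def)

lemma chart_openin: "c \<in> A \<Longrightarrow> openin X (fst c)"
  using chart_is_chart by (auto simp: is_chart_def)

lemma chart_subset: "c \<in> A \<Longrightarrow> fst c \<subseteq> topspace X"
  using chart_openin openin_subset by blast

lemma chart_open_image: "c \<in> A \<Longrightarrow> open (snd c ` fst c)"
  using chart_is_chart by (auto simp: is_chart_def)

lemma chart_homeo: "c \<in> A \<Longrightarrow> homeomorphic_map (subtopology X (fst c)) (top_of_set (snd c ` fst c)) (snd c)"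
  using chart_is_chart by (auto simp: is_chart_def)

lemma chart_exists: "p \<in> topspace X \<Longrightarrow> \<exists>c\<in>A. p \<in> fst c"
  using atlas by (auto simp: smooth_atlas_def)

lemma finite_subcover:
  assumes "\<And>p. p \<in> topspace X \<Longrightarrow> openin X (V p) \<and> p \<in> V p"
  obtains Q where "Q \<subseteq> topspace X" "finite Q" "topspace X \<subseteq> (\<Union>p\<in>Q. V p)"
proof -
  have "\<exists>\<F>. finite \<F> \<and> \<F> \<subseteq> V ` topspace X \<and> topspace X \<subseteq> \<Union>\<F>"
    using compact assms unfolding compact_space_def by (intro compactinD) auto
  then obtain \<F> where F: "finite \<F>" "\<F> \<subseteq> V ` topspace X" "topspace X \<subseteq> \<Union>\<F>" by blast
  then obtain Q where "Q \<subseteq> topspace X" "finite Q" "\<F> = V ` Q" by (meson finite_subset_image)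
  then show thesis using F(3) that by blast
qed

lemma chart_inj: assumes "c \<in> A" shows "inj_on (snd c) (fst c)"
proof -
  have "inj_on (snd c) (topspace (subtopology X (fst c)))"
    using chart_homeo[OF assms] by (rule homeomorphic_imp_injective_map)
  moreover have "topspace (subtopology X (fst c)) = fst c" using chart_subset[OF assms] by auto
  ultimately show ?thesis by simp
qed

lemma chart_inv_f [simp]: "c \<in> A \<Longrightarrow> p \<in> fst c \<Longrightarrow> chart_inv c (snd c p) = p"
  by (rule inv_into_f_f[OF chart_inj])

lemma chart_f_inv: "x \<in> snd c ` fst c \<Longrightarrow> snd c (chart_inv c x) = x"
  by (rule f_inv_into_f)

lemma chart_inv_in: "x \<in> snd c ` fst c \<Longrightarrow> chart_inv c x \<in> fst c"
  by (rule inv_into_into)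

lemma chart_inv_image_subset: "W \<subseteq> snd c ` fst c \<Longrightarrow> chart_inv c ` W \<subseteq> fst c"
  by (intro image_subsetI chart_inv_in) (erule subsetD)

lemma chart_inv_top: "c \<in> A \<Longrightarrow> x \<in> snd c ` fst c \<Longrightarrow> chart_inv c x \<in> topspace X"
  by (rule subsetD[OF chart_subset chart_inv_in])

lemma chart_image_open:
  assumes c: "c \<in> A" and V: "openin X V" "V \<subseteq> fst c" shows "open (snd c ` V)"
proof -
  have "openin (subtopology X (fst c)) V"
    using V chart_openin[OF c] by (simp add: openin_open_subtopology)
  then have "openin (top_of_set (snd c ` fst c)) (snd c ` V)"
    using homeomorphic_imp_open_map[OF chart_homeo[OF c]] by (auto simp: open_map_def)
  then show ?thesis using chart_open_image[OF c] by (simp add: openin_open_eq)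
qed

lemma chart_continuous: "c \<in> A \<Longrightarrow> continuous_map (subtopology X (fst c)) euclidean (snd c)"
  by (metis continuous_map_into_fulltopology homeomorphic_imp_continuous_map chart_homeo)

lemma chart_preimage_open:
  assumes c: "c \<in> A" and W: "open W" shows "openin X {p \<in> fst c. snd c p \<in> W}"
proof -
  have "openin (subtopology X (fst c)) {p \<in> topspace (subtopology X (fst c)). snd c p \<in> W}"
    using chart_continuous[OF c] W by (intro openin_continuous_map_preimage) auto
  moreover have "{p \<in> topspace (subtopology X (fst c)). snd c p \<in> W} = {p \<in> fst c. snd c p \<in> W}"
    using chart_subset[OF c] by auto
  ultimately show ?thesis using chart_openin[OF c] by (simp add: openin_open_subtopology)
qed

lemma chart_inv_continuous:
  assumes c: "c \<in> A" shows "continuous_map (top_of_set (snd c ` fst c)) X (chart_inv c)"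
proof -
  have eq: "{x \<in> snd c ` fst c. chart_inv c x \<in> W} = snd c ` (fst c \<inter> W)" for W
  proof safe
    fix p assume "p \<in> fst c" "chart_inv c (snd c p) \<in> W"
    then show "snd c p \<in> snd c ` (fst c \<inter> W)" using c by auto
  next
    fix p assume "p \<in> fst c" "p \<in> W"
    then show "chart_inv c (snd c p) \<in> W" using c by simp
  qed auto
  show ?thesis
    unfolding continuous_map_def
  proof (intro conjI allI impI)
    show "chart_inv c \<in> topspace (top_of_set (snd c ` fst c)) \<rightarrow> topspace X"
    proof (rule funcsetI)
      fix x assume "x \<in> topspace (top_of_set (snd c ` fst c))"
      then have "x \<in> snd c ` fst c" by simp
      then show "chart_inv c x \<in> topspace X" by (rule chart_inv_top[OF c])
    qed
    fix W assume "openin X W"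
    then have "open (snd c ` (fst c \<inter> W))"
      using chart_openin[OF c] by (intro chart_image_open[OF c] openin_Int) auto
    then have "openin (top_of_set (snd c ` fst c)) (snd c ` (fst c \<inter> W))"
      unfolding openin_open_eq[OF chart_open_image[OF c]] by blast
    then show "openin (top_of_set (snd c ` fst c)) {x \<in> topspace (top_of_set (snd c ` fst c)). chart_inv c x \<in> W}"
      unfolding topspace_euclidean_subtopology eq .
  qed
qed

lemma chart_inv_image_open:
  assumes c: "c \<in> A" and W: "open W" "W \<subseteq> snd c ` fst c" shows "openin X (chart_inv c ` W)"
proof -
  have "chart_inv c ` W = {p \<in> fst c. snd c p \<in> W}"
  proof safe
    fix x assume "x \<in> W"
    then have x: "x \<in> snd c ` fst c" using W by blast
    show "chart_inv c x \<in> fst c" by (rule chart_inv_in[OF x])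
    show "snd c (chart_inv c x) \<in> W" using chart_f_inv[OF x] \<open>x \<in> W\<close> by simp
  next
    fix p assume "p \<in> fst c" "snd c p \<in> W"
    then show "p \<in> chart_inv c ` W" using c by (intro image_eqI[of _ _ "snd c p"]) auto
  qed
  then show ?thesis using chart_preimage_open[OF c W(1)] by simp
qed

lemma chart_inv_image_compact:
  assumes c: "c \<in> A" and W: "compact W" "W \<subseteq> snd c ` fst c" shows "compactin X (chart_inv c ` W)"
proof (rule image_compactin[OF _ chart_inv_continuous[OF c]])
  show "compactin (top_of_set (snd c ` fst c)) W" using W by (simp add: compactin_subtopology)
qed

lemma coord_dom_iff: "c \<in> A \<Longrightarrow> x \<in> coord_dom c d f \<longleftrightarrow> x \<in> snd c ` fst c \<and> f (chart_inv c x) \<in> fst d"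
  unfolding coord_dom_def by (force simp: chart_inv_in chart_f_inv)

lemma coord_dom_open:
  assumes f: "continuous_map X X f" and c: "c \<in> A" and d: "d \<in> A" shows "open (coord_dom c d f)"
proof -
  have "fst c \<inter> f -` fst d = fst c \<inter> {p \<in> topspace X. f p \<in> fst d}" using chart_subset[OF c] by auto
  then show ?thesis
    unfolding coord_dom_def using f chart_openin[OF c] chart_openin[OF d] c
    by (auto intro!: chart_image_open openin_Int openin_continuous_map_preimage)
qed

definition C1a_mfd :: "real \<Rightarrow> ('a \<Rightarrow> 'a) \<Rightarrow> bool" where
  "C1a_mfd \<alpha> f \<longleftrightarrow> continuous_map X X f \<and> (\<forall>c\<in>A. \<forall>d\<in>A. C1a_on \<alpha> (coord_dom c d f) (coord_rep c d f))"

lemma C1a_mfd_imp_C1a_map: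
  assumes "C1a_mfd \<alpha> f" "\<alpha> > 0" shows "C1a_map X A \<alpha> f"
  using assms C1a_on_jacobian[OF _ assms(2)] unfolding C1a_mfd_def C1a_map_def Let_def by blast

text \<open>For the identity the coordinate representations are the transition maps.\<close>
lemma C1a_mfd_id:
  assumes \<alpha>: "0 < \<alpha>" "\<alpha> \<le> 1" shows "C1a_mfd \<alpha> id"
  unfolding C1a_mfd_def
proof (intro conjI ballI)
  show "continuous_map X X id" by simp
  fix c d assume c: "c \<in> A" and d: "d \<in> A"
  then have "Ck_on 2 (coord_dom c d id) (coord_rep c d id)"
    using atlas by (simp add: smooth_atlas_def smooth_on_def)
  then show "C1a_on \<alpha> (coord_dom c d id) (coord_rep c d id)"
    by (rule Ck_on_2_imp_C1a_on[OF _ coord_dom_open[OF _ c d] \<alpha>]) simp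
qed

lemma C1a_mfd_cong:
  assumes f: "C1a_mfd \<alpha> f" and fg: "\<And>p. p \<in> topspace X \<Longrightarrow> g p = f p"
  shows "C1a_mfd \<alpha> g"
  unfolding C1a_mfd_def
proof (intro conjI ballI)
  show "continuous_map X X g"
    using f fg unfolding C1a_mfd_def by (metis continuous_map_eq)
  fix c d assume c: "c \<in> A" and d: "d \<in> A"
  have e: "g (chart_inv c x) = f (chart_inv c x)" if "x \<in> snd c ` fst c" for x
    by (rule fg[OF chart_inv_top[OF c that]])
  have eq: "coord_dom c d g = coord_dom c d f"
    using e by (auto simp: coord_dom_iff[OF c])
  show "C1a_on \<alpha> (coord_dom c d g) (coord_rep c d g)"
    unfolding eq
  proof (rule C1a_on_cong)
    show "C1a_on \<alpha> (coord_dom c d f) (coord_rep c d f)" "open (coord_dom c d f)"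
      using f c d coord_dom_open by (auto simp: C1a_mfd_def)
    show "coord_rep c d g y = coord_rep c d f y" if "y \<in> coord_dom c d f" for y
      using e[of y] that by (simp add: coord_rep_def coord_dom_iff[OF c])
  qed
qed

lemma C1a_mfd_comp:
  assumes f: "C1a_mfd \<alpha> f" and g: "C1a_mfd \<alpha> g" and \<alpha>: "0 < \<alpha>"
  shows "C1a_mfd \<alpha> (g \<circ> f)"
  unfolding C1a_mfd_def
proof (intro conjI ballI)
  have cf: "continuous_map X X f" and cg: "continuous_map X X g" using f g by (auto simp: C1a_mfd_def)
  then show "continuous_map X X (g \<circ> f)" by (rule continuous_map_compose)
  fix c e assume c: "c \<in> A" and e: "e \<in> A"
  show "C1a_on \<alpha> (coord_dom c e (g \<circ> f)) (coord_rep c e (g \<circ> f))"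
  proof (rule C1a_on_local)
    fix x assume "x \<in> coord_dom c e (g \<circ> f)"
    then have x: "x \<in> snd c ` fst c" "g (f (chart_inv c x)) \<in> fst e" by (auto simp: coord_dom_iff[OF c])
    have "chart_inv c x \<in> topspace X" by (rule chart_inv_top[OF c x(1)])
    then have "f (chart_inv c x) \<in> topspace X" using cf by (auto simp: continuous_map_def)
    then obtain d where d: "d \<in> A" "f (chart_inv c x) \<in> fst d" using chart_exists by blast
    let ?F = "coord_rep c d f" and ?G = "coord_rep d e g"
    have CF: "C1a_on \<alpha> (coord_dom c d f) ?F" and CG: "C1a_on \<alpha> (coord_dom d e g) ?G"
      using f g c d e by (auto simp: C1a_mfd_def)
    define V where "V = coord_dom c d f \<inter> ?F -` coord_dom d e g"
    have V: "open V"
      unfolding V_def using C1a_on_continuous[OF CF] coord_dom_open[OF cf c d(1)] coord_dom_open[OF cg d(1) e]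
      by (rule continuous_open_preimage)
    have inV: "y \<in> V \<longleftrightarrow> y \<in> snd c ` fst c \<and> f (chart_inv c y) \<in> fst d \<and> g (f (chart_inv c y)) \<in> fst e" for y
      by (cases "f (chart_inv c y) \<in> fst d")
        (simp_all add: V_def coord_dom_iff[OF c] coord_dom_iff[OF d(1)] coord_rep_def d(1))
    have "C1a_on \<alpha> V (\<lambda>y. ?G (?F y))"
      by (rule C1a_on_compose[OF C1a_on_subset[OF CF V] CG _ \<alpha>]) (auto simp: V_def)
    moreover have "coord_rep c e (g \<circ> f) y = ?G (?F y)" if "y \<in> V" for y
      using that d(1) unfolding inV by (auto simp: coord_rep_def)
    ultimately show "\<exists>V h. open V \<and> x \<in> V \<and> V \<subseteq> coord_dom c e (g \<circ> f) \<and> C1a_on \<alpha> V h \<and>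
        (\<forall>y\<in>V. coord_rep c e (g \<circ> f) y = h y)"
      using V x d by (intro exI[of _ V] exI[of _ "\<lambda>y. ?G (?F y)"]) (auto simp: inV coord_dom_iff[OF c])
  qed
qed

text \<open>The self-map of the manifold that acts as \<open>\<kappa>\<close> in one chart.\<close>
definition chart_map :: "('a, 'n) chart \<Rightarrow> ((real,'n) vec \<Rightarrow> (real,'n) vec) \<Rightarrow> 'a \<Rightarrow> 'a" where
  "chart_map c \<kappa> p = (if p \<in> fst c then chart_inv c (\<kappa> (snd c p)) else p)"

text \<open>The manifold is covered by the chart domain and by the complement of the image of \<open>Q\<close>, which is open as the manifold is
  Hausdorff. On the former the map is \<open>\<kappa>\<close> in coordinates, on the latter the identity.\<close>
lemma C1a_mfd_chart_map:
  assumes c: "c \<in> A" and \<kappa>: "C1a_on \<alpha> UNIV \<kappa>" and \<alpha>: "0 < \<alpha>" "\<alpha> \<le> 1"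
    and Q: "compact Q" "Q \<subseteq> snd c ` fst c" "\<And>x. x \<notin> Q \<Longrightarrow> \<kappa> x = x"
    and im: "\<And>x. x \<in> snd c ` fst c \<Longrightarrow> \<kappa> x \<in> snd c ` fst c"
  shows "C1a_mfd \<alpha> (chart_map c \<kappa>)"
proof -
  let ?f = "chart_map c \<kappa>"
  \<comment> \<open>Off the image of \<open>Q\<close> the map is the identity.\<close>
  define R0 where "R0 = topspace X - chart_inv c ` Q"
  have "closedin X (chart_inv c ` Q)"
    using chart_inv_image_compact[OF c Q(1,2)] hausdorff compactin_imp_closedin by blast
  then have Oo: "openin X R0" unfolding R0_def by blast
  have fR: "?f p = p" if "p \<in> R0" for p
  proof (cases "p \<in> fst c")
    case True
    then have "snd c p \<notin> Q" using that c unfolding R0_def by (metis DiffE chart_inv_f image_eqI)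
    then show ?thesis using True c Q(3) by (simp add: chart_map_def)
  qed (simp add: chart_map_def)
  have cov: "p \<in> R0" if "p \<in> topspace X" "p \<notin> fst c" for p
    using that(1) chart_inv_in[OF subsetD[OF Q(2)]] that(2) unfolding R0_def by auto
  have fc: "?f p \<in> fst c" "snd c (?f p) = \<kappa> (snd c p)" if "p \<in> fst c" for p
    using im[of "snd c p"] that by (auto simp: chart_map_def chart_inv_in chart_f_inv)
  have cont: "continuous_map X X ?f"
    unfolding continuous_map_def
  proof (intro conjI allI impI)
    show "?f \<in> topspace X \<rightarrow> topspace X"
    proof (rule funcsetI)
      fix p assume "p \<in> topspace X"
      then show "?f p \<in> topspace X"
        using subsetD[OF chart_subset[OF c] fc(1)[of p]] by (cases "p \<in> fst c") (auto simp: chart_map_def)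
    qed
    fix W assume W: "openin X W"
    have "open (snd c ` (fst c \<inter> W))" using W chart_openin[OF c] by (intro chart_image_open[OF c] openin_Int) auto
    then have "open (\<kappa> -` (snd c ` (fst c \<inter> W)))"
      using C1a_on_continuous[OF \<kappa>] by (intro open_vimage) auto
    then have "openin X {p \<in> fst c. snd c p \<in> \<kappa> -` (snd c ` (fst c \<inter> W))}" by (rule chart_preimage_open[OF c])
    moreover have "{p \<in> topspace X. ?f p \<in> W} = {p \<in> fst c. snd c p \<in> \<kappa> -` (snd c ` (fst c \<inter> W))} \<union> (R0 \<inter> W)" (is "?L = ?R")
    proof (rule set_eqI)
      fix p
      show "p \<in> ?L \<longleftrightarrow> p \<in> ?R"
      proof (cases "p \<in> fst c")
        case True
        have "?f p \<in> W \<longleftrightarrow> snd c (?f p) \<in> snd c ` (fst c \<inter> W)"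
          using fc(1)[OF True] chart_inj[OF c] by (auto dest: inj_onD)
        then show ?thesis using True fc(2)[OF True] fR[of p] chart_subset[OF c] by auto
      next
        case False
        then show ?thesis using cov[of p] fR[of p] unfolding R0_def by auto
      qed
    qed
    ultimately show "openin X {p \<in> topspace X. ?f p \<in> W}" using Oo W by auto
  qed
  show ?thesis
    unfolding C1a_mfd_def
  proof (intro conjI ballI cont)
    fix c' d' assume c': "c' \<in> A" and d': "d' \<in> A"
    have tr: "C1a_on \<alpha> (coord_dom a b id) (coord_rep a b id)" if "a \<in> A" "b \<in> A" for a b
      using C1a_mfd_id[OF \<alpha>] that by (auto simp: C1a_mfd_def)
    have oid: "open (coord_dom a b id)" if "a \<in> A" "b \<in> A" for a b
      using coord_dom_open[of id] that by simp
    note odf = coord_dom_open[OF cont c' d']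
    show "C1a_on \<alpha> (coord_dom c' d' ?f) (coord_rep c' d' ?f)"
    proof (rule C1a_on_local)
      fix x assume x: "x \<in> coord_dom c' d' ?f"
      then have x1: "x \<in> snd c' ` fst c'" "?f (chart_inv c' x) \<in> fst d'" by (auto simp: coord_dom_iff[OF c'])
      show "\<exists>V h. open V \<and> x \<in> V \<and> V \<subseteq> coord_dom c' d' ?f \<and> C1a_on \<alpha> V h \<and> (\<forall>y\<in>V. coord_rep c' d' ?f y = h y)"
      proof (cases "chart_inv c' x \<in> fst c")
        case True
        define V where "V = coord_dom c' d' ?f \<inter> coord_dom c' c id"
        have V: "open V" unfolding V_def by (intro open_Int odf oid c' c)
        let ?T = "coord_rep c' c id" and ?T' = "coord_rep c d' id"
        have y: "y \<in> snd c' ` fst c'" "chart_inv c' y \<in> fst c" "?f (chart_inv c' y) \<in> fst d'" if "y \<in> V" for y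
          using that by (auto simp: V_def coord_dom_iff[OF c'])
        have "C1a_on \<alpha> V (\<lambda>y. \<kappa> (?T y))"
          by (rule C1a_on_compose[OF C1a_on_subset[OF tr[OF c' c] V] \<kappa> _ \<alpha>(1)]) (auto simp: V_def)
        then have "C1a_on \<alpha> V (\<lambda>y. ?T' (\<kappa> (?T y)))"
        proof (rule C1a_on_compose[OF _ tr[OF c d'] _ \<alpha>(1)])
          show "(\<lambda>y. \<kappa> (?T y)) ` V \<subseteq> coord_dom c d' id"
          proof safe
            fix y assume "y \<in> V"
            from y[OF this] show "\<kappa> (?T y) \<in> coord_dom c d' id"
              using im by (auto simp: coord_dom_iff[OF c] coord_rep_def chart_map_def)
          qed
        qed
        moreover have "coord_rep c' d' ?f y = ?T' (\<kappa> (?T y))" if "y \<in> V" for y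
          using y[OF that] by (simp add: coord_rep_def chart_map_def)
        ultimately show ?thesis
          using V x True c' x1 by (intro exI[of _ V] exI[of _ "\<lambda>y. ?T' (\<kappa> (?T y))"]) (auto simp: V_def coord_dom_iff)
      next
        case False
        define V where "V = coord_dom c' d' ?f \<inter> snd c' ` (fst c' \<inter> R0)"
        have V: "open V" unfolding V_def
          using Oo chart_openin[OF c'] by (intro open_Int odf chart_image_open[OF c'] openin_Int) auto
        have y: "y \<in> snd c' ` fst c'" "chart_inv c' y \<in> R0" "?f (chart_inv c' y) \<in> fst d'" if "y \<in> V" for y
          using that c' by (auto simp: V_def coord_dom_iff[OF c'])
        have sub: "V \<subseteq> coord_dom c' d' id"
          using y fR by (auto simp: coord_dom_iff[OF c'])
        have "chart_inv c' x \<in> R0"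
          by (rule cov) (use chart_inv_top[OF c' x1(1)] False in auto)
        then have "x \<in> V" using x x1 chart_inv_in[OF x1(1)] unfolding V_def
          by (auto intro!: image_eqI[of _ _ "chart_inv c' x"] simp: chart_f_inv)
        moreover have "coord_rep c' d' ?f y = coord_rep c' d' id y" if "y \<in> V" for y
          using fR[OF y(2)[OF that]] by (simp add: coord_rep_def)
        ultimately show ?thesis
          using V C1a_on_subset[OF tr[OF c' d'] V sub] by (intro exI[of _ V] exI[of _ "coord_rep c' d' id"]) (auto simp: V_def)
      qed
    qed
  qed
qed

definition diffeo_pair :: "real \<Rightarrow> ('a \<Rightarrow> 'a) \<Rightarrow> ('a \<Rightarrow> 'a) \<Rightarrow> bool" where
  "diffeo_pair \<alpha> f g \<longleftrightarrow> C1a_mfd \<alpha> f \<and> C1a_mfd \<alpha> g \<and> (\<forall>p\<in>topspace X. g (f p) = p \<and> f (g p) = p)"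

lemma C1a_mfd_maps: "C1a_mfd \<alpha> f \<Longrightarrow> p \<in> topspace X \<Longrightarrow> f p \<in> topspace X"
  unfolding C1a_mfd_def by (auto simp: continuous_map_def)

lemma diffeo_pair_imp_C1a_diffeo:
  assumes fg: "diffeo_pair \<alpha> f g" and \<alpha>: "0 < \<alpha>" shows "f \<in> C1a_diffeo X A \<alpha>"
proof -
  have f: "C1a_mfd \<alpha> f" and g: "C1a_mfd \<alpha> g" and inv: "\<And>p. p \<in> topspace X \<Longrightarrow> g (f p) = p \<and> f (g p) = p"
    using fg by (auto simp: diffeo_pair_def)
  have bij: "bij_betw f (topspace X) (topspace X)"
    using inv C1a_mfd_maps[OF f] C1a_mfd_maps[OF g] by (intro bij_betw_byWitness[where f' = g]) auto
  have "inv_into (topspace X) f p = g p" if "p \<in> topspace X" for p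
    using inv[OF that] C1a_mfd_maps[OF g that] bij by (metis bij_betw_inv_into_left)
  then have "C1a_mfd \<alpha> (inv_into (topspace X) f)" by (rule C1a_mfd_cong[OF g])
  then show ?thesis using bij f C1a_mfd_imp_C1a_map \<alpha> by (auto simp: C1a_diffeo_def)
qed

lemma diffeo_pair_comp:
  assumes "diffeo_pair \<alpha> f f'" "diffeo_pair \<alpha> g g'" "0 < \<alpha>" shows "diffeo_pair \<alpha> (g \<circ> f) (f' \<circ> g')"
  using assms C1a_mfd_maps unfolding diffeo_pair_def by (auto intro!: C1a_mfd_comp)

text \<open>A diffeomorphism of the plane that is the identity off a ball in the chart preserves the image of the chart.\<close>
lemma kick_diffeo:
  assumes c: "c \<in> A" and s: "s > 0" and sub: "cball z (100 * s) \<subseteq> snd c ` fst c"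
    and m: "\<bar>m\<bar> \<le> 1/10" and w: "norm w \<le> 1" and \<alpha>: "0 < \<alpha>" "\<alpha> \<le> 1"
  obtains f g where "diffeo_pair \<alpha> f g"
    "\<And>x. x \<in> snd c ` fst c \<Longrightarrow> f (chart_inv c x) = chart_inv c (kick_at z s m w x)"
    "\<And>x. x \<in> snd c ` fst c \<Longrightarrow> kick_at z s m w x \<in> snd c ` fst c"
proof -
  define conj where "conj = (\<lambda>k x. z + s *\<^sub>R k ((1/s) *\<^sub>R (x - z)) :: (real,'n) vec)"
  have C: "C1a_on \<alpha> UNIV (conj k)" if k: "C1a_on \<alpha> UNIV k" for k
  proof -
    have "C1a_on \<alpha> UNIV (\<lambda>x::(real,'n) vec. (1/s) *\<^sub>R x + (- ((1/s) *\<^sub>R z)))"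
      by (intro C1a_on_add C1a_on_const C1a_on_bounded_linear bounded_linear_scaleR_right open_UNIV)
    then have "C1a_on \<alpha> UNIV (\<lambda>x::(real,'n) vec. (1/s) *\<^sub>R (x - z))" by (simp add: scaleR_diff_right)
    from C1a_on_compose[OF this k _ \<alpha>(1)] have "C1a_on \<alpha> UNIV (\<lambda>x::(real,'n) vec. k ((1/s) *\<^sub>R (x - z)))" by simp
    from C1a_on_compose[OF this C1a_on_bounded_linear[OF bounded_linear_scaleR_right[of s] open_UNIV] _ \<alpha>(1)]
    have "C1a_on \<alpha> UNIV (\<lambda>x::(real,'n) vec. s *\<^sub>R k ((1/s) *\<^sub>R (x - z)))" by simp
    from C1a_on_add[OF C1a_on_const[OF open_UNIV] this] show ?thesis unfolding conj_def .
  qed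
  note bij = kick_bij[OF m w]
  have conj_id: "conj (\<lambda>x. x) = (\<lambda>x. x)" unfolding conj_def using s by auto
  have conj_conj: "conj k (conj k' x) = conj (\<lambda>x. k (k' x)) x" for k k' x unfolding conj_def using s by simp
  define \<kappa> where "\<kappa> = conj (kick m w)"
  define \<kappa>' where "\<kappa>' = conj (inv (kick m w))"
  have inv1: "\<kappa>' (\<kappa> x) = x" for x
    unfolding \<kappa>_def \<kappa>'_def conj_conj using bij by (simp add: conj_id bij_is_inj)
  have inv2: "\<kappa> (\<kappa>' x) = x" for x
    unfolding \<kappa>_def \<kappa>'_def conj_conj using bij by (simp add: conj_id bij_is_surj surj_f_inv_f)
  let ?Q = "cball z (100 * s)"
  have out: "\<kappa> x = x" if "x \<notin> ?Q" for x
  proof -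
    have "norm ((1/s) *\<^sub>R (x - z)) = dist z x / s" using s by (simp add: dist_norm norm_minus_commute divide_inverse)
    also have "\<dots> \<ge> 100" using that s by (simp add: field_simps)
    finally show ?thesis unfolding \<kappa>_def conj_def using s by (simp add: kick_outside)
  qed
  have out': "\<kappa>' x = x" if "x \<notin> ?Q" for x using out[OF that] inv1[of x] by simp
  have im: "\<kappa> x \<in> snd c ` fst c" if "x \<in> snd c ` fst c" for x
  proof (rule ccontr)
    assume "\<kappa> x \<notin> snd c ` fst c"
    then have "\<kappa>' (\<kappa> x) = \<kappa> x" using sub by (intro out') auto
    then show False using inv1[of x] that \<open>\<kappa> x \<notin> _\<close> by simp
  qed
  have im': "\<kappa>' x \<in> snd c ` fst c" if "x \<in> snd c ` fst c" for x
  proof (rule ccontr)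
    assume "\<kappa>' x \<notin> snd c ` fst c"
    then have "\<kappa> (\<kappa>' x) = \<kappa>' x" using sub by (intro out) auto
    then show False using inv2[of x] that \<open>\<kappa>' x \<notin> _\<close> by simp
  qed
  show thesis
  proof (rule that[of "chart_map c \<kappa>" "chart_map c \<kappa>'"])
    show "diffeo_pair \<alpha> (chart_map c \<kappa>) (chart_map c \<kappa>')"
      unfolding diffeo_pair_def
    proof (intro conjI ballI)
      show "C1a_mfd \<alpha> (chart_map c \<kappa>)"
        by (rule C1a_mfd_chart_map[OF c _ \<alpha> _ sub]) (use C[OF C1a_on_kick[OF \<alpha>]] out im in \<open>auto simp: \<kappa>_def\<close>)
      show "C1a_mfd \<alpha> (chart_map c \<kappa>')"
        by (rule C1a_mfd_chart_map[OF c _ \<alpha> _ sub]) (use C[OF C1a_on_inv_kick[OF m w \<alpha>]] out' im' in \<open>auto simp: \<kappa>'_def\<close>)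
      fix p
      show "chart_map c \<kappa>' (chart_map c \<kappa> p) = p"
        using im[of "snd c p"] inv1 c by (auto simp: chart_map_def chart_inv_in chart_f_inv)
      show "chart_map c \<kappa> (chart_map c \<kappa>' p) = p"
        using im'[of "snd c p"] inv2 c by (auto simp: chart_map_def chart_inv_in chart_f_inv)
    qed
    show "chart_map c \<kappa> (chart_inv c x) = chart_inv c (kick_at z s m w x)" if "x \<in> snd c ` fst c" for x
      using that by (simp add: chart_map_def chart_inv_in chart_f_inv \<kappa>_def conj_def)
    show "kick_at z s m w x \<in> snd c ` fst c" if "x \<in> snd c ` fst c" for x
      using im[OF that] by (simp add: \<kappa>_def conj_def)
  qed
qed

text \<open>The points that can be moved into \<open>D\<close> form an open set by continuity. Its complement is open too: within
  a small chart ball, any point is reached from the centre by a kick with \<open>m = 0\<close>.\<close>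
lemma diffeo_transitive:
  assumes D: "openin X D" "D \<noteq> {}" and p: "p \<in> topspace X" and \<alpha>: "0 < \<alpha>" "\<alpha> \<le> 1"
  shows "\<exists>f g. diffeo_pair \<alpha> f g \<and> f p \<in> D"
proof -
  define W where "W = {p \<in> topspace X. \<exists>f g. diffeo_pair \<alpha> f g \<and> f p \<in> D}"
  have "openin X W"
  proof (subst openin_subopen, safe)
    fix q assume "q \<in> W"
    then obtain f g where q: "q \<in> topspace X" "diffeo_pair \<alpha> f g" "f q \<in> D" by (auto simp: W_def)
    have "openin X {p \<in> topspace X. f p \<in> D}"
      using q D by (intro openin_continuous_map_preimage[of X X]) (auto simp: diffeo_pair_def C1a_mfd_def)
    then show "\<exists>T. openin X T \<and> q \<in> T \<and> T \<subseteq> W" using q by (intro exI[of _ "{p \<in> topspace X. f p \<in> D}"]) (auto simp: W_def)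
  qed
  moreover have "openin X (topspace X - W)"
  proof (subst openin_subopen, rule ballI)
    fix q assume q: "q \<in> topspace X - W"
    then obtain c where c: "c \<in> A" "q \<in> fst c" using chart_exists by blast
    let ?z = "snd c q"
    obtain e where e: "e > 0" "cball ?z e \<subseteq> snd c ` fst c"
      using chart_open_image[OF c(1)] c(2) by (meson open_contains_cball image_eqI)
    define s where "s = e / 100"
    have s: "s > 0" "cball ?z (100 * s) \<subseteq> snd c ` fst c" using e unfolding s_def by auto
    define T where "T = {p \<in> fst c. snd c p \<in> ball ?z s}"
    have "openin X T" unfolding T_def by (rule chart_preimage_open[OF c(1)]) simp
    moreover have "q \<in> T" using c s by (simp add: T_def)
    moreover have "T \<subseteq> topspace X - W"
    proof
      fix p assume p: "p \<in> T"
      then have p1: "p \<in> fst c" "dist ?z (snd c p) < s" by (auto simp: T_def)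
      show "p \<in> topspace X - W"
      proof (rule ccontr)
        assume "p \<notin> topspace X - W"
        then have "p \<in> W" using p1 chart_subset[OF c(1)] by auto
        then obtain f g where f: "diffeo_pair \<alpha> f g" "f p \<in> D" by (auto simp: W_def)
        define w where "w = (1/s) *\<^sub>R (snd c p - ?z)"
        have "norm w = dist ?z (snd c p) / s"
          unfolding w_def using s(1) by (simp add: dist_norm norm_minus_commute divide_inverse)
        then have w: "norm w \<le> 1" using p1 s by simp
        obtain k k' where k: "diffeo_pair \<alpha> k k'"
          "\<And>x. x \<in> snd c ` fst c \<Longrightarrow> k (chart_inv c x) = chart_inv c (kick_at ?z s 0 w x)"
          using kick_diffeo[OF c(1) s, of 0 w \<alpha>] w \<alpha> by (metis abs_0 divide_nonneg_nonneg zero_le_numeral zero_le_one)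
        have "k q = p" using k(2)[of ?z] c s(1) p1 by (simp add: kick_0) (simp add: w_def)
        then have "diffeo_pair \<alpha> (f \<circ> k) (k' \<circ> g)" "(f \<circ> k) q \<in> D"
          using f diffeo_pair_comp[OF k(1) f(1) \<alpha>(1)] by auto
        then have "q \<in> W" using q unfolding W_def by blast
        then show False using q by blast
      qed
    qed
    ultimately show "\<exists>T. openin X T \<and> q \<in> T \<and> T \<subseteq> topspace X - W" by blast
  qed
  then have "closedin X W" by (auto simp: closedin_def W_def)
  ultimately have "W = {} \<or> W = topspace X"
    using connected by (auto simp: connected_space_clopen_in)
  moreover have "W \<noteq> {}"
  proof -
    obtain q where q: "q \<in> D" using D by blast
    moreover have "diffeo_pair \<alpha> id id" using C1a_mfd_id[OF \<alpha>] by (simp add: diffeo_pair_def)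
    ultimately have "q \<in> W" using D openin_subset unfolding W_def by fastforce
    then show ?thesis by blast
  qed
  ultimately show ?thesis using p unfolding W_def by blast
qed

end

section \<open>The Riemannian volume\<close>

lemma continuous_on_det:
  fixes F :: "'b::topological_space \<Rightarrow> real^'n^'n"
  assumes "continuous_on S F" shows "continuous_on S (\<lambda>x. det (F x))"
  unfolding det_def by (intro continuous_intros assms)

text \<open>The segment from the identity to \<open>M\<close> consists of positive definite matrices, so the determinant has no
  zero on it.\<close>
lemma det_pos_of_positive_definite:
  fixes M :: "real^'n^'n"
  assumes M: "\<And>v. v \<noteq> 0 \<Longrightarrow> v \<bullet> (M *v v) > 0" shows "det M > 0"
proof (rule ccontr)
  assume neg: "\<not> det M > 0"
  define f where "f = (\<lambda>t::real. det ((1 - t) *\<^sub>R mat 1 + t *\<^sub>R M))"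
  have c: "continuous_on {0..1} f" unfolding f_def by (intro continuous_on_det continuous_intros)
  have "f 0 = 1" "f 1 = det M" by (auto simp: f_def)
  then obtain t where t: "0 \<le> t" "t \<le> 1" "f t = 0"
    using IVT2'[of f 1 0 0] neg c by force
  then obtain v where v: "v \<noteq> 0" "((1 - t) *\<^sub>R mat 1 + t *\<^sub>R M) *v v = 0"
    unfolding f_def using invertible_det_nz invertible_left_inverse matrix_left_invertible_ker by metis
  have "0 = v \<bullet> (((1 - t) *\<^sub>R mat 1 + t *\<^sub>R M) *v v)" using v by simp
  also have "\<dots> = (1 - t) * (v \<bullet> v) + t * (v \<bullet> (M *v v))"
    by (simp add: matrix_vector_mult_add_rdistrib scaleR_matrix_vector_assoc[symmetric] inner_add_right)
  finally have e: "(1 - t) * (v \<bullet> v) + t * (v \<bullet> (M *v v)) = 0" by simp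
  have "0 \<le> (1 - t) * (v \<bullet> v)" "0 \<le> t * (v \<bullet> (M *v v))" using t M[OF v(1)] by auto
  with e have "(1 - t) * (v \<bullet> v) = 0" "t * (v \<bullet> (M *v v)) = 0" by linarith+
  then show False using v M[OF v(1)] by auto
qed

lemma Ck_on_1_det_continuous:
  fixes f :: "real^'n \<Rightarrow> real^'n"
  assumes "Ck_on 1 S f" shows "continuous_on S (\<lambda>x. det (jacobian f (at x)))"
proof (rule continuous_on_det)
  have c: "continuous_on S (\<lambda>x. frechet_derivative f (at x) v)" for v using assms by simp
  have "jacobian f (at x) = (\<chi> i j. frechet_derivative f (at x) (axis j 1) $ i)" for x
    by (simp add: jacobian_def matrix_def)
  then show "continuous_on S (\<lambda>x. jacobian f (at x))"
    by (simp add: continuous_on_vec_lambda continuous_on_component c)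
qed

lemma Ck_on_1_has_derivative:
  fixes f :: "real^'n \<Rightarrow> real^'n"
  assumes "Ck_on 1 S f" "x \<in> S"
  shows "(f has_derivative (\<lambda>v. jacobian f (at x) *v v)) (at x)"
  using assms by (simp add: jacobian_works[symmetric])

context closed_manifold
begin

definition borelX :: "'a measure" where
  "borelX = sigma (topspace X) {U. openin X U}"

lemma opens_Pow: "{U. openin X U} \<subseteq> Pow (topspace X)"
  by (auto dest: openin_subset)

lemma space_borelX [simp]: "space borelX = topspace X"
  and sets_borelX: "sets borelX = sigma_sets (topspace X) {U. openin X U}"
  unfolding borelX_def using opens_Pow by (auto simp: sets_measure_of)

lemma openin_sets [intro]: "openin X U \<Longrightarrow> U \<in> sets borelX"
  unfolding sets_borelX by auto

lemma chart_dom_sets [intro]: "c \<in> A \<Longrightarrow> fst c \<in> sets borelX"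
  by (intro openin_sets chart_openin)

lemma continuous_map_measurable:
  assumes "continuous_map X X f" shows "f \<in> measurable borelX borelX"
  unfolding borelX_def
proof (rule measurable_sigma_sets[OF _ opens_Pow])
  show "sets (sigma (topspace X) {U. openin X U}) = sigma_sets (topspace X) {U. openin X U}"
    using opens_Pow by (simp add: sets_measure_of)
  have sp: "space (sigma (topspace X) {U. openin X U}) = topspace X" by (simp add: space_measure_of_conv)
  show "f \<in> space (sigma (topspace X) {U. openin X U}) \<rightarrow> topspace X"
    using assms unfolding sp by (auto simp: continuous_map_def)
  fix U assume "U \<in> {U. openin X U}"
  then have "openin X {p \<in> topspace X. f p \<in> U}" using assms by (auto simp: continuous_map_def)
  moreover have "f -` U \<inter> topspace X = {p \<in> topspace X. f p \<in> U}" by auto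
  ultimately show "f -` U \<inter> space (sigma (topspace X) {U. openin X U}) \<in> sets (sigma (topspace X) {U. openin X U})"
    unfolding sp using openin_sets unfolding borelX_def by simp
qed

text \<open>The inverse of the chart, made total by a default point so as to push measures forward.\<close>
definition chart_param :: "('a, 'n) chart \<Rightarrow> (real,'n) vec \<Rightarrow> 'a" where
  "chart_param c x = (if x \<in> snd c ` fst c then chart_inv c x else (SOME p. p \<in> topspace X))"

lemma chart_param_measurable:
  assumes c: "c \<in> A" shows "chart_param c \<in> measurable borel borelX"
proof -
  let ?p = "SOME p. p \<in> topspace X"
  have p: "?p \<in> topspace X" using nonempty someI_ex[of "\<lambda>p. p \<in> topspace X"] by blast
  have "chart_param c \<in> measurable borel (sigma (topspace X) {U. openin X U})"
  proof (rule measurable_measure_of[OF opens_Pow])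
    show "chart_param c \<in> space borel \<rightarrow> topspace X"
      using p chart_inv_top[OF c] by (auto simp: chart_param_def)
    fix U assume "U \<in> {U. openin X U}"
    then have U: "openin X U" by simp
    let ?S = "snd c ` fst c"
    have "open (snd c ` (fst c \<inter> U))"
      using U chart_openin[OF c] by (intro chart_image_open[OF c] openin_Int) auto
    moreover have "chart_param c -` U = snd c ` (fst c \<inter> U) \<union> (if ?p \<in> U then - ?S else {})"
    proof (rule set_eqI)
      fix x
      show "x \<in> chart_param c -` U \<longleftrightarrow> x \<in> snd c ` (fst c \<inter> U) \<union> (if ?p \<in> U then - ?S else {})"
      proof (cases "x \<in> ?S")
        case True
        then obtain q where q: "q \<in> fst c" "x = snd c q" by blast
        then have "x \<in> snd c ` (fst c \<inter> U) \<longleftrightarrow> q \<in> U" using chart_inj[OF c] by (auto dest: inj_onD)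
        moreover have "chart_param c x = q" using q c by (auto simp: chart_param_def)
        ultimately show ?thesis using True by auto
      next
        case False
        then show ?thesis by (auto simp: chart_param_def)
      qed
    qed
    ultimately show "chart_param c -` U \<inter> space borel \<in> sets borel"
      using chart_open_image[OF c] by auto
  qed
  then show ?thesis by (simp add: borelX_def)
qed

lemma chart_image_eq:
  assumes c: "c \<in> A" and B: "B \<subseteq> fst c"
  shows "snd c ` B = chart_param c -` B \<inter> snd c ` fst c"
proof safe
  fix p assume p: "p \<in> B"
  then have pc: "p \<in> fst c" using B by blast
  then have "chart_param c (snd c p) = p" using c by (simp add: chart_param_def)
  then show "snd c p \<in> chart_param c -` B" using p by simp
  show "snd c p \<in> snd c ` fst c" using pc by (rule imageI)
next
  fix p assume p: "p \<in> fst c" "chart_param c (snd c p) \<in> B"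
  then have "p \<in> B" using c by (simp add: chart_param_def)
  then show "snd c p \<in> snd c ` B" by blast
qed

lemma chart_image_borel:
  assumes c: "c \<in> A" and B: "B \<in> sets borelX" "B \<subseteq> fst c" shows "snd c ` B \<in> sets borel"
  unfolding chart_image_eq[OF c B(2)]
  using measurable_sets[OF chart_param_measurable[OF c] B(1)] chart_open_image[OF c] by auto

lemma trans_Ck1:
  assumes "c \<in> A" "d \<in> A" shows "Ck_on 1 (coord_dom c d id) (coord_rep c d id)"
  using atlas assms unfolding smooth_atlas_def smooth_on_def by blast

lemma chart_change_of_variables:
  assumes c: "c \<in> A" and d: "d \<in> A" and F: "Ck_on 1 (coord_dom c d f) (coord_rep c d f)"
    and f: "inj_on f (topspace X)"
    and B: "B \<in> sets borelX" "B \<subseteq> fst c" and fB: "f ` B \<in> sets borelX" "f ` B \<subseteq> fst d"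
    and h: "h \<in> borel_measurable borel"
  shows "(\<integral>\<^sup>+x. indicator (snd d ` f ` B) x * h x \<partial>lborel)
    = (\<integral>\<^sup>+x. ennreal \<bar>det (jacobian (coord_rep c d f) (at x))\<bar> * indicator (snd c ` B) x * h (coord_rep c d f x) \<partial>lborel)"
proof -
  let ?g = "coord_rep c d f" and ?S = "snd c ` B"
  have sub: "?S \<subseteq> coord_dom c d f" unfolding coord_dom_def using B fB by (intro image_mono) auto
  have S: "?S \<in> sets borel" by (rule chart_image_borel[OF c B])
  have gf: "?g (snd c p) = snd d (f p)" if "p \<in> B" for p using that B c by (auto simp: coord_rep_def)
  have im: "?g ` ?S = snd d ` f ` B" using gf by force
  have imb: "?g ` ?S \<in> sets borel" unfolding im by (rule chart_image_borel[OF d fB])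
  have inj: "inj_on ?g ?S"
  proof (rule inj_onI)
    fix x y assume "x \<in> ?S" "y \<in> ?S" and e: "?g x = ?g y"
    then obtain p q where pq: "p \<in> B" "q \<in> B" "x = snd c p" "y = snd c q" by blast
    then have "snd d (f p) = snd d (f q)" using e gf by simp
    then have "f p = f q" using chart_inj[OF d] pq fB(2) by (auto dest!: inj_onD)
    then have "p = q" using f pq B(2) chart_subset[OF c] by (auto dest!: inj_onD)
    then show "x = y" using pq by simp
  qed
  let ?J = "\<lambda>x. ennreal \<bar>det (matrix (\<lambda>v. jacobian ?g (at x) *v v))\<bar> * indicator ?S x"
  have J: "?J \<in> borel_measurable borel"
  proof -
    have "continuous_on ?S (\<lambda>x. ennreal \<bar>det (jacobian ?g (at x))\<bar>)"
      by (intro continuous_on_ennreal continuous_intros continuous_on_subset[OF Ck_on_1_det_continuous[OF F] sub])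
    then have "(\<lambda>x. if x \<in> ?S then ennreal \<bar>det (jacobian ?g (at x))\<bar> else 0) \<in> borel_measurable borel"
      using S by (intro borel_measurable_continuous_on_if) auto
    moreover have "?J = (\<lambda>x. if x \<in> ?S then ennreal \<bar>det (jacobian ?g (at x))\<bar> else 0)"
      by (auto simp: matrix_of_matrix_vector_mul)
    ultimately show ?thesis by simp
  qed
  have "(\<integral>\<^sup>+x. indicator (?g ` ?S) x * h x \<partial>lborel) = (\<integral>\<^sup>+x. ?J x * h (?g x) \<partial>lborel)"
  proof (rule nn_integral_change_of_variables[OF S _ inj imb J h])
    show "(?g has_derivative (\<lambda>v. jacobian ?g (at x) *v v)) (at x within ?S)" if "x \<in> ?S" for x
      by (rule has_derivative_at_withinI[OF Ck_on_1_has_derivative[OF F]]) (use that sub in auto)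
  qed
  then show ?thesis by (simp only: im matrix_of_matrix_vector_mul)
qed

lemma null_image:
  assumes c: "c \<in> A" and d: "d \<in> A" and F: "Ck_on 1 (coord_dom c d f) (coord_rep c d f)"
    and f: "inj_on f (topspace X)"
    and B: "B \<in> sets borelX" "B \<subseteq> fst c" and fB: "f ` B \<in> sets borelX" "f ` B \<subseteq> fst d"
    and null: "emeasure lborel (snd c ` B) = 0"
  shows "emeasure lborel (snd d ` f ` B) = 0"
proof -
  have S: "snd c ` B \<in> sets borel" by (rule chart_image_borel[OF c B])
  have "AE x in lborel. x \<notin> snd c ` B"
    using S null by (intro AE_not_in) (auto simp: null_sets_def)
  then have "(\<integral>\<^sup>+x. ennreal \<bar>det (jacobian (coord_rep c d f) (at x))\<bar> * indicator (snd c ` B) x * 1 \<partial>lborel) = (\<integral>\<^sup>+x. 0 \<partial>(lborel :: (real, 'n) vec measure))"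
    by (intro nn_integral_cong_AE) (auto elim!: eventually_mono)
  moreover have "emeasure lborel (snd d ` f ` B) = (\<integral>\<^sup>+x. indicator (snd d ` f ` B) x * 1 \<partial>lborel)"
    using chart_image_borel[OF d fB] by simp
  ultimately show ?thesis
    unfolding chart_change_of_variables[OF c d F f B fB borel_measurable_const] by simp
qed

end

locale riemannian_manifold = closed_manifold X A
  for X :: "'a topology" and A :: "('a, 'n::{finite,wellorder}) chart set" +
  fixes G :: "('a, 'n) chart \<Rightarrow> 'a \<Rightarrow> ((real, 'n) vec, 'n) vec"
  assumes metric: "riemannian_metric A G"
begin

definition \<rho> :: "('a, 'n) chart \<Rightarrow> (real,'n) vec \<Rightarrow> ennreal" where
  "\<rho> c x = ennreal (sqrt (det (G c (chart_inv c x))))"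

definition vol :: "('a, 'n) chart \<Rightarrow> 'a set \<Rightarrow> ennreal" where
  "vol c B = (\<integral>\<^sup>+x. \<rho> c x * indicator (snd c ` B) x \<partial>lborel)"

lemma det_pos: "c \<in> A \<Longrightarrow> p \<in> fst c \<Longrightarrow> det (G c p) > 0"
  using metric by (intro det_pos_of_positive_definite) (auto simp: riemannian_metric_def)

lemma \<rho>_pos: "c \<in> A \<Longrightarrow> x \<in> snd c ` fst c \<Longrightarrow> \<rho> c x > 0"
  unfolding \<rho>_def using det_pos[OF _ chart_inv_in] by (simp add: ennreal_less_zero_iff)

lemma \<rho>_continuous:
  assumes "c \<in> A" shows "continuous_on (snd c ` fst c) (\<rho> c)"
proof -
  have "Ck_on 0 (snd c ` fst c) (\<lambda>x. G c (chart_inv c x))"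
    using metric assms unfolding riemannian_metric_def smooth_on_def by blast
  then show ?thesis unfolding \<rho>_def[abs_def]
    by (intro continuous_on_ennreal continuous_on_det continuous_intros) simp
qed

lemma \<rho>_measurable:
  assumes "c \<in> A" shows "(\<lambda>x. \<rho> c x * indicator (snd c ` fst c) x) \<in> borel_measurable borel"
proof -
  have "(\<lambda>x. if x \<in> snd c ` fst c then \<rho> c x else 0) \<in> borel_measurable borel"
    using chart_open_image[OF assms] \<rho>_continuous[OF assms] by (intro borel_measurable_continuous_on_if) auto
  moreover have "(\<lambda>x. if x \<in> snd c ` fst c then \<rho> c x else 0) = (\<lambda>x. \<rho> c x * indicator (snd c ` fst c) x)" by auto
  ultimately show ?thesis by simp
qed

definition vol_measure :: "('a, 'n) chart \<Rightarrow> 'a measure" where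
  "vol_measure c = distr (density lborel (\<lambda>x. \<rho> c x * indicator (snd c ` fst c) x)) borelX (chart_param c)"

lemma vol_measure:
  assumes c: "c \<in> A" and B: "B \<in> sets borelX" shows "emeasure (vol_measure c) B = vol c (B \<inter> fst c)"
proof -
  have Bs: "chart_param c -` B \<in> sets borel"
    using measurable_sets[OF chart_param_measurable[OF c] B] by simp
  have "emeasure (vol_measure c) B = emeasure (density lborel (\<lambda>x. \<rho> c x * indicator (snd c ` fst c) x)) (chart_param c -` B)"
    unfolding vol_measure_def using chart_param_measurable[OF c] B by (subst emeasure_distr) auto
  also have "\<dots> = (\<integral>\<^sup>+x. \<rho> c x * indicator (snd c ` fst c) x * indicator (chart_param c -` B) x \<partial>lborel)"
    using \<rho>_measurable[OF c] Bs by (subst emeasure_density) auto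
  also have "\<dots> = vol c (B \<inter> fst c)"
    unfolding vol_def
  proof (intro nn_integral_cong)
    fix x
    have "snd c ` (B \<inter> fst c) = chart_param c -` (B \<inter> fst c) \<inter> snd c ` fst c"
      by (rule chart_image_eq[OF c]) auto
    moreover have "chart_param c x \<in> fst c" if "x \<in> snd c ` fst c" using that by (simp add: chart_param_def chart_inv_in)
    ultimately show "\<rho> c x * indicator (snd c ` fst c) x * indicator (chart_param c -` B) x = \<rho> c x * indicator (snd c ` (B \<inter> fst c)) x"
      by (auto split: split_indicator)
  qed
  finally show ?thesis .
qed

lemma sets_vol_measure: "sets (vol_measure c) = sets borelX" by (simp add: vol_measure_def)

text \<open>The transformation law gives \<open>det G\<^sub>c = (det J)\<^sup>2 det G\<^sub>d\<close>, and the square root of this is the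
  factor in the change of variables.\<close>
lemma vol_change_chart:
  assumes c: "c \<in> A" and d: "d \<in> A" and B: "B \<in> sets borelX" "B \<subseteq> fst c" "B \<subseteq> fst d"
  shows "vol c B = vol d B"
proof -
  let ?g = "coord_rep c d id" and ?S = "snd c ` B"
  have gf: "?g (snd c p) = snd d p" if "p \<in> B" for p using that B c by (auto simp: coord_rep_def)
  have "vol d B = (\<integral>\<^sup>+x. indicator (snd d ` id ` B) x * (\<rho> d x * indicator (snd d ` fst d) x) \<partial>lborel)"
    unfolding vol_def using B by (intro nn_integral_cong) (auto split: split_indicator)
  also have "\<dots> = (\<integral>\<^sup>+x. ennreal \<bar>det (jacobian ?g (at x))\<bar> * indicator ?S x * (\<rho> d (?g x) * indicator (snd d ` fst d) (?g x)) \<partial>lborel)"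
    by (rule chart_change_of_variables[OF c d trans_Ck1[OF c d] _ B(1,2) _ _ \<rho>_measurable[OF d]]) (use B in auto)
  also have "\<dots> = vol c B"
    unfolding vol_def
  proof (rule nn_integral_cong)
    fix x
    show "ennreal \<bar>det (jacobian ?g (at x))\<bar> * indicator ?S x * (\<rho> d (?g x) * indicator (snd d ` fst d) (?g x)) = \<rho> c x * indicator ?S x"
    proof (cases "x \<in> ?S")
      case True
      then obtain p where p: "p \<in> B" "x = snd c p" by blast
      let ?M = "jacobian ?g (at x)"
      have "G c p = transpose ?M ** G d p ** ?M"
        using metric c d p B unfolding riemannian_metric_def Let_def by blast
      then have "det (G c p) = (det ?M)^2 * det (G d p)"
        by (simp add: det_mul det_transpose power2_eq_square)
      then have "sqrt (det (G c p)) = \<bar>det ?M\<bar> * sqrt (det (G d p))"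
        by (simp add: real_sqrt_mult)
      moreover have "\<rho> c x = ennreal (sqrt (det (G c p)))" "\<rho> d (?g x) = ennreal (sqrt (det (G d p)))"
        unfolding \<rho>_def using p B c d gf[OF p(1)] by auto
      moreover have "?g x \<in> snd d ` fst d" using p gf[OF p(1)] B by auto
      ultimately show ?thesis
        using True det_pos[OF d, of p] p B by (auto simp: ennreal_mult)
    qed simp
  qed
  finally show ?thesis by simp
qed

lemma finite_chart_cover:
  obtains cs where "set cs \<subseteq> A" "(\<Union>c\<in>set cs. fst c) = topspace X"
proof -
  have "\<exists>\<F>. finite \<F> \<and> \<F> \<subseteq> fst ` A \<and> topspace X \<subseteq> \<Union>\<F>"
    using compact chart_openin chart_exists unfolding compact_space_def
    by (intro compactinD) auto
  then obtain \<F> where F: "finite \<F>" "\<F> \<subseteq> fst ` A" "topspace X \<subseteq> \<Union>\<F>" by blast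
  then obtain C where C: "C \<subseteq> A" "finite C" "\<F> = fst ` C" by (meson finite_subset_image)
  obtain cs where "set cs = C" using C finite_list by blast
  then show thesis using C F chart_subset by (intro that[of cs]) blast+
qed

text \<open>Cut the manifold into finitely many measurable pieces, each inside one chart, and add up the coordinate
  volumes. The result is correct in every chart by \<open>vol_change_chart\<close>.\<close>
lemma riemannian_volume_exists_unique: "\<exists>!\<nu>. is_riemannian_volume X A G \<nu>"
proof -
  obtain cs where cs: "set cs \<subseteq> A" "(\<Union>c\<in>set cs. fst c) = topspace X" by (rule finite_chart_cover)
  let ?n = "length cs"
  have csA: "cs ! i \<in> A" if "i < ?n" for i using that cs by auto
  \<comment> \<open>The \<open>i\<close>-th piece consists of the points for which \<open>i\<close> is the first chart of the list.\<close>
  define P where "P = (\<lambda>i. fst (cs ! i) - (\<Union>j<i. fst (cs ! j)))"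
  have Psets: "P i \<in> sets borelX" if "i < ?n" for i
    unfolding P_def using csA that by (intro sets.Diff sets.finite_UN) auto
  have Psub: "P i \<subseteq> fst (cs ! i)" for i unfolding P_def by auto
  have Pdisj: "disjoint_family_on (\<lambda>i. B \<inter> P i) {..<?n}" for B
    unfolding disjoint_family_on_def
  proof (intro ballI impI)
    fix m n :: nat assume "m \<noteq> n"
    then have "m < n \<or> n < m" by auto
    then show "(B \<inter> P m) \<inter> (B \<inter> P n) = {}" by (auto simp: P_def)
  qed
  have Pcov: "(\<Union>i<?n. B \<inter> P i) = B" if "B \<subseteq> topspace X" for B
  proof
    show "B \<subseteq> (\<Union>i<?n. B \<inter> P i)"
    proof
      fix p assume p: "p \<in> B"
      then have "p \<in> (\<Union>c\<in>set cs. fst c)" using cs(2) that by blast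
      then obtain c where c: "c \<in> set cs" "p \<in> fst c" by blast
      then obtain i where "i < ?n" "cs ! i = c" by (auto simp: in_set_conv_nth)
      with c have "\<exists>i. i < ?n \<and> p \<in> fst (cs ! i)" by (intro exI[of _ i]) simp
      then obtain i where i: "i < ?n \<and> p \<in> fst (cs ! i)" "\<forall>j<i. \<not> (j < ?n \<and> p \<in> fst (cs ! j))"
        unfolding exists_least_iff[of "\<lambda>i. i < ?n \<and> p \<in> fst (cs ! i)"] by blast
      then have "p \<notin> fst (cs ! j)" if "j < i" for j using that by (meson order.strict_trans)
      then have "p \<in> B \<inter> P i" using p i unfolding P_def by blast
      then show "p \<in> (\<Union>i<?n. B \<inter> P i)" using i by blast
    qed
  qed auto
  have split: "emeasure M B = (\<Sum>i<?n. emeasure M (B \<inter> P i))"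
    if "sets M = sets borelX" "B \<in> sets borelX" for M B
  proof -
    have "(\<Sum>i<?n. emeasure M (B \<inter> P i)) = emeasure M (\<Union>i<?n. B \<inter> P i)"
      using that Psets Pdisj by (intro sum_emeasure) auto
    moreover have "B \<subseteq> topspace X" using sets.sets_into_space[OF that(2)] by simp
    ultimately show ?thesis using Pcov by simp
  qed
  define N where "N = (\<lambda>B. \<Sum>i<?n. emeasure (vol_measure (cs ! i)) (B \<inter> P i))"
  define \<nu> where "\<nu> = measure_of (topspace X) (sets borelX) N"
  have Pow: "sets borelX \<subseteq> Pow (topspace X)" using sets.space_closed[of borelX] by simp
  have sets_\<nu>: "sets \<nu> = sets borelX"
    unfolding \<nu>_def using sets.sigma_sets_eq[of borelX] Pow by simp
  have sa: "sigma_algebra (topspace X) (sets borelX)" using sets.sigma_algebra_axioms[of borelX] by simp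
  have emeasure_\<nu>: "emeasure \<nu> B = N B" if "B \<in> sets borelX" for B
  proof (rule emeasure_measure_of_sigma[OF sa, of N B, folded \<nu>_def])
    show "positive (sets borelX) N" by (simp add: positive_def N_def)
    show "countably_additive (sets borelX) N"
    proof (rule countably_additiveI)
      fix Bs :: "nat \<Rightarrow> 'a set" assume Bs: "range Bs \<subseteq> sets borelX" "disjoint_family Bs"
      have "(\<Sum>k. N (Bs k)) = (\<Sum>i<?n. \<Sum>k. emeasure (vol_measure (cs ! i)) (Bs k \<inter> P i))"
        unfolding N_def by (rule suminf_sum) auto
      also have "\<dots> = (\<Sum>i<?n. emeasure (vol_measure (cs ! i)) (\<Union>k. Bs k \<inter> P i))"
      proof (intro sum.cong refl suminf_emeasure)
        fix i assume "i \<in> {..<?n}"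
        then show "range (\<lambda>k. Bs k \<inter> P i) \<subseteq> sets (vol_measure (cs ! i))"
          using Bs Psets by (auto simp: sets_vol_measure)
        show "disjoint_family (\<lambda>k. Bs k \<inter> P i)" using Bs(2) unfolding disjoint_family_on_def by blast
      qed
      also have "\<dots> = N (\<Union>k. Bs k)" unfolding N_def by simp
      finally show "(\<Sum>k. N (Bs k)) = N (\<Union>k. Bs k)" .
    qed
  qed (use that in auto)
  have vol_piece: "emeasure (vol_measure (cs ! i)) (B \<inter> P i) = vol c (B \<inter> P i)"
    if "i < ?n" "c \<in> A" "B \<in> sets borelX" "B \<subseteq> fst c" for i c B
  proof -
    have "B \<inter> P i \<in> sets borelX" using that Psets by auto
    then have "emeasure (vol_measure (cs ! i)) (B \<inter> P i) = vol (cs ! i) (B \<inter> P i \<inter> fst (cs ! i))"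
      by (rule vol_measure[OF csA[OF that(1)]])
    also have "B \<inter> P i \<inter> fst (cs ! i) = B \<inter> P i" using Psub by auto
    also have "vol (cs ! i) (B \<inter> P i) = vol c (B \<inter> P i)"
      using \<open>B \<inter> P i \<in> _\<close> csA[OF that(1)] that Psub by (intro vol_change_chart) auto
    finally show ?thesis .
  qed
  have ex: "is_riemannian_volume X A G \<nu>"
    unfolding is_riemannian_volume_def
  proof (intro conjI ballI impI)
    show "space \<nu> = topspace X" unfolding \<nu>_def using Pow by (simp add: space_measure_of)
    show "sets \<nu> = sigma_sets (topspace X) {U. openin X U}" unfolding sets_\<nu> by (rule sets_borelX)
    fix c B assume c: "c \<in> A" and B: "B \<in> sets \<nu>" "B \<subseteq> fst c"
    then have Bb: "B \<in> sets borelX" by (simp add: sets_\<nu>)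
    have "emeasure \<nu> B = (\<Sum>i<?n. vol c (B \<inter> P i))"
      unfolding emeasure_\<nu>[OF Bb] N_def by (intro sum.cong refl vol_piece c Bb B) auto
    also have "\<dots> = (\<Sum>i<?n. emeasure (vol_measure c) (B \<inter> P i))"
    proof (intro sum.cong refl)
      fix i assume "i \<in> {..<?n}"
      then have "B \<inter> P i \<in> sets borelX" using Bb Psets by auto
      moreover have "B \<inter> P i \<inter> fst c = B \<inter> P i" using B by auto
      ultimately show "vol c (B \<inter> P i) = emeasure (vol_measure c) (B \<inter> P i)" using vol_measure[OF c, of "B \<inter> P i"] by simp
    qed
    also have "\<dots> = emeasure (vol_measure c) B" by (rule split[symmetric, OF sets_vol_measure Bb])
    also have "\<dots> = vol c (B \<inter> fst c)" by (rule vol_measure[OF c Bb])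
    also have "B \<inter> fst c = B" using B by auto
    finally show "emeasure \<nu> B = (\<integral>\<^sup>+x\<in>snd c ` B. ennreal (sqrt (det (G c (chart_inv c x)))) \<partial>lborel)"
      unfolding vol_def \<rho>_def .
  qed
  have vol_eq: "emeasure \<nu>' B = vol c B"
    if "is_riemannian_volume X A G \<nu>'" "c \<in> A" "B \<in> sets \<nu>'" "B \<subseteq> fst c" for \<nu>' c B
    using that unfolding is_riemannian_volume_def vol_def \<rho>_def by blast
  have uniq: "\<nu>1 = \<nu>2" if 1: "is_riemannian_volume X A G \<nu>1" and 2: "is_riemannian_volume X A G \<nu>2" for \<nu>1 \<nu>2
  proof (rule measure_eqI)
    have s1: "sets \<nu>1 = sets borelX" and s2: "sets \<nu>2 = sets borelX"
      using 1 2 by (auto simp: is_riemannian_volume_def sets_borelX)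
    then show "sets \<nu>1 = sets \<nu>2" by simp
    fix B assume "B \<in> sets \<nu>1"
    then have B: "B \<in> sets borelX" using s1 by simp
    have "emeasure \<nu>1 (B \<inter> P i) = emeasure \<nu>2 (B \<inter> P i)" if "i < ?n" for i
    proof -
      have "B \<inter> P i \<in> sets borelX" using B Psets[OF that] by auto
      moreover have "B \<inter> P i \<subseteq> fst (cs ! i)" using Psub by auto
      ultimately show ?thesis
        using vol_eq[OF 1 csA[OF that]] vol_eq[OF 2 csA[OF that]] s1 s2 by simp
    qed
    then show "emeasure \<nu>1 B = emeasure \<nu>2 B"
      unfolding split[OF s1 B] split[OF s2 B] by simp
  qed
  show ?thesis by (rule ex1I[of "is_riemannian_volume X A G" \<nu>, OF ex]) (rule uniq[OF _ ex])
qed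

abbreviation \<nu> :: "'a measure" where "\<nu> \<equiv> riemannian_volume X A G"
abbreviation \<mu> :: "'a measure" where "\<mu> \<equiv> normalized_volume X A G"

lemma is_vol: "is_riemannian_volume X A G \<nu>"
  unfolding riemannian_volume_def by (rule theI'[OF riemannian_volume_exists_unique])

lemma sets_\<nu>: "sets \<nu> = sets borelX" and space_\<nu>: "space \<nu> = topspace X"
  using is_vol by (auto simp: is_riemannian_volume_def sets_borelX)

lemma emeasure_\<nu>: "c \<in> A \<Longrightarrow> B \<in> sets borelX \<Longrightarrow> B \<subseteq> fst c \<Longrightarrow> emeasure \<nu> B = vol c B"
  using is_vol unfolding is_riemannian_volume_def vol_def \<rho>_def sets_borelX by blast

lemma \<nu>_null_iff:
  assumes c: "c \<in> A" and B: "B \<in> sets borelX" "B \<subseteq> fst c"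
  shows "emeasure \<nu> B = 0 \<longleftrightarrow> emeasure lborel (snd c ` B) = 0"
proof -
  have S: "snd c ` B \<in> sets borel" by (rule chart_image_borel[OF c B])
  have m: "(\<lambda>x. \<rho> c x * indicator (snd c ` B) x) \<in> borel_measurable borel"
  proof -
    have "(\<lambda>x. (\<rho> c x * indicator (snd c ` fst c) x) * indicator (snd c ` B) x) \<in> borel_measurable borel"
      using \<rho>_measurable[OF c] S by auto
    moreover have "(\<lambda>x. (\<rho> c x * indicator (snd c ` fst c) x) * indicator (snd c ` B) x) = (\<lambda>x. \<rho> c x * indicator (snd c ` B) x)"
      using B by (auto simp: fun_eq_iff split: split_indicator)
    ultimately show ?thesis by simp
  qed
  have "emeasure \<nu> B = 0 \<longleftrightarrow> (AE x in lborel. \<rho> c x * indicator (snd c ` B) x = 0)"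
    unfolding emeasure_\<nu>[OF c B] vol_def using m by (subst nn_integral_0_iff_AE) auto
  also have "\<dots> \<longleftrightarrow> (AE x in lborel. x \<notin> snd c ` B)"
  proof (rule AE_cong)
    fix x
    show "\<rho> c x * indicator (snd c ` B) x = 0 \<longleftrightarrow> x \<notin> snd c ` B"
      using \<rho>_pos[OF c, of x] B by (cases "x \<in> snd c ` B") auto
  qed
  also have "\<dots> \<longleftrightarrow> emeasure lborel (snd c ` B) = 0"
    using S AE_iff_null_sets[of "snd c ` B" lborel] by (auto simp: null_sets_def)
  finally show ?thesis .
qed

lemma \<nu>_finite: "emeasure \<nu> (topspace X) < \<top>"
proof -
  have "\<exists>V. openin X V \<and> p \<in> V \<and> emeasure \<nu> V < \<top>" if p: "p \<in> topspace X" for p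
  proof -
    obtain c where c: "c \<in> A" "p \<in> fst c" using chart_exists[OF p] by blast
    obtain e where e: "e > 0" "cball (snd c p) e \<subseteq> snd c ` fst c"
      using chart_open_image[OF c(1)] c(2) by (meson open_contains_cball image_eqI)
    define V where "V = {q \<in> fst c. snd c q \<in> ball (snd c p) e}"
    have V: "openin X V" unfolding V_def by (rule chart_preimage_open[OF c(1)]) simp
    have "\<rho> c = (\<lambda>x. ennreal (sqrt (det (G c (chart_inv c x)))))" by (auto simp: \<rho>_def)
    have "Ck_on 0 (snd c ` fst c) (\<lambda>x. G c (chart_inv c x))"
      using metric c unfolding riemannian_metric_def smooth_on_def by blast
    then have "continuous_on (cball (snd c p) e) (\<lambda>x. sqrt (det (G c (chart_inv c x))))"
      using e by (intro continuous_on_det continuous_intros) (auto intro: continuous_on_subset)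
    then have "bounded ((\<lambda>x. sqrt (det (G c (chart_inv c x)))) ` cball (snd c p) e)"
      by (intro compact_imp_bounded compact_continuous_image) auto
    then have "\<exists>M. \<forall>x\<in>cball (snd c p) e. \<bar>sqrt (det (G c (chart_inv c x)))\<bar> \<le> M" by (auto simp: bounded_iff)
    then obtain M where M: "\<And>x. x \<in> cball (snd c p) e \<Longrightarrow> \<bar>sqrt (det (G c (chart_inv c x)))\<bar> \<le> M" by blast
    have "emeasure \<nu> V = vol c V" by (rule emeasure_\<nu>[OF c(1) openin_sets[OF V]]) (auto simp: V_def)
    also have "\<dots> \<le> (\<integral>\<^sup>+x. ennreal M * indicator (cball (snd c p) e) x \<partial>lborel)"
      unfolding vol_def
    proof (rule nn_integral_mono)
      fix x
      show "\<rho> c x * indicator (snd c ` V) x \<le> ennreal M * indicator (cball (snd c p) e) x"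
      proof (cases "x \<in> snd c ` V")
        case True
        then have x: "x \<in> cball (snd c p) e" by (auto simp: V_def)
        then have "\<rho> c x \<le> ennreal M" unfolding \<rho>_def using M[OF x] by (intro ennreal_leI) linarith
        then show ?thesis using True x by simp
      qed simp
    qed
    also have "\<dots> < \<top>"
      using emeasure_lborel_cball_finite[of "snd c p" e]
      by (auto simp: nn_integral_cmult_indicator ennreal_mult_eq_top_iff less_top[symmetric])
    finally show ?thesis using V c e by (intro exI[of _ V]) (auto simp: V_def)
  qed
  then obtain V where V: "\<And>p. p \<in> topspace X \<Longrightarrow> openin X (V p) \<and> p \<in> V p \<and> emeasure \<nu> (V p) < \<top>" by metis
  obtain Q where Q: "Q \<subseteq> topspace X" "finite Q" "topspace X \<subseteq> (\<Union>p\<in>Q. V p)"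
    using finite_subcover[of V] V by blast
  have s: "V ` Q \<subseteq> sets \<nu>" using V Q openin_sets by (auto simp: sets_\<nu>)
  have "emeasure \<nu> (topspace X) \<le> emeasure \<nu> (\<Union>p\<in>Q. V p)"
    using Q s by (intro emeasure_mono) auto
  also have "\<dots> \<le> (\<Sum>p\<in>Q. emeasure \<nu> (V p))" using s Q by (intro emeasure_subadditive_finite) auto
  also have "\<dots> < \<top>"
    using Q V by (auto simp: subset_iff)
  finally show ?thesis .
qed

lemma \<nu>_pos: "emeasure \<nu> (topspace X) > 0"
proof (rule ccontr)
  assume "\<not> ?thesis"
  then have z: "emeasure \<nu> (topspace X) = 0" by (simp add: not_gr_zero)
  obtain p c where c: "c \<in> A" "p \<in> fst c" using nonempty chart_exists by blast
  have "emeasure \<nu> (fst c) \<le> emeasure \<nu> (topspace X)"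
    using chart_subset[OF c(1)] chart_dom_sets[OF c(1)] sets.top[of borelX] by (intro emeasure_mono) (auto simp: sets_\<nu>)
  then have "emeasure lborel (snd c ` fst c) = 0"
    using z \<nu>_null_iff[OF c(1) chart_dom_sets[OF c(1)]] by auto
  then have "negligible (snd c ` fst c)"
    using chart_open_image[OF c(1)] by (simp add: negligible_iff_null_sets null_sets_def)
  then show False using open_not_negligible[OF chart_open_image[OF c(1)]] c by blast
qed

lemma sets_\<mu>: "sets \<mu> = sets borelX" and space_\<mu>: "space \<mu> = topspace X"
  unfolding normalized_volume_def by (auto simp: sets_\<nu> space_\<nu>)

lemma prob_\<mu>: "prob_space \<mu>"
  unfolding normalized_volume_def
  by (rule prob_space_uniform_measure) (use \<nu>_pos \<nu>_finite in auto)

lemma \<mu>_null_iff_\<nu>: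
  assumes B: "B \<in> sets borelX" shows "emeasure \<mu> B = 0 \<longleftrightarrow> emeasure \<nu> B = 0"
proof -
  have "topspace X \<inter> B = B" using sets.sets_into_space[OF B] by auto
  moreover have "topspace X \<in> sets \<nu>" using sets.top[of borelX] by (simp add: sets_\<nu>)
  ultimately have "emeasure \<mu> B = emeasure \<nu> B / emeasure \<nu> (topspace X)"
    unfolding normalized_volume_def using B by (simp add: sets_\<nu>)
  then show ?thesis using \<nu>_pos \<nu>_finite by (auto simp: ennreal_divide_eq_0_iff)
qed

lemma \<mu>_null_iff:
  assumes "c \<in> A" "B \<in> sets borelX" "B \<subseteq> fst c"
  shows "emeasure \<mu> B = 0 \<longleftrightarrow> emeasure lborel (snd c ` B) = 0"
  using assms \<mu>_null_iff_\<nu> \<nu>_null_iff by simp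

end

section \<open>Null sets, sets of full measure and transport\<close>

context riemannian_manifold
begin

definition inverse_pair :: "('a \<Rightarrow> 'a) \<Rightarrow> ('a \<Rightarrow> 'a) \<Rightarrow> bool" where
  "inverse_pair f g \<longleftrightarrow> (\<exists>\<alpha>. C1a_map X A \<alpha> f \<and> C1a_map X A \<alpha> g) \<and>
     (\<forall>p\<in>topspace X. g (f p) = p \<and> f (g p) = p)"

lemma inverse_pair_sym: "inverse_pair f g \<Longrightarrow> inverse_pair g f"
  unfolding inverse_pair_def by blast

lemma C1a_diffeo_inverse_pair:
  assumes f: "f \<in> C1a_diffeo X A \<alpha>" shows "inverse_pair f (inv_into (topspace X) f)"
proof -
  have bij: "bij_betw f (topspace X) (topspace X)" using f by (simp add: C1a_diffeo_def)
  have "inv_into (topspace X) f (f p) = p \<and> f (inv_into (topspace X) f p) = p" if "p \<in> topspace X" for p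
    using bij that by (simp add: bij_betw_inv_into_left bij_betw_inv_into_right)
  then show ?thesis using f unfolding inverse_pair_def C1a_diffeo_def by blast
qed

lemma inverse_pair_continuous: "inverse_pair f g \<Longrightarrow> continuous_map X X f"
  by (auto simp: inverse_pair_def C1a_map_def)

lemma inverse_pair_maps: "inverse_pair f g \<Longrightarrow> p \<in> topspace X \<Longrightarrow> f p \<in> topspace X"
  using inverse_pair_continuous[of f g] by (auto simp: continuous_map_def)

lemma inverse_pair_inv: "inverse_pair f g \<Longrightarrow> p \<in> topspace X \<Longrightarrow> g (f p) = p"
  by (auto simp: inverse_pair_def)

lemma inverse_pair_measurable: "inverse_pair f g \<Longrightarrow> f \<in> measurable borelX borelX"
  by (rule continuous_map_measurable[OF inverse_pair_continuous])

lemma inverse_pair_image: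
  assumes fg: "inverse_pair f g" and B: "B \<subseteq> topspace X" shows "g ` B = f -` B \<inter> topspace X"
proof (intro equalityI subsetI)
  fix q assume "q \<in> g ` B"
  then obtain p where p: "p \<in> B" "p \<in> topspace X" "q = g p" using B by blast
  show "q \<in> f -` B \<inter> topspace X"
    using p inverse_pair_inv[OF inverse_pair_sym[OF fg] p(2)] inverse_pair_maps[OF inverse_pair_sym[OF fg] p(2)] by simp
next
  fix p assume "p \<in> f -` B \<inter> topspace X"
  then have p: "f p \<in> B" "p \<in> topspace X" by auto
  show "p \<in> g ` B" by (rule image_eqI[OF _ p(1)]) (simp add: inverse_pair_inv[OF fg p(2)])
qed

lemma sets_subset: "B \<in> sets borelX \<Longrightarrow> B \<subseteq> topspace X"
  using sets.sets_into_space[of B borelX] by simp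

lemma preimage_sets: "inverse_pair f g \<Longrightarrow> B \<in> sets borelX \<Longrightarrow> f -` B \<inter> topspace X \<in> sets borelX"
  using measurable_sets[OF inverse_pair_measurable, of f g B] by simp

lemma \<mu>_null_subset:
  "emeasure \<mu> N = 0 \<Longrightarrow> N \<in> sets borelX \<Longrightarrow> M \<subseteq> N \<Longrightarrow> emeasure \<mu> M = 0"
  using emeasure_mono[of M N \<mu>] by (simp add: sets_\<mu>)

text \<open>The preimage is the image under the inverse map \<open>g\<close>. In coordinates \<open>g\<close> is \<open>C\<^sup>1\<close> on finitely many pieces.\<close>
lemma null_preimage:
  assumes fg: "inverse_pair f g" and N: "N \<in> sets borelX" "emeasure \<mu> N = 0"
  shows "emeasure \<mu> (f -` N \<inter> topspace X) = 0"
proof -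
  note gf = inverse_pair_sym[OF fg]
  obtain cs where cs: "set cs \<subseteq> A" "(\<Union>c\<in>set cs. fst c) = topspace X" by (rule finite_chart_cover)
  define M :: "('a, 'n) chart \<times> ('a, 'n) chart \<Rightarrow> 'a set"
    where "M = (\<lambda>(c, d). N \<inter> fst c \<inter> (g -` fst d \<inter> topspace X))"
  have Ms: "M (c, d) \<in> sets borelX" if "c \<in> set cs" "d \<in> set cs" for c d
  proof -
    have "c \<in> A" "d \<in> A" using that cs(1) by auto
    then show ?thesis unfolding M_def prod.case
      by (intro sets.Int N(1) chart_dom_sets preimage_sets[OF gf])
  qed
  have im: "g ` M (c, d) = f -` M (c, d) \<inter> topspace X" if "c \<in> set cs" "d \<in> set cs" for c d
    by (rule inverse_pair_image[OF fg sets_subset[OF Ms[OF that]]])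
  have gM: "g ` M (c, d) \<in> sets borelX" if "c \<in> set cs" "d \<in> set cs" for c d
    unfolding im[OF that] by (rule preimage_sets[OF fg Ms[OF that]])
  have null: "emeasure \<mu> (g ` M (c, d)) = 0" if cd: "c \<in> set cs" "d \<in> set cs" for c d
  proof -
    have c: "c \<in> A" and d: "d \<in> A" using cd cs by auto
    have sub: "g ` M (c, d) \<subseteq> fst d" "M (c, d) \<subseteq> fst c" by (auto simp: M_def)
    have "emeasure \<mu> (M (c, d)) = 0" by (rule \<mu>_null_subset[OF N(2,1)]) (auto simp: M_def)
    then have z: "emeasure lborel (snd c ` M (c, d)) = 0" using \<mu>_null_iff[OF c Ms[OF cd] sub(2)] by simp
    have inj: "inj_on g (topspace X)" using inverse_pair_inv[OF gf] by (auto intro: inj_on_inverseI)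
    have F: "Ck_on 1 (coord_dom c d g) (coord_rep c d g)"
      using gf c d unfolding inverse_pair_def C1a_map_def Let_def by blast
    have "emeasure lborel (snd d ` g ` M (c, d)) = 0"
      by (rule null_image[OF c d F inj Ms[OF cd] sub(2) gM[OF cd] sub(1) z])
    then show ?thesis using \<mu>_null_iff[OF d gM[OF cd] sub(1)] by simp
  qed
  have "f -` N \<inter> topspace X \<subseteq> (\<Union>cd\<in>set cs \<times> set cs. g ` M cd)"
  proof
    fix p assume p: "p \<in> f -` N \<inter> topspace X"
    then have pp: "f p \<in> N" "f p \<in> topspace X" "p \<in> topspace X" "g (f p) = p"
      using inverse_pair_maps[OF fg] inverse_pair_inv[OF fg] by auto
    obtain c d where "c \<in> set cs" "f p \<in> fst c" "d \<in> set cs" "p \<in> fst d" using pp cs(2) by blast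
    then have "(c, d) \<in> set cs \<times> set cs" "f p \<in> M (c, d)" using pp by (auto simp: M_def)
    then show "p \<in> (\<Union>cd\<in>set cs \<times> set cs. g ` M cd)" using pp(4) by (metis UN_I image_eqI)
  qed
  moreover have "emeasure \<mu> (\<Union>cd\<in>set cs \<times> set cs. g ` M cd) = 0"
  proof -
    have s: "(\<lambda>cd. g ` M cd) ` (set cs \<times> set cs) \<subseteq> sets \<mu>" using gM by (auto simp: sets_\<mu>)
    have "emeasure \<mu> (\<Union>cd\<in>set cs \<times> set cs. g ` M cd) \<le> (\<Sum>cd\<in>set cs \<times> set cs. emeasure \<mu> (g ` M cd))"
      using s by (intro emeasure_subadditive_finite) auto
    also have "\<dots> = 0" using null by (intro sum.neutral) auto
    finally show ?thesis by simp
  qed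
  moreover have "(\<Union>cd\<in>set cs \<times> set cs. g ` M cd) \<in> sets borelX" using gM by auto
  ultimately show ?thesis using \<mu>_null_subset by blast
qed

lemma quasi_invariant_diffeos:
  assumes S: "S \<subseteq> C1a_diffeo X A \<alpha>" shows "quasi_invariant (group_generators X S) \<mu>"
proof -
  have q: "f \<in> measurable \<mu> \<mu> \<and> absolutely_continuous \<mu> (distr \<mu> \<mu> f)" if fg: "inverse_pair f g" for f g
  proof
    show m: "f \<in> measurable \<mu> \<mu>"
      using inverse_pair_measurable[OF fg] by (simp cong: measurable_cong_sets add: sets_\<mu>)
    show "absolutely_continuous \<mu> (distr \<mu> \<mu> f)"
      unfolding absolutely_continuous_def
    proof
      fix N assume "N \<in> null_sets \<mu>"
      then have N: "N \<in> sets borelX" "emeasure \<mu> N = 0" by (auto simp: sets_\<mu>)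
      then have "emeasure (distr \<mu> \<mu> f) N = 0"
        using null_preimage[OF fg N] m by (subst emeasure_distr) (auto simp: sets_\<mu> space_\<mu>)
      then show "N \<in> null_sets (distr \<mu> \<mu> f)" using N by (auto simp: sets_\<mu>)
    qed
  qed
  show ?thesis
    unfolding quasi_invariant_def group_generators_def
  proof
    fix f assume "f \<in> S \<union> (\<lambda>g. inv_into (topspace X) g) ` S"
    then have "\<exists>g. inverse_pair f g"
      using C1a_diffeo_inverse_pair inverse_pair_sym S by blast
    then show "f \<in> measurable \<mu> \<mu> \<and> absolutely_continuous \<mu> (distr \<mu> \<mu> f)" using q by blast
  qed
qed

text \<open>The points near which almost every point belongs to \<open>B\<close>.\<close>
definition full :: "'a set \<Rightarrow> 'a set" where
  "full B = {p \<in> topspace X. \<exists>V. openin X V \<and> p \<in> V \<and> emeasure \<mu> (V - B) = 0}"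

lemma open_subset_full: "openin X V \<Longrightarrow> emeasure \<mu> (V - B) = 0 \<Longrightarrow> V \<subseteq> full B"
  unfolding full_def using openin_subset by blast

lemma full_eq_topspace:
  assumes B: "B \<in> sets borelX" and f: "topspace X \<subseteq> full B" shows "emeasure \<mu> (topspace X - B) = 0"
proof -
  have "\<exists>V. openin X V \<and> p \<in> V \<and> emeasure \<mu> (V - B) = 0" if "p \<in> topspace X" for p
    using f that unfolding full_def by blast
  then obtain V where V: "\<And>p. p \<in> topspace X \<Longrightarrow> openin X (V p) \<and> p \<in> V p \<and> emeasure \<mu> (V p - B) = 0" by metis
  obtain Q where Q: "Q \<subseteq> topspace X" "finite Q" "topspace X \<subseteq> (\<Union>p\<in>Q. V p)"
    using finite_subcover[of V] V by blast
  have s: "(\<lambda>p. V p - B) ` Q \<subseteq> sets \<mu>" using V Q openin_sets B by (auto simp: sets_\<mu>)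
  have "emeasure \<mu> (topspace X - B) \<le> emeasure \<mu> (\<Union>p\<in>Q. V p - B)"
  proof (rule emeasure_mono)
    show "topspace X - B \<subseteq> (\<Union>p\<in>Q. V p - B)" using Q by blast
    show "(\<Union>p\<in>Q. V p - B) \<in> sets \<mu>" using s Q by (intro sets.finite_UN) auto
  qed
  also have "\<dots> \<le> (\<Sum>p\<in>Q. emeasure \<mu> (V p - B))" using s Q by (intro emeasure_subadditive_finite) auto
  also have "\<dots> = 0" using V Q by (intro sum.neutral) auto
  finally show ?thesis by simp
qed

lemma full_preimage:
  assumes fg: "inverse_pair f g" and B: "B \<in> sets borelX" and inv: "f -` B \<inter> topspace X = B"
    and p: "p \<in> topspace X" "f p \<in> full B"
  shows "p \<in> full B"
proof -
  obtain V where V: "openin X V" "f p \<in> V" "emeasure \<mu> (V - B) = 0" using p(2) unfolding full_def by blast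
  have "openin X (f -` V \<inter> topspace X)"
    using openin_continuous_map_preimage[OF inverse_pair_continuous[OF fg] V(1)] by (simp add: vimage_def Int_def conj_commute)
  moreover have "f -` V \<inter> topspace X - B = f -` (V - B) \<inter> topspace X" using inv by blast
  moreover have "emeasure \<mu> (f -` (V - B) \<inter> topspace X) = 0"
    using V B by (intro null_preimage[OF fg]) auto
  ultimately have "openin X (f -` V \<inter> topspace X) \<and> p \<in> f -` V \<inter> topspace X \<and> emeasure \<mu> (f -` V \<inter> topspace X - B) = 0"
    using p(1) V(2) by simp
  then show ?thesis unfolding full_def using p(1) by blast
qed

lemma full_invariant:
  assumes fg: "inverse_pair f g" and B: "B \<in> sets borelX" and inv: "f -` B \<inter> topspace X = B" and p: "p \<in> topspace X"
  shows "f p \<in> full B \<longleftrightarrow> p \<in> full B"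
proof
  show "f p \<in> full B \<Longrightarrow> p \<in> full B" by (rule full_preimage[OF fg B inv p])
  note gf = inverse_pair_sym[OF fg]
  have fB: "f r \<in> B \<longleftrightarrow> r \<in> B" if "r \<in> topspace X" for r
  proof -
    have "r \<in> f -` B \<inter> topspace X \<longleftrightarrow> r \<in> B" by (simp only: inv)
    then show ?thesis using that by simp
  qed
  have ginv: "g -` B \<inter> topspace X = B"
  proof (rule set_eqI)
    fix q
    show "q \<in> g -` B \<inter> topspace X \<longleftrightarrow> q \<in> B"
    proof (cases "q \<in> topspace X")
      case True
      then show ?thesis
        using fB[OF inverse_pair_maps[OF gf True]] inverse_pair_inv[OF gf True] by simp
    next
      case False
      then show ?thesis using sets_subset[OF B] by (simp add: subset_iff) metis
    qed
  qed
  assume "p \<in> full B"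
  then show "f p \<in> full B"
    by (intro full_preimage[OF gf B ginv inverse_pair_maps[OF fg p]]) (simp add: inverse_pair_inv[OF fg p])
qed

text \<open>Generators are indexed by their role. If the same map serves in several roles, the neighbourhoods are intersected.\<close>
lemma C1a_robustlyI:
  assumes J: "finite J" and g: "\<And>j. j \<in> J \<Longrightarrow> openin (C1a_topology X A \<alpha>) (N j) \<and> g j \<in> N j"
    and P: "\<And>h. (\<And>j. j \<in> J \<Longrightarrow> h j \<in> N j) \<Longrightarrow> P (h ` J)"
  shows "C1a_robustly X A \<alpha> P (g ` J)"
proof -
  define U where "U = (\<lambda>k. \<Inter>j\<in>{j\<in>J. g j = k}. N j)"
  have "openin (C1a_topology X A \<alpha>) (U k) \<and> k \<in> U k" if "k \<in> g ` J" for k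
  proof
    have ne: "{j\<in>J. g j = k} \<noteq> {}" using that by blast
    show "openin (C1a_topology X A \<alpha>) (U k)" unfolding U_def using J g ne by (intro openin_INT2) auto
    show "k \<in> U k" unfolding U_def using g by auto
  qed
  moreover have "P (f ` g ` J)" if f: "\<forall>k\<in>g ` J. f k \<in> U k" for f
  proof -
    have "P ((\<lambda>j. f (g j)) ` J)" by (rule P) (use f in \<open>auto simp: U_def\<close>)
    then show ?thesis by (simp add: image_image)
  qed
  ultimately show ?thesis unfolding C1a_robustly_def by blast
qed

lemma subbasic_nhd:
  assumes "g \<in> C1a_diffeo X A \<alpha>" "c \<in> A" "d \<in> A" "compactin X K" "K \<subseteq> fst c" "g ` K \<subseteq> fst d" "\<epsilon> > 0"
  shows "openin (C1a_topology X A \<alpha>) (C1a_subbasic_nhd X A \<alpha> g c d K \<epsilon>) \<and> g \<in> C1a_subbasic_nhd X A \<alpha> g c d K \<epsilon>"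
proof
  show "openin (C1a_topology X A \<alpha>) (C1a_subbasic_nhd X A \<alpha> g c d K \<epsilon>)"
    unfolding C1a_topology_def by (rule topology_generated_by_Basis) (use assms in blast)
  show "g \<in> C1a_subbasic_nhd X A \<alpha> g c d K \<epsilon>"
    unfolding C1a_subbasic_nhd_def Let_def using assms by (auto intro!: exI[of _ 0])
qed

lemma subbasic_nhdD:
  assumes f: "f \<in> C1a_subbasic_nhd X A \<alpha> g c d K \<epsilon>"
  shows "f \<in> C1a_diffeo X A \<alpha>" "f ` K \<subseteq> fst d"
    and "p \<in> K \<Longrightarrow> norm (coord_rep c d f (snd c p) - coord_rep c d g (snd c p)) < \<epsilon>"
    and "p \<in> K \<Longrightarrow> norm (jacobian (coord_rep c d f) (at (snd c p)) - jacobian (coord_rep c d g) (at (snd c p))) < \<epsilon>"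
proof -
  note f' = f[unfolded C1a_subbasic_nhd_def Let_def mem_Collect_eq]
  from f' show "f \<in> C1a_diffeo X A \<alpha>" by (rule conjunct1)
  from f' have "f ` K \<subseteq> fst d \<and> (\<exists>\<delta><\<epsilon>. (\<forall>x\<in>snd c ` K. norm (coord_rep c d f x - coord_rep c d g x) \<le> \<delta> \<and>
      norm (jacobian (coord_rep c d f) (at x) - jacobian (coord_rep c d g) (at x)) \<le> \<delta>) \<and>
      (\<forall>x\<in>snd c ` K. \<forall>y\<in>snd c ` K. norm (jacobian (coord_rep c d f) (at x) - jacobian (coord_rep c d g) (at x) -
        (jacobian (coord_rep c d f) (at y) - jacobian (coord_rep c d g) (at y))) \<le> \<delta> * dist x y powr \<alpha>))"
    by (rule conjunct2)
  note f2 = this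
  from f2 show "f ` K \<subseteq> fst d" by (rule conjunct1)
  from f2[THEN conjunct2] obtain \<delta> where \<delta>: "\<delta> < \<epsilon>"
    and b: "\<forall>x\<in>snd c ` K. norm (coord_rep c d f x - coord_rep c d g x) \<le> \<delta> \<and>
      norm (jacobian (coord_rep c d f) (at x) - jacobian (coord_rep c d g) (at x)) \<le> \<delta>"
    by (elim exE conjE)
  assume "p \<in> K"
  then have "snd c p \<in> snd c ` K" by (rule imageI)
  note b' = bspec[OF b this]
  show "norm (coord_rep c d f (snd c p) - coord_rep c d g (snd c p)) < \<epsilon>"
    by (rule le_less_trans[OF b'[THEN conjunct1] \<delta>])
  show "norm (jacobian (coord_rep c d f) (at (snd c p)) - jacobian (coord_rep c d g) (at (snd c p))) < \<epsilon>"
    by (rule le_less_trans[OF b'[THEN conjunct2] \<delta>])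
qed

text \<open>The diffeomorphism that carries a point into \<open>D\<close> also carries a compact neighbourhood \<open>K\<close> of it into \<open>D\<close>,
  and so do its small perturbations. Finitely many such neighbourhoods cover the manifold.\<close>
lemma transport_generators:
  assumes D: "openin X D" "D \<noteq> {}" and d: "d \<in> A" "D \<subseteq> fst d" and \<alpha>: "0 < \<alpha>" "\<alpha> \<le> 1"
  obtains P :: "'a set" and g N where "finite P"
    "\<And>p. p \<in> P \<Longrightarrow> openin (C1a_topology X A \<alpha>) (N p) \<and> g p \<in> N p \<and> g p \<in> C1a_diffeo X A \<alpha> \<and> N p \<subseteq> C1a_diffeo X A \<alpha>"
    "\<forall>f q. (\<forall>p\<in>P. f p \<in> N p) \<longrightarrow> q \<in> topspace X \<longrightarrow> (\<exists>p\<in>P. f p q \<in> D)"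
proof -
  have "\<exists>g N V. openin X V \<and> p \<in> V \<and> openin (C1a_topology X A \<alpha>) N \<and> g \<in> N \<and> g \<in> C1a_diffeo X A \<alpha> \<and> N \<subseteq> C1a_diffeo X A \<alpha> \<and>
      (\<forall>f\<in>N. f ` V \<subseteq> D)" if p: "p \<in> topspace X" for p
  proof -
    obtain g g' where gg: "diffeo_pair \<alpha> g g'" "g p \<in> D" using diffeo_transitive[OF D p \<alpha>] by blast
    have gd: "g \<in> C1a_diffeo X A \<alpha>" by (rule diffeo_pair_imp_C1a_diffeo[OF gg(1) \<alpha>(1)])
    have gc: "continuous_map X X g" using gg by (simp add: diffeo_pair_def C1a_mfd_def)
    obtain c where c: "c \<in> A" "p \<in> fst c" using chart_exists[OF p] by blast
    define W where "W = fst c \<inter> {q \<in> topspace X. g q \<in> D}"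
    have "openin X W" unfolding W_def by (intro openin_Int chart_openin[OF c(1)] openin_continuous_map_preimage[OF gc D(1)])
    then have "open (snd c ` W)" by (rule chart_image_open[OF c(1)]) (auto simp: W_def)
    moreover have "snd c p \<in> snd c ` W" using p c gg by (auto simp: W_def)
    ultimately obtain e where e: "e > 0" "cball (snd c p) e \<subseteq> snd c ` W" by (meson open_contains_cball)
    have sub: "cball (snd c p) e \<subseteq> snd c ` fst c" using e by (auto simp: W_def)
    define K where "K = chart_inv c ` cball (snd c p) e"
    have KW: "K \<subseteq> W"
    proof
      fix q assume "q \<in> K"
      then obtain x where x: "x \<in> cball (snd c p) e" "q = chart_inv c x" unfolding K_def by blast
      then obtain q' where q': "q' \<in> W" "x = snd c q'" using e by blast
      then have "q = q'" using x c by (simp add: W_def)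
      then show "q \<in> W" using q' by simp
    qed
    have K: "compactin X K" unfolding K_def by (rule chart_inv_image_compact[OF c(1) compact_cball sub])
    have Kc: "K \<subseteq> fst c" "g ` K \<subseteq> D" using KW by (auto simp: W_def)
    have "compactin (subtopology X (fst d)) (g ` K)"
      using image_compactin[OF K gc] Kc d by (simp add: compactin_subtopology)
    then have "compactin euclidean (snd d ` (g ` K))" by (rule image_compactin[OF _ chart_continuous[OF d(1)]])
    then have cp: "compact (snd d ` (g ` K))" by simp
    have oD: "open (snd d ` D)" by (rule chart_image_open[OF d(1) D(1) d(2)])
    have "snd d ` (g ` K) \<subseteq> snd d ` D" using Kc by blast
    then obtain \<epsilon> where \<epsilon>: "\<epsilon> > 0" "(\<Union>x\<in>snd d ` (g ` K). ball x \<epsilon>) \<subseteq> snd d ` D"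
      using compact_subset_open_imp_ball_epsilon_subset[OF cp oD] by blast
    define N where "N = C1a_subbasic_nhd X A \<alpha> g c d K \<epsilon>"
    define V where "V = chart_inv c ` ball (snd c p) e"
    have N: "openin (C1a_topology X A \<alpha>) N \<and> g \<in> N"
      unfolding N_def using Kc d(2) by (intro subbasic_nhd[OF gd c(1) d(1) K _ _ \<epsilon>(1)]) auto
    have "openin X V" unfolding V_def using sub by (intro chart_inv_image_open[OF c(1)]) auto
    moreover have "p \<in> V" unfolding V_def using c e by (intro image_eqI[of _ _ "snd c p"]) auto
    moreover have "N \<subseteq> C1a_diffeo X A \<alpha>" unfolding N_def using subbasic_nhdD(1) by (rule subsetI)
    moreover have "f ` V \<subseteq> D" if f: "f \<in> N" for f
    proof
      fix y assume "y \<in> f ` V"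
      moreover have "V \<subseteq> K" unfolding V_def K_def by (intro image_mono ball_subset_cball)
      ultimately obtain q where q: "q \<in> K" "y = f q" by blast
      note fN = f[unfolded N_def]
      have fK: "f ` K \<subseteq> fst d" by (rule subbasic_nhdD(2)[OF fN])
      have "norm (coord_rep c d f (snd c q) - coord_rep c d g (snd c q)) < \<epsilon>" by (rule subbasic_nhdD(3)[OF fN q(1)])
      then have "snd d (f q) \<in> ball (snd d (g q)) \<epsilon>"
        using q Kc c by (auto simp: coord_rep_def dist_norm norm_minus_commute subset_iff)
      then have "snd d (f q) \<in> snd d ` D" using \<epsilon>(2) q by blast
      then obtain q' where q': "q' \<in> D" "snd d (f q) = snd d q'" by blast
      have "f q \<in> fst d" "q' \<in> fst d" using fK q q' d by auto
      then have "f q = q'" using chart_inj[OF d(1)] q'(2) by (auto dest: inj_onD)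
      then show "y \<in> D" using q q' by simp
    qed
    ultimately show ?thesis using N gd by blast
  qed
  then obtain g N V where V: "\<And>p. p \<in> topspace X \<Longrightarrow> openin X (V p) \<and> p \<in> V p"
    and N: "\<And>p. p \<in> topspace X \<Longrightarrow> openin (C1a_topology X A \<alpha>) (N p) \<and> g p \<in> N p \<and> g p \<in> C1a_diffeo X A \<alpha> \<and> N p \<subseteq> C1a_diffeo X A \<alpha>"
    and NV: "\<And>p f. p \<in> topspace X \<Longrightarrow> f \<in> N p \<Longrightarrow> f ` V p \<subseteq> D"
    by metis
  obtain P where P: "P \<subseteq> topspace X" "finite P" "topspace X \<subseteq> (\<Union>p\<in>P. V p)"
    using finite_subcover[of V] V by blast
  show thesis
  proof (rule that[of P N g])
    show "finite P" by fact
    show "openin (C1a_topology X A \<alpha>) (N p) \<and> g p \<in> N p \<and> g p \<in> C1a_diffeo X A \<alpha> \<and> N p \<subseteq> C1a_diffeo X A \<alpha>" if "p \<in> P" for p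
      using N that P by blast
    show "\<forall>f q. (\<forall>p\<in>P. f p \<in> N p) \<longrightarrow> q \<in> topspace X \<longrightarrow> (\<exists>p\<in>P. f p q \<in> D)"
    proof (intro allI impI)
      fix f q assume f: "\<forall>p\<in>P. f p \<in> N p" and q: "q \<in> topspace X"
      then obtain p where p: "p \<in> P" "q \<in> V p" using P by blast
      then show "\<exists>p\<in>P. f p q \<in> D" using NV[of p "f p"] f P by blast
    qed
  qed
qed

end

section \<open>Robust ergodicity on surfaces\<close>

locale riemannian_surface = riemannian_manifold X A G
  for X :: "'a topology" and A :: "('a, 2) chart set" and G :: "('a, 2) chart \<Rightarrow> 'a \<Rightarrow> real ^ 2 ^ 2"
begin

text \<open>Both the deviation of a kick from the affine contraction and the size of the perturbation
  are at most \<open>1/200\<close>, relative to the scale \<open>s\<close>.\<close>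
lemma perturbed_kicks_near_affine:
  assumes c: "c \<in> A" and s: "s > 0" and sub: "cball z (100 * s) \<subseteq> snd c ` fst c" and \<alpha>: "0 < \<alpha>" "\<alpha> \<le> 1"
    and T: "\<And>i x. i \<in> centers \<Longrightarrow> x \<in> snd c ` fst c \<Longrightarrow>
      T i (chart_inv c x) = chart_inv c (kick_at z s (-1/10) i x)"
    and T': "\<And>i x. i \<in> centers \<Longrightarrow> x \<in> snd c ` fst c \<Longrightarrow> kick_at z s (-1/10) i x \<in> snd c ` fst c"
    and f: "\<And>i. i \<in> centers \<Longrightarrow> f i \<in> C1a_subbasic_nhd X A \<alpha> (T i) c c (chart_inv c ` cball z (4 * s)) (min (s/200) (1/200))"
  shows "\<exists>C. near_affine_ifs z s \<alpha> C (\<lambda>i. coord_rep c c (f i)) (\<lambda>i y. jacobian (coord_rep c c (f i)) (at y))"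
proof -
  let ?F = "\<lambda>i. coord_rep c c (f i)" and ?H = "\<lambda>i. coord_rep c c (T i)"
  let ?Q = "cball z (4 * s)" and ?S = "snd c ` fst c"
  have QS: "?Q \<subseteq> ?S" using sub s by auto
  have So: "open ?S" by (rule chart_open_image[OF c])
  have H: "?H i x = kick_at z s (-1/10) i x" if "i \<in> centers" "x \<in> ?S" for i x
    using T[OF that] T'[OF that] by (simp add: coord_rep_def chart_f_inv)
  have m: "\<bar>-1/10\<bar> \<le> (1/10::real)" by simp
  have w: "norm i \<le> 1" if "i \<in> centers" for i using norm_center[OF that] by simp
  have small: "norm ((1/s) *\<^sub>R (y - z)) \<le> 4" if "y \<in> ?Q" for y
  proof -
    have "norm ((1/s) *\<^sub>R (y - z)) = dist z y / s" using s by (simp add: dist_norm norm_minus_commute divide_inverse)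
    also have "\<dots> \<le> 4" using that s by (simp add: divide_le_eq)
    finally show ?thesis .
  qed
  have dH: "(?H i has_derivative (\<lambda>v. s *\<^sub>R kick' (-1/10) i ((1/s) *\<^sub>R (y - z)) ((1/s) *\<^sub>R v))) (at y)"
    if i: "i \<in> centers" and y: "y \<in> ?S" for i y
  proof (rule has_derivative_transform_within_open[OF _ So y])
    have a: "((\<lambda>x. (1/s) *\<^sub>R (x - z)) has_derivative (\<lambda>v. (1/s) *\<^sub>R v)) (at y)"
      by (auto intro!: derivative_eq_intros)
    have "((\<lambda>x. kick (-1/10) i ((1/s) *\<^sub>R (x - z))) has_derivative (\<lambda>v. kick' (-1/10) i ((1/s) *\<^sub>R (y - z)) ((1/s) *\<^sub>R v))) (at y)"
      by (rule has_derivative_compose[OF a kick_has_derivative])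
    then have "((\<lambda>x. s *\<^sub>R kick (-1/10) i ((1/s) *\<^sub>R (x - z))) has_derivative (\<lambda>v. s *\<^sub>R kick' (-1/10) i ((1/s) *\<^sub>R (y - z)) ((1/s) *\<^sub>R v))) (at y)"
      by (rule has_derivative_scaleR_right)
    then show "((\<lambda>x. kick_at z s (-1/10) i x) has_derivative (\<lambda>v. s *\<^sub>R kick' (-1/10) i ((1/s) *\<^sub>R (y - z)) ((1/s) *\<^sub>R v))) (at y)"
      using has_derivative_add[OF has_derivative_const[of z]] by fastforce
    show "\<And>x. x \<in> ?S \<Longrightarrow> kick_at z s (-1/10) i x = ?H i x" using H[OF i] by simp
  qed
  have jH: "jacobian (?H i) (at y) *v v = s *\<^sub>R kick' (-1/10) i ((1/s) *\<^sub>R (y - z)) ((1/s) *\<^sub>R v)"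
    if i: "i \<in> centers" and y: "y \<in> ?S" for i y v
  proof -
    have "?H i differentiable (at y)" using dH[OF i y] by (rule differentiableI)
    then have "(?H i has_derivative (\<lambda>v. jacobian (?H i) (at y) *v v)) (at y)" by (simp only: jacobian_works)
    from has_derivative_unique[OF this dH[OF i y]] show ?thesis by (rule fun_cong)
  qed
  have pt: "\<exists>p\<in>chart_inv c ` ?Q. y = snd c p" if "y \<in> ?Q" for y
    using that QS chart_f_inv[of y c] by (intro bexI[of _ "chart_inv c y"]) auto
  have near1: "norm (?F i y - ?H i y) \<le> s/200" and near2: "norm (jacobian (?F i) (at y) - jacobian (?H i) (at y)) \<le> 1/200"
    if i: "i \<in> centers" and y: "y \<in> ?Q" for i y
  proof -
    obtain p where p: "p \<in> chart_inv c ` ?Q" "y = snd c p" using pt[OF y] by blast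
    show "norm (?F i y - ?H i y) \<le> s/200" using subbasic_nhdD(3)[OF f[OF i] p(1)] p(2) by simp
    show "norm (jacobian (?F i) (at y) - jacobian (?H i) (at y)) \<le> 1/200" using subbasic_nhdD(4)[OF f[OF i] p(1)] p(2) by simp
  qed
  have dom: "y \<in> coord_dom c c (f i)" if i: "i \<in> centers" and y: "y \<in> ?Q" for i y
  proof -
    have "f i (chart_inv c y) \<in> fst c" using subbasic_nhdD(2)[OF f[OF i]] y by blast
    then show ?thesis using y QS by (auto simp: coord_dom_iff[OF c])
  qed
  have fd: "f i \<in> C1a_diffeo X A \<alpha>" if "i \<in> centers" for i by (rule subbasic_nhdD(1)[OF f[OF that]])
  have fm: "C1a_map X A \<alpha> (f i)" if "i \<in> centers" for i using fd[OF that] by (simp add: C1a_diffeo_def)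
  have "\<exists>C. \<forall>y\<in>?Q. \<forall>y'\<in>?Q. norm (jacobian (?F i) (at y) - jacobian (?F i) (at y')) \<le> C * dist y y' powr \<alpha>" if i: "i \<in> centers" for i
  proof -
    have "?Q \<subseteq> coord_dom c c (f i)" using dom[OF i] by blast
    then show ?thesis using fm[OF i] c compact_cball[of z "4 * s"] unfolding C1a_map_def Let_def by blast
  qed
  then obtain C where C: "\<And>i y y'. i \<in> centers \<Longrightarrow> y \<in> ?Q \<Longrightarrow> y' \<in> ?Q \<Longrightarrow>
      norm (jacobian (?F i) (at y) - jacobian (?F i) (at y')) \<le> C i * dist y y' powr \<alpha>" by metis
  define C0 where "C0 = (\<Sum>i\<in>centers. \<bar>C i\<bar>)"
  have C0: "C i \<le> C0" if "i \<in> centers" for i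
    using member_le_sum[of i centers "\<lambda>i. \<bar>C i\<bar>"] that finite_centers unfolding C0_def by fastforce
  have "near_affine_ifs z s \<alpha> C0 ?F (\<lambda>i y. jacobian (?F i) (at y))"
  proof
    show "0 < s" "0 < \<alpha>" "\<alpha> \<le> 1" by fact+
    show "0 \<le> C0" unfolding C0_def by (intro sum_nonneg) auto
    fix i assume i: "i \<in> centers"
    show "inj_on (?F i) ?Q"
    proof (rule inj_onI)
      fix y y' assume y: "y \<in> ?Q" "y' \<in> ?Q" and e: "?F i y = ?F i y'"
      have yS: "y \<in> ?S" "y' \<in> ?S" using y QS by auto
      have "f i (chart_inv c y) \<in> fst c" "f i (chart_inv c y') \<in> fst c"
        using dom[OF i] y by (auto simp: coord_dom_iff[OF c])
      then have "f i (chart_inv c y) = f i (chart_inv c y')"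
        using e chart_inj[OF c] by (auto simp: coord_rep_def dest: inj_onD)
      moreover have "inj_on (f i) (topspace X)" using fd[OF i] by (simp add: C1a_diffeo_def bij_betw_def)
      ultimately have "chart_inv c y = chart_inv c y'"
        using chart_inv_top[OF c yS(1)] chart_inv_top[OF c yS(2)] by (auto dest: inj_onD)
      then show "y = y'" using chart_f_inv[OF yS(1)] chart_f_inv[OF yS(2)] by metis
    qed
    fix y assume y: "y \<in> ?Q"
    then have yS: "y \<in> ?S" using QS by blast
    have "Ck_on 1 (coord_dom c c (f i)) (?F i)" using fm[OF i] c unfolding C1a_map_def Let_def by blast
    then show "(?F i has_derivative (\<lambda>v. jacobian (?F i) (at y) *v v)) (at y)"
      by (rule Ck_on_1_has_derivative[OF _ dom[OF i y]])
    let ?x = "(1/s) *\<^sub>R (y - z)"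
    have "norm (?F i y - (z + (9/10) *\<^sub>R (y - z) + s *\<^sub>R i)) \<le> norm (?F i y - ?H i y) + norm (?H i y - (z + (9/10) *\<^sub>R (y - z) + s *\<^sub>R i))"
      by (rule dist_triangle[where 'a = "real^2", unfolded dist_norm])
    also have "?H i y - (z + (9/10) *\<^sub>R (y - z) + s *\<^sub>R i) = s *\<^sub>R (kick (-1/10) i ?x - ((1 + -1/10) *\<^sub>R ?x + i))"
      unfolding H[OF i yS] using s by (simp add: scaleR_diff_right scaleR_add_right)
    also have "norm \<dots> \<le> s * (1/200)"
      using kick_affine(1)[OF m w[OF i] small[OF y]] s by simp
    finally show "norm (?F i y - (z + (9/10) *\<^sub>R (y - z) + s *\<^sub>R i)) \<le> s / 100" using near1[OF i y] by simp
    show "norm (jacobian (?F i) (at y) *v v - (9/10) *\<^sub>R v) \<le> 1/100 * norm v" for v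
    proof -
      have "norm (jacobian (?F i) (at y) *v v - (9/10) *\<^sub>R v)
          \<le> norm (jacobian (?F i) (at y) *v v - jacobian (?H i) (at y) *v v) + norm (jacobian (?H i) (at y) *v v - (9/10) *\<^sub>R v)"
        by (rule dist_triangle[where 'a = "real^2", unfolded dist_norm])
      also have "jacobian (?F i) (at y) *v v - jacobian (?H i) (at y) *v v = (jacobian (?F i) (at y) - jacobian (?H i) (at y)) *v v"
        by (simp add: matrix_vector_mult_diff_rdistrib)
      also have "norm \<dots> \<le> 1/200 * norm v"
        by (rule order_trans[OF norm_matrix_vector_le mult_right_mono[OF near2[OF i y] norm_ge_zero]])
      also have "jacobian (?H i) (at y) *v v - (9/10) *\<^sub>R v = s *\<^sub>R (kick' (-1/10) i ?x ((1/s) *\<^sub>R v) - (1 + -1/10) *\<^sub>R ((1/s) *\<^sub>R v))"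
        unfolding jH[OF i yS] using s by (simp add: scaleR_diff_right)
      also have "norm \<dots> \<le> s * (1/200 * norm ((1/s) *\<^sub>R v))"
        using mult_left_mono[OF kick_affine(2)[OF m w[OF i] small[OF y], of "(1/s) *\<^sub>R v"] less_imp_le[OF s]]
        by (simp only: norm_scaleR abs_of_pos[OF s])
      also have "\<dots> = 1/200 * norm v" using s by simp
      finally show ?thesis by simp
    qed
    fix y' assume y': "y' \<in> ?Q"
    show "norm (jacobian (?F i) (at y) - jacobian (?F i) (at y')) \<le> C0 * dist y y' powr \<alpha>"
      using C[OF i y y'] C0[OF i] by (meson mult_right_mono order_trans powr_ge_zero)
  qed
  then show ?thesis by blast
qed

text \<open>In the chart, the full ball provided by \<open>near_affine_ifs.full_ball\<close> is spread over the disc by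
  \<open>near_affine_ifs.reach\<close>, applied to the open invariant set \<open>full B\<close>.\<close>
lemma invariant_set_full_on_disc:
  assumes c: "c \<in> A" and sub: "cball z (100 * s) \<subseteq> snd c ` fst c"
    and ifs: "near_affine_ifs z s \<alpha> C (\<lambda>i. coord_rep c c (f i)) J"
    and f: "\<And>i. i \<in> centers \<Longrightarrow> inverse_pair (f i) (f' i)"
    and fK: "\<And>i. i \<in> centers \<Longrightarrow> f i ` (chart_inv c ` cball z (4 * s)) \<subseteq> fst c"
    and B: "B \<in> sets borelX" and inv: "\<And>i. i \<in> centers \<Longrightarrow> f i -` B \<inter> topspace X = B"
    and pos: "emeasure \<mu> (B \<inter> chart_inv c ` ball z s) \<noteq> 0"
  shows "chart_inv c ` ball z s \<subseteq> full B"
proof -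
  interpret near_affine_ifs z s \<alpha> C "\<lambda>i. coord_rep c c (f i)" J by (rule ifs)
  let ?S = "snd c ` fst c"
  define B' where "B' = snd c ` (B \<inter> fst c)"
  have B': "B' \<in> sets borel"
    unfolding B'_def using B chart_dom_sets[OF c] by (intro chart_image_borel[OF c]) auto
  have mem: "snd c p \<in> snd c ` (M \<inter> fst c) \<longleftrightarrow> p \<in> M" if "p \<in> fst c" for p M
    using inj_on_image_mem_iff[OF chart_inj[OF c] that, of "M \<inter> fst c"] that by simp
  \<comment> \<open>Invariance of a set \<open>M\<close> under \<open>f i\<close>, read in the chart; this is used for \<open>B\<close> and for \<open>full B\<close>.\<close>
  have orbit: "coord_rep c c (f i) y \<in> snd c ` (M \<inter> fst c) \<longleftrightarrow> y \<in> snd c ` (M \<inter> fst c)"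
    if i: "i \<in> centers" and y: "y \<in> cball z (4 * s)"
      and M: "\<And>p. p \<in> topspace X \<Longrightarrow> f i p \<in> M \<longleftrightarrow> p \<in> M" for i y M
  proof -
    have yS: "y \<in> ?S" using y sub s by auto
    have "coord_rep c c (f i) y = snd c (f i (chart_inv c y))" by (simp add: coord_rep_def)
    moreover have "f i (chart_inv c y) \<in> fst c" using fK[OF i] y by blast
    ultimately have "coord_rep c c (f i) y \<in> snd c ` (M \<inter> fst c) \<longleftrightarrow> f i (chart_inv c y) \<in> M" using mem by simp
    also have "\<dots> \<longleftrightarrow> chart_inv c y \<in> M" by (rule M[OF chart_inv_top[OF c yS]])
    also have "\<dots> \<longleftrightarrow> y \<in> snd c ` (M \<inter> fst c)"
      using mem[OF chart_inv_in[OF yS], of M] chart_f_inv[OF yS] by simp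
    finally show ?thesis .
  qed
  have Binv: "f i p \<in> B \<longleftrightarrow> p \<in> B" if "i \<in> centers" "p \<in> topspace X" for i p
  proof -
    have "p \<in> f i -` B \<inter> topspace X \<longleftrightarrow> p \<in> B" by (simp only: inv[OF that(1)])
    then show ?thesis using that(2) by simp
  qed
  have bS: "ball z s \<subseteq> ?S" using sub s by auto
  have im: "snd c ` chart_inv c ` R = R" if "R \<subseteq> ?S" for R
  proof -
    have "snd c ` chart_inv c ` R = (\<lambda>x. x) ` R"
      unfolding image_image by (intro image_cong refl chart_f_inv subsetD[OF that])
    then show ?thesis by simp
  qed
  have D: "openin X (chart_inv c ` ball z s)" by (rule chart_inv_image_open[OF c open_ball bS])
  have DU: "chart_inv c ` ball z s \<subseteq> fst c" by (rule chart_inv_image_subset[OF bS])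
  have "snd c ` (B \<inter> chart_inv c ` ball z s) = B' \<inter> ball z s"
  proof -
    have "snd c ` (B \<inter> chart_inv c ` ball z s) = snd c ` ((B \<inter> fst c) \<inter> chart_inv c ` ball z s)" using DU by (intro arg_cong[of _ _ "(`) (snd c)"]) blast
    also have "\<dots> = snd c ` (B \<inter> fst c) \<inter> snd c ` chart_inv c ` ball z s"
      by (rule inj_on_image_Int[OF chart_inj[OF c]]) (use DU in auto)
    finally show ?thesis unfolding B'_def im[OF bS] .
  qed
  moreover have "emeasure lborel (snd c ` (B \<inter> chart_inv c ` ball z s)) \<noteq> 0"
    using pos \<mu>_null_iff[OF c, of "B \<inter> chart_inv c ` ball z s"] B D DU by auto
  ultimately have pos': "emeasure lborel (B' \<inter> ball z s) > 0" by (simp add: zero_less_iff_neq_zero)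
  have "\<exists>x\<in>cball z s. \<exists>r>0. emeasure lborel (ball x r - B') = 0"
  proof (rule full_ball[OF B' _ pos'])
    fix i y assume i: "i \<in> centers" and y: "y \<in> cball z s"
    show "coord_rep c c (f i) y \<in> B' \<longleftrightarrow> y \<in> B'"
      unfolding B'_def by (rule orbit[OF i]) (use y s Binv[OF i] in auto)
  qed
  then obtain x r where x: "x \<in> cball z s" "r > 0" "emeasure lborel (ball x r - B') = 0" by blast
  \<comment> \<open>Shrinking the radius keeps the ball inside the chart.\<close>
  define r' where "r' = min r s"
  have r': "r' > 0" "r' \<le> r" "r' \<le> s" unfolding r'_def using x s by auto
  have sub': "ball x r' \<subseteq> ?S"
  proof
    fix y assume "y \<in> ball x r'"
    then have "y \<in> cball z (100 * s)" using dist_triangle[of z y x] x(1) r' s by auto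
    then show "y \<in> ?S" using sub by blast
  qed
  define V where "V = chart_inv c ` ball x r'"
  have V: "openin X V" unfolding V_def by (rule chart_inv_image_open[OF c open_ball sub'])
  have VU: "V \<subseteq> fst c" unfolding V_def by (rule chart_inv_image_subset[OF sub'])
  have "snd c ` (V - B) = ball x r' - B'"
  proof -
    have "snd c ` (V - B) = snd c ` (V - B \<inter> fst c)" using VU by (intro arg_cong[of _ _ "(`) (snd c)"]) blast
    also have "\<dots> = snd c ` V - snd c ` (B \<inter> fst c)"
      by (rule inj_on_image_set_diff[OF chart_inj[OF c]]) (use VU in auto)
    finally show ?thesis unfolding V_def B'_def im[OF sub'] .
  qed
  moreover have "emeasure lborel (ball x r' - B') = 0"
  proof -
    have "emeasure lborel (ball x r' - B') \<le> emeasure lborel (ball x r - B')"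
      using r' B' by (intro emeasure_mono) auto
    then show ?thesis using x(3) by simp
  qed
  ultimately have "emeasure \<mu> (V - B) = 0"
    using \<mu>_null_iff[OF c, of "V - B"] V VU B by auto
  then have Vf: "V \<subseteq> full B" by (rule open_subset_full[OF V])
  have "cball z s \<subseteq> snd c ` (full B \<inter> fst c)"
  proof (rule reach[OF x(1) r'(1)])
    have "snd c ` V \<subseteq> snd c ` (full B \<inter> fst c)" using Vf VU by blast
    then show "ball x r' \<subseteq> snd c ` (full B \<inter> fst c)" unfolding V_def im[OF sub'] .
    fix i y assume i: "i \<in> centers" and y: "y \<in> cball z (3 * s)"
      and h: "coord_rep c c (f i) y \<in> snd c ` (full B \<inter> fst c)"
    have "y \<in> cball z (4 * s)" using y s by auto
    from orbit[OF i this full_invariant[OF f[OF i] B inv[OF i]]] h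
    show "y \<in> snd c ` (full B \<inter> fst c)" by blast
  qed
  then have cov: "ball z s \<subseteq> snd c ` (full B \<inter> fst c)" using ball_subset_cball by blast
  show ?thesis
  proof
    fix q assume "q \<in> chart_inv c ` ball z s"
    then obtain y where y: "y \<in> ball z s" "q = chart_inv c y" by blast
    then obtain p where p: "p \<in> full B" "p \<in> fst c" "y = snd c p" using cov by blast
    then show "q \<in> full B" using y(2) chart_inv_f[OF c p(2)] by simp
  qed
qed

theorem robustly_ergodic_generators:
  assumes \<alpha>: "0 < \<alpha>" "\<alpha> \<le> 1"
  shows "\<exists>S. finite S \<and> S \<subseteq> C1a_diffeo X A \<alpha> \<and> C1a_robustly X A \<alpha> (action_group_term_ergodic X \<mu>) S"
proof -
  obtain p0 c where c: "c \<in> A" "p0 \<in> fst c" using nonempty chart_exists by blast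
  define z where "z = snd c p0"
  obtain e where e: "e > 0" "cball z e \<subseteq> snd c ` fst c"
    using chart_open_image[OF c(1)] c(2) unfolding z_def by (meson open_contains_cball image_eqI)
  \<comment> \<open>The generators may differ from the identity in the ball of radius \<open>100 s\<close>.\<close>
  define s where "s = e / 100"
  have s: "s > 0" and sub: "cball z (100 * s) \<subseteq> snd c ` fst c" using e unfolding s_def by auto
  have "\<exists>T T'. diffeo_pair \<alpha> T T' \<and> (\<forall>x\<in>snd c ` fst c. T (chart_inv c x) = chart_inv c (kick_at z s (-1/10) i x) \<and>
      kick_at z s (-1/10) i x \<in> snd c ` fst c)" if i: "i \<in> centers" for i
  proof -
    have mw: "\<bar>-1/10\<bar> \<le> (1/10::real)" "norm i \<le> 1" using norm_center[OF i] by auto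
    obtain f g where fg: "diffeo_pair \<alpha> f g"
      "\<And>x. x \<in> snd c ` fst c \<Longrightarrow> f (chart_inv c x) = chart_inv c (kick_at z s (-1/10) i x)"
      "\<And>x. x \<in> snd c ` fst c \<Longrightarrow> kick_at z s (-1/10) i x \<in> snd c ` fst c"
      by (rule kick_diffeo[OF c(1) s sub mw \<alpha>]) (rule that)
    then show ?thesis by (intro exI[of _ f] exI[of _ g] conjI ballI)
  qed
  then obtain T T' where TT: "\<And>i. i \<in> centers \<Longrightarrow> diffeo_pair \<alpha> (T i) (T' i)"
    and T: "\<And>i x. i \<in> centers \<Longrightarrow> x \<in> snd c ` fst c \<Longrightarrow> T i (chart_inv c x) = chart_inv c (kick_at z s (-1/10) i x)"
    and T2: "\<And>i x. i \<in> centers \<Longrightarrow> x \<in> snd c ` fst c \<Longrightarrow> kick_at z s (-1/10) i x \<in> snd c ` fst c"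
    by metis
  have Td: "T i \<in> C1a_diffeo X A \<alpha>" if "i \<in> centers" for i by (rule diffeo_pair_imp_C1a_diffeo[OF TT[OF that] \<alpha>(1)])
  define K where "K = chart_inv c ` cball z (4 * s)"
  define NT where "NT = (\<lambda>i. C1a_subbasic_nhd X A \<alpha> (T i) c c K (min (s/200) (1/200)))"
  have QS: "cball z (4 * s) \<subseteq> snd c ` fst c" using sub s by auto
  have Kc: "compactin X K" unfolding K_def by (rule chart_inv_image_compact[OF c(1) compact_cball QS])
  have KU: "K \<subseteq> fst c" unfolding K_def by (rule chart_inv_image_subset[OF QS])
  have TK: "T i ` K \<subseteq> fst c" if "i \<in> centers" for i
  proof
    fix q assume "q \<in> T i ` K"
    then obtain x where x: "x \<in> cball z (4 * s)" "q = T i (chart_inv c x)" unfolding K_def by blast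
    then have xS: "x \<in> snd c ` fst c" using QS by blast
    show "q \<in> fst c" unfolding x(2) T[OF that xS] by (rule chart_inv_in[OF T2[OF that xS]])
  qed
  have NT: "openin (C1a_topology X A \<alpha>) (NT i) \<and> T i \<in> NT i" if "i \<in> centers" for i
    unfolding NT_def using s by (intro subbasic_nhd[OF Td[OF that] c(1) c(1) Kc KU TK[OF that]]) auto
  define D where "D = chart_inv c ` ball z s"
  have bS: "ball z s \<subseteq> snd c ` fst c" using sub s by auto
  have D: "openin X D" "D \<noteq> {}" "D \<subseteq> fst c"
    unfolding D_def using chart_inv_image_open[OF c(1) open_ball bS] chart_inv_image_subset[OF bS] s by (simp_all)
  obtain P :: "'a set" and g NP where P: "finite P"
    and NP: "\<And>p. p \<in> P \<Longrightarrow> openin (C1a_topology X A \<alpha>) (NP p) \<and> g p \<in> NP p \<and> g p \<in> C1a_diffeo X A \<alpha> \<and> NP p \<subseteq> C1a_diffeo X A \<alpha>"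
    and hit: "\<forall>f q. (\<forall>p\<in>P. f p \<in> NP p) \<longrightarrow> q \<in> topspace X \<longrightarrow> (\<exists>p\<in>P. f p q \<in> D)"
    by (rule transport_generators[OF D(1,2) c(1) D(3) \<alpha>]) (rule that)
  \<comment> \<open>The roles of the generators: contractions on the left, transports on the right.\<close>
  define R :: "(real^2 + 'a) set" where "R = Inl ` centers \<union> Inr ` P"
  define gen where "gen = case_sum T g"
  define N where "N = case_sum NT NP"
  have finR: "finite R" unfolding R_def using finite_centers P by simp
  have genN: "openin (C1a_topology X A \<alpha>) (N j) \<and> gen j \<in> N j" if "j \<in> R" for j
    using that NT NP unfolding R_def N_def gen_def by auto
  have ergodic: "action_group_term_ergodic X \<mu> (f ` R)" if f: "\<And>j. j \<in> R \<Longrightarrow> f j \<in> N j" for f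
  proof -
    have fT: "f (Inl i) \<in> NT i" if "i \<in> centers" for i using f[of "Inl i"] that by (auto simp: R_def N_def)
    have fP: "f (Inr p) \<in> NP p" if "p \<in> P" for p using f[of "Inr p"] that by (auto simp: R_def N_def)
    have fTd: "f (Inl i) \<in> C1a_diffeo X A \<alpha>" if "i \<in> centers" for i
      using subbasic_nhdD(1) fT[OF that] unfolding NT_def by blast
    have fd: "f j \<in> C1a_diffeo X A \<alpha>" if "j \<in> R" for j
      using that fTd fP NP unfolding R_def by blast
    obtain C where ifs: "near_affine_ifs z s \<alpha> C (\<lambda>i. coord_rep c c (f (Inl i))) (\<lambda>i y. jacobian (coord_rep c c (f (Inl i))) (at y))"
      using perturbed_kicks_near_affine[OF c(1) s sub \<alpha> T T2, of "\<lambda>i. f (Inl i)"] fT unfolding NT_def K_def by blast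
    have pair: "inverse_pair (f j) (inv_into (topspace X) (f j))" if "j \<in> R" for j
      by (rule C1a_diffeo_inverse_pair[OF fd[OF that]])
    have Inl: "Inl i \<in> R" if "i \<in> centers" for i using that by (simp add: R_def)
    have Inr: "Inr p \<in> R" if "p \<in> P" for p using that by (simp add: R_def)
    have fK: "f (Inl i) ` (chart_inv c ` cball z (4 * s)) \<subseteq> fst c" if "i \<in> centers" for i
      using subbasic_nhdD(2)[OF fT[OF that, unfolded NT_def K_def]] .
    \<comment> \<open>A set that is full on \<open>D\<close> is full everywhere, because each point is sent into \<open>D\<close> by a transport.\<close>
    have spread: "emeasure \<mu> (topspace X - B) = 0"
      if B: "B \<in> sets borelX" and inv: "\<And>j. j \<in> R \<Longrightarrow> f j -` B \<inter> topspace X = B" and DB: "D \<subseteq> full B" for B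
    proof (rule full_eq_topspace[OF B], rule subsetI)
      fix q assume q: "q \<in> topspace X"
      then obtain p where p: "p \<in> P" "f (Inr p) q \<in> D" using hit[rule_format, of "\<lambda>p. f (Inr p)" q] fP by blast
      then have "f (Inr p) q \<in> full B" using DB by blast
      then show "q \<in> full B" using full_invariant[OF pair[OF Inr[OF p(1)]] B inv[OF Inr[OF p(1)]] q] by blast
    qed
    interpret prob_space \<mu> by (rule prob_\<mu>)
    show ?thesis
      unfolding action_group_term_ergodic_def term_ergodic_def
    proof (intro conjI ballI impI)
      show "prob_space \<mu>" by (rule prob_\<mu>)
      show "quasi_invariant (group_generators X (f ` R)) \<mu>" using fd by (intro quasi_invariant_diffeos) blast
      fix B assume "B \<in> sets \<mu>" and all: "\<forall>g\<in>group_generators X (f ` R). g -` B \<inter> space \<mu> = B"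
      then have B: "B \<in> sets borelX" by (simp add: sets_\<mu>)
      have inv: "f j -` B \<inter> topspace X = B" if "j \<in> R" for j
        using all that unfolding group_generators_def space_\<mu> by blast
      show "measure \<mu> B = 0 \<or> measure \<mu> B = 1"
      proof (cases "emeasure \<mu> (B \<inter> D) = 0")
        case True
        let ?B = "topspace X - B"
        have cB: "?B \<in> sets borelX" using B sets.compl_sets[of B borelX] by simp
        have cinv: "f j -` ?B \<inter> topspace X = ?B" if "j \<in> R" for j
        proof (rule set_eqI)
          fix q
          have "q \<in> f j -` B \<inter> topspace X \<longleftrightarrow> q \<in> B" by (simp only: inv[OF that])
          then show "q \<in> f j -` ?B \<inter> topspace X \<longleftrightarrow> q \<in> ?B"
            using inverse_pair_maps[OF pair[OF that], of q] by auto
        qed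
        have "D - ?B = B \<inter> D" using openin_subset[OF D(1)] by blast
        then have DB: "D \<subseteq> full ?B" using True by (intro open_subset_full[OF D(1)]) simp
        have "emeasure \<mu> (topspace X - ?B) = 0" by (rule spread[OF cB _ DB]) (rule cinv)
        moreover have "topspace X - ?B = B" using sets_subset[OF B] by blast
        ultimately show ?thesis by (simp add: measure_def)
      next
        case False
        have DB: "D \<subseteq> full B"
          unfolding D_def
          by (rule invariant_set_full_on_disc[OF c(1) sub ifs pair[OF Inl] fK B inv[OF Inl]]) (use False in \<open>auto simp: D_def\<close>)
        have "emeasure \<mu> (topspace X - B) = 0" by (rule spread[OF B _ DB]) (rule inv)
        then have "measure \<mu> (space \<mu> - B) = 0" by (simp add: measure_def space_\<mu>)
        then show ?thesis using prob_compl[of B] B by (simp add: sets_\<mu>)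
      qed
    qed
  qed
  have "C1a_robustly X A \<alpha> (action_group_term_ergodic X \<mu>) (gen ` R)"
  proof (rule C1a_robustlyI[OF finR])
    show "openin (C1a_topology X A \<alpha>) (N j) \<and> gen j \<in> N j" if "j \<in> R" for j by (rule genN[OF that])
    show "action_group_term_ergodic X \<mu> (h ` R)" if "\<And>j. j \<in> R \<Longrightarrow> h j \<in> N j" for h by (rule ergodic[OF that])
  qed
  moreover have "gen ` R \<subseteq> C1a_diffeo X A \<alpha>" using Td NP unfolding R_def gen_def by auto
  ultimately show ?thesis using finR by blast
qed

end

theorem corollary1p1:
  fixes \<alpha> :: real
    and X :: "'a topology"
    and A :: "('a, 2) chart set"
    and G :: "('a, 2) chart \<Rightarrow> 'a \<Rightarrow> real ^ 2 ^ 2"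
  assumes "0 < \<alpha>" and "\<alpha> \<le> 1"
    and "compact_connected_manifold X A"
    and "riemannian_metric A G"
  shows "\<exists>S. finite S \<and> S \<subseteq> C1a_diffeo X A \<alpha> \<and>
           C1a_robustly X A \<alpha> (action_group_term_ergodic X (normalized_volume X A G)) S"
proof -
  interpret riemannian_surface X A G
    by unfold_locales (use assms in auto)
  show ?thesis using assms(1,2) by (rule robustly_ergodic_generators)
qed

end
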